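(* Let $r\ge1$ and regard the contact algebra $K(2r+1)$ as a $W(1)$-module via $x\cdot D=[\Theta_K(x),D]$, where $\Theta_K(x_1^i\partial_1)=\frac12D_K(x_{2r+1}^i)$. Then $$K(2r+1)\cong\begin{cases}V(0)^{\oplus(p^{2r-1}-1)}\oplus V(p-1)^{\oplus p^{2r-1}}\oplus\Big(\bigoplus_{i=1}^{p-2}L(i)^{\oplus p^{2r-1}}\Big)\oplus L(p-1),&\text{if }2r+4\equiv0\pmod p,\\ V(0)^{\oplus p^{2r-1}}\oplus V(p-1)^{\oplus p^{2r-1}}\oplus\Big(\bigoplus_{i=1}^{p-2}L(i)^{\oplus p^{2r-1}}\Big),&\text{if }2r+4\not\equiv0\pmod p.\end{cases}$$ Consequently, $$[K(2r+1)]=\begin{cases}(2p^{2r-1}-1)[L(0)]+\sum_{i=1}^{p-2}p^{2r-1}[L(i)]+2p^{2r-1}[L(p-1)],&\text{if }2r+4\equiv0\pmod p,\\ 2p^{2r-1}[L(0)]+\sum_{i=1}^{p-2}p^{2r-1}[L(i)]+2p^{2r-1}[L(p-1)],&\text{if }2r+4\not\equiv0\pmod p.\end{cases}$$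
   Context: $\mathbb F$ is an algebraically closed field of characteristic $p>2$, $I=\{0,\dots,p-1\}$. $\mathcal A(2r+1)$ is the truncated polynomial algebra with basis $x^\alpha$, $\alpha\in I^{2r+1}$ ($x^\alpha x^\beta=x^{\alpha+\beta}$, $=0$ if outside $I^{2r+1}$), $\partial_i(x_j)=\delta_{ij}$. For $1\le i\le 2r$: $\sigma(i)=1$, $i'=i+r$ if $i\le r$; $\sigma(i)=-1$, $i'=i-r$ if $i>r$. For $f\in\mathcal A(2r+1)$, $D_K(f)=\sum_{i=1}^{2r+1}f_i\partial_i$ with $f_j=x_j\partial_{2r+1}(f)+\sigma(j')\partial_{j'}(f)$ ($j\le2r$) and $f_{2r+1}=2f-\sum_{j=1}^{2r}\sigma(j)x_jf_{j'}$. $\widetilde K(2r+1)=\mathrm{span}\{D_K(x^\alpha)\mid\alpha\in I^{2r+1}\}$ and $K(2r+1)=[\widetilde K(2r+1),\widetilde K(2r+1)]$. $W(1)$ is the Witt algebra with basis $x_1^i\partial_1$; $W(1)_{[i]}=\mathbb Fx_1^{i+1}\partial_1$, $W(1)_0=\bigoplus_{i\ge0}W(1)_{[i]}$, $W(1)_1=\bigoplus_{i\ge1}W(1)_{[i]}$. For $\lambda\in I$, $\mathbb F_\lambda$ is the one-dimensional $W(1)_0$-module with $x_1\partial_1$ acting by $\lambda$ and $W(1)_1$ by $0$; $V(\lambda)=u(W(1))\otimes_{u(W(1)_0)}\mathbb F_\lambda$ ($u$ = restricted enveloping algebra) and $L(\lambda)$ its unique simple quotient. $[M]$ is the formal sum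 of composition factors of $M$ with multiplicity. *)

theory Defs
  imports Main "HOL-Library.Function_Algebras" "HOL-Library.Multiset"
    "HOL-Computational_Algebra.Polynomial"
begin

definition alg_closed :: "'a::field itself \<Rightarrow> bool" where
  "alg_closed _ \<longleftrightarrow> (\<forall>q :: 'a poly. degree q > 0 \<longrightarrow> (\<exists>x. poly q x = 0))"

definition sc :: "'a::field \<Rightarrow> ('i \<Rightarrow> 'a) \<Rightarrow> ('i \<Rightarrow> 'a)" where
  "sc c f = (\<lambda>x. c * f x)"

definition scD :: "'a::field \<Rightarrow> ('j \<Rightarrow> 'i \<Rightarrow> 'a) \<Rightarrow> ('j \<Rightarrow> 'i \<Rightarrow> 'a)" where
  "scD c D = (\<lambda>j. sc c (D j))"

definition fspanD :: "('j \<Rightarrow> 'i \<Rightarrow> 'a::field) set \<Rightarrow> ('j \<Rightarrow> 'i \<Rightarrow> 'a) set" where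
  "fspanD S = {(\<Sum>x\<in>T. scD (c x) x) | T c. finite T \<and> T \<subseteq> S}"

definition fspan :: "('i \<Rightarrow> 'a::field) set \<Rightarrow> ('i \<Rightarrow> 'a) set" where
  "fspan S = {(\<Sum>x\<in>T. sc (c x) x) | T c. finite T \<and> T \<subseteq> S}"

text \<open>Multi-indices are functions nat \<Rightarrow> nat; variables are numbered 1..n.
  An element of A(n) is its coefficient function on multi-indices
  (zero outside I^n).\<close>

definition valid_idx :: "nat \<Rightarrow> nat \<Rightarrow> (nat \<Rightarrow> nat) \<Rightarrow> bool" where
  "valid_idx p n \<alpha> \<longleftrightarrow> (\<forall>i. (1 \<le> i \<and> i \<le> n \<longrightarrow> \<alpha> i < p) \<and> (\<not>(1 \<le> i \<and> i \<le> n) \<longrightarrow> \<alpha> i = 0))"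

definition mono :: "nat \<Rightarrow> nat \<Rightarrow> (nat \<Rightarrow> nat) \<Rightarrow> ((nat \<Rightarrow> nat) \<Rightarrow> 'a::field)" where
  "mono p n \<alpha> = (\<lambda>\<beta>. if valid_idx p n \<alpha> \<and> \<beta> = \<alpha> then 1 else 0)"

definition pmult :: "nat \<Rightarrow> nat \<Rightarrow> ((nat \<Rightarrow> nat) \<Rightarrow> 'a::field) \<Rightarrow> ((nat \<Rightarrow> nat) \<Rightarrow> 'a) \<Rightarrow> ((nat \<Rightarrow> nat) \<Rightarrow> 'a)" where
  "pmult p n f g = (\<lambda>\<gamma>. if valid_idx p n \<gamma> then
      (\<Sum>\<alpha>\<in>{\<alpha>. valid_idx p n \<alpha>}. if (\<forall>i. \<alpha> i \<le> \<gamma> i) then f \<alpha> * g (\<lambda>i. \<gamma> i - \<alpha> i) else 0)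
    else 0)"

definition pderiv_i :: "nat \<Rightarrow> nat \<Rightarrow> nat \<Rightarrow> ((nat \<Rightarrow> nat) \<Rightarrow> 'a::field) \<Rightarrow> ((nat \<Rightarrow> nat) \<Rightarrow> 'a)" where
  "pderiv_i p n i f = (\<lambda>\<gamma>. if valid_idx p n \<gamma> \<and> valid_idx p n (\<gamma>(i := Suc (\<gamma> i)))
      then of_nat (Suc (\<gamma> i)) * f (\<gamma>(i := Suc (\<gamma> i))) else 0)"

definition var :: "nat \<Rightarrow> nat \<Rightarrow> nat \<Rightarrow> ((nat \<Rightarrow> nat) \<Rightarrow> 'a::field)" where
  "var p n j = mono p n (\<lambda>k. if k = j then 1 else 0)"

text \<open>A derivation \<Sum> f_i \<partial>_i of A(n) is represented by i \<mapsto> f_i (i = 1..n).\<close>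
type_synonym 'a der = "nat \<Rightarrow> (nat \<Rightarrow> nat) \<Rightarrow> 'a"

definition bracket :: "nat \<Rightarrow> nat \<Rightarrow> 'a::field der \<Rightarrow> 'a der \<Rightarrow> 'a der" where
  "bracket p n D E = (\<lambda>j. if 1 \<le> j \<and> j \<le> n then
      (\<Sum>i\<in>{1..n}. pmult p n (D i) (pderiv_i p n i (E j)) - pmult p n (E i) (pderiv_i p n i (D j)))
    else 0)"

definition sigma :: "nat \<Rightarrow> nat \<Rightarrow> 'a::field" where
  "sigma r i = (if i \<le> r then 1 else -1)"

definition prime_idx :: "nat \<Rightarrow> nat \<Rightarrow> nat" where
  "prime_idx r i = (if i \<le> r then i + r else i - r)"

definition DK_comp :: "nat \<Rightarrow> nat \<Rightarrow> ((nat \<Rightarrow> nat) \<Rightarrow> 'a::field) \<Rightarrow> nat \<Rightarrow> ((nat \<Rightarrow> nat) \<Rightarrow> 'a)" where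
  "DK_comp p r f j = pmult p (2*r+1) (var p (2*r+1) j) (pderiv_i p (2*r+1) (2*r+1) f)
      + sc (sigma r (prime_idx r j)) (pderiv_i p (2*r+1) (prime_idx r j) f)"

definition DK :: "nat \<Rightarrow> nat \<Rightarrow> ((nat \<Rightarrow> nat) \<Rightarrow> 'a::field) \<Rightarrow> 'a der" where
  "DK p r f = (\<lambda>i. if 1 \<le> i \<and> i \<le> 2*r then DK_comp p r f i
     else if i = 2*r+1 then sc 2 f - (\<Sum>j\<in>{1..2*r}. sc (sigma r j) (pmult p (2*r+1) (var p (2*r+1) j) (DK_comp p r f (prime_idx r j))))
     else 0)"

definition Ktilde :: "nat \<Rightarrow> nat \<Rightarrow> 'a::field der set" where
  "Ktilde p r = fspanD {DK p r (mono p (2*r+1) \<alpha>) | \<alpha>. valid_idx p (2*r+1) \<alpha>}"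

definition Kalg :: "nat \<Rightarrow> nat \<Rightarrow> 'a::field der set" where
  "Kalg p r = fspanD {bracket p (2*r+1) D E | D E. D \<in> Ktilde p r \<and> E \<in> Ktilde p r}"

text \<open>\<Theta>_K(x_1^a \<partial>_1) = 1/2 D_K(x_{2r+1}^a) and the W(1)-action x \<cdot> D = [\<Theta>_K(x), D]
  for the basis element x_1^a \<partial>_1 of W(1) (a < p).\<close>
definition ThetaK :: "nat \<Rightarrow> nat \<Rightarrow> nat \<Rightarrow> 'a::field der" where
  "ThetaK p r a = scD (inverse 2) (DK p r (mono p (2*r+1) (\<lambda>k. if k = 2*r+1 then a else 0)))"

definition actK :: "nat \<Rightarrow> nat \<Rightarrow> nat \<Rightarrow> 'a::field der \<Rightarrow> 'a der" where
  "actK p r a D = bracket p (2*r+1) (ThetaK p r a) D"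

definition is_submod :: "nat \<Rightarrow> nat \<Rightarrow> 'a::field der set \<Rightarrow> bool" where
  "is_submod p r N \<longleftrightarrow> N \<subseteq> Kalg p r \<and> 0 \<in> N \<and> (\<forall>x\<in>N. \<forall>y\<in>N. x + y \<in> N)
     \<and> (\<forall>c. \<forall>x\<in>N. scD c x \<in> N) \<and> (\<forall>a<p. \<forall>x\<in>N. actK p r a x \<in> N)"

definition simple_subq :: "nat \<Rightarrow> nat \<Rightarrow> 'a::field der set \<Rightarrow> 'a der set \<Rightarrow> bool" where
  "simple_subq p r A B \<longleftrightarrow> is_submod p r A \<and> is_submod p r B \<and> B \<subset> A \<and>
     (\<forall>C. is_submod p r C \<and> B \<subseteq> C \<and> C \<subseteq> A \<longrightarrow> C = B \<or> C = A)"

text \<open>W(1) has basis e_a = x_1^a \<partial>_1, a < p.  The tensor algebra T(W(1)) has as basis the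
  words over the letters 0..p-1 (a word [a_1,...,a_k] stands for e_{a_1}\<cdots>e_{a_k});
  elements of T(W(1)) are finitely supported coefficient functions on words.
  V(\<lambda>) = u(W(1)) \<otimes>_{u(W(1)_0)} F_\<lambda> is T(W(1)) modulo the span of:
  (1) the commutator relations u(xy-yx-[x,y])v, (2) the restricted relations
  u(x^p - x^[p])v for all x \<in> W(1), and (3) the left ideal generated by y - \<chi>(y), y \<in> W(1)_0.\<close>

definition valid_word :: "nat \<Rightarrow> nat list \<Rightarrow> bool" where
  "valid_word p w \<longleftrightarrow> (\<forall>a\<in>set w. a < p)"

definition wd :: "nat list \<Rightarrow> (nat list \<Rightarrow> 'a::field)" where
  "wd w = (\<lambda>u. if u = w then 1 else 0)"

text \<open>Derivation \<Sum>_k c_k x^k \<partial> acting on the truncated A(1) (coefficients of x^j, j<p).\<close>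
definition W1_apply :: "nat \<Rightarrow> (nat \<Rightarrow> 'a::field) \<Rightarrow> (nat \<Rightarrow> 'a) \<Rightarrow> (nat \<Rightarrow> 'a)" where
  "W1_apply p c f = (\<lambda>j. if j < p then
      (\<Sum>k<p. if k \<le> j \<and> j - k + 1 < p then c k * of_nat (j - k + 1) * f (j - k + 1) else 0)
    else 0)"

text \<open>p-map: (\<Sum> c_k x^k \<partial>)^[p] = D^p(x) \<partial>, D^p the p-th power of the derivation D.\<close>
definition W1_pmap :: "nat \<Rightarrow> (nat \<Rightarrow> 'a::field) \<Rightarrow> (nat \<Rightarrow> 'a)" where
  "W1_pmap p c = (W1_apply p c ^^ p) (\<lambda>j. if j = 1 then 1 else 0)"

definition chi :: "nat \<Rightarrow> nat \<Rightarrow> 'a::field" where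
  "chi lam a = (if a = 1 then of_nat lam else 0)"

definition Rel :: "nat \<Rightarrow> nat \<Rightarrow> (nat list \<Rightarrow> 'a::field) set" where
  "Rel p lam =
     {wd (u @ [a, b] @ v) - wd (u @ [b, a] @ v)
        - (if a + b - 1 < p then sc (of_nat b - of_nat a) (wd (u @ [a + b - 1] @ v)) else 0)
      | u v a b. valid_word p u \<and> valid_word p v \<and> a < p \<and> b < p}
   \<union> {(\<Sum>t\<in>{t. length t = p \<and> valid_word p t}. sc (\<Prod>j<p. c (t ! j)) (wd (u @ t @ v)))
        - (\<Sum>k<p. sc (W1_pmap p c k) (wd (u @ [k] @ v)))
      | u v c. valid_word p u \<and> valid_word p v \<and> (\<forall>k\<ge>p. c k = 0)}
   \<union> {wd (u @ [a]) - sc (chi lam a) (wd u) | u a. valid_word p u \<and> 1 \<le> a \<and> a < p}"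

definition fin_comb :: "nat \<Rightarrow> (nat list \<Rightarrow> 'a::field) set" where
  "fin_comb p = {\<rho>. finite {w. \<rho> w \<noteq> 0} \<and> (\<forall>w. \<rho> w \<noteq> 0 \<longrightarrow> valid_word p w)}"

definition ext :: "(nat list \<Rightarrow> 'a::field der) \<Rightarrow> (nat list \<Rightarrow> 'a) \<Rightarrow> 'a der" where
  "ext \<psi> \<rho> = (\<Sum>w\<in>{w. \<rho> w \<noteq> 0}. scD (\<rho> w) (\<psi> w))"

text \<open>\<psi> (images of words) induces a W(1)-module homomorphism T(W(1)) \<rightarrow> A/B which
  kills the relations of V(\<lambda>) and is surjective.\<close>
definition quot_hom :: "nat \<Rightarrow> nat \<Rightarrow> nat \<Rightarrow> 'a::field der set \<Rightarrow> 'a der set \<Rightarrow> (nat list \<Rightarrow> 'a der) \<Rightarrow> bool" where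
  "quot_hom p r lam A B \<psi> \<longleftrightarrow>
     (\<forall>w. valid_word p w \<longrightarrow> \<psi> w \<in> A)
   \<and> (\<forall>w a. valid_word p w \<and> a < p \<longrightarrow> actK p r a (\<psi> w) - \<psi> (a # w) \<in> B)
   \<and> (\<forall>\<rho>\<in>Rel p lam. ext \<psi> \<rho> \<in> B)
   \<and> (\<forall>x\<in>A. \<exists>\<rho>\<in>fin_comb p. x - ext \<psi> \<rho> \<in> B)"

text \<open>A/B \<cong> V(\<lambda>): the induced map T(W(1))/span(Rel) \<rightarrow> A/B is an isomorphism.\<close>
definition subq_iso_V :: "nat \<Rightarrow> nat \<Rightarrow> nat \<Rightarrow> 'a::field der set \<Rightarrow> 'a der set \<Rightarrow> bool" where
  "subq_iso_V p r lam A B \<longleftrightarrow> is_submod p r A \<and> is_submod p r B \<and> B \<subseteq> A \<and>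
     (\<exists>\<psi>. quot_hom p r lam A B \<psi> \<and>
        (\<forall>\<rho>\<in>fin_comb p. ext \<psi> \<rho> \<in> B \<longrightarrow> \<rho> \<in> fspan (Rel p lam)))"

text \<open>A/B \<cong> L(\<lambda>): A/B is a simple quotient of V(\<lambda>) (L(\<lambda>) being the unique one).\<close>
definition subq_iso_L :: "nat \<Rightarrow> nat \<Rightarrow> nat \<Rightarrow> 'a::field der set \<Rightarrow> 'a der set \<Rightarrow> bool" where
  "subq_iso_L p r lam A B \<longleftrightarrow> simple_subq p r A B \<and> (\<exists>\<psi>. quot_hom p r lam A B \<psi>)"

datatype summand = SV nat | SL nat

definition summand_iso :: "nat \<Rightarrow> nat \<Rightarrow> summand \<Rightarrow> 'a::field der set \<Rightarrow> bool" where
  "summand_iso p r s N = (case s of SV lam \<Rightarrow> subq_iso_V p r lam N {0} | SL lam \<Rightarrow> subq_iso_L p r lam N {0})"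

definition direct_decomp :: "nat \<Rightarrow> nat \<Rightarrow> (summand \<times> 'a::field der set) list \<Rightarrow> bool" where
  "direct_decomp p r Ns \<longleftrightarrow>
     (\<forall>i<length Ns. is_submod p r (snd (Ns ! i)))
   \<and> (\<forall>x\<in>Kalg p r. \<exists>v. (\<forall>i<length Ns. v i \<in> snd (Ns ! i)) \<and> x = (\<Sum>i<length Ns. v i))
   \<and> (\<forall>v. (\<forall>i<length Ns. v i \<in> snd (Ns ! i)) \<and> (\<Sum>i<length Ns. v i) = 0 \<longrightarrow> (\<forall>i<length Ns. v i = 0))"

definition comp_series :: "nat \<Rightarrow> nat \<Rightarrow> 'a::field der set list \<Rightarrow> bool" where
  "comp_series p r Ms \<longleftrightarrow> Ms \<noteq> [] \<and> hd Ms = {0} \<and> last Ms = Kalg p r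
     \<and> (\<forall>i. Suc i < length Ms \<longrightarrow> simple_subq p r (Ms ! Suc i) (Ms ! i))"

text \<open>[K] = M: in every composition series the factors are, up to isomorphism, the
  L(\<lambda>)'s listed (with multiplicity) by the multiset M.\<close>
definition comp_factors_are :: "nat \<Rightarrow> nat \<Rightarrow> nat multiset \<Rightarrow> 'a::field itself \<Rightarrow> bool" where
  "comp_factors_are p r M _ \<longleftrightarrow>
     (\<exists>Ms :: 'a der set list. comp_series p r Ms) \<and>
     (\<forall>Ms :: 'a der set list. comp_series p r Ms \<longrightarrow>
        (\<exists>lab. (\<forall>i. Suc i < length Ms \<longrightarrow> lab i < p \<and> subq_iso_L p r (lab i) (Ms ! Suc i) (Ms ! i))
              \<and> mset (map lab [0..<length Ms - 1]) = M))"

end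

theory Submission
  imports Defs
begin

text \<open>
  Write \<open>t\<close> for the last variable, \<open>T = \<partial>\<^sub>t\<close> and \<open>X\<^sub>j = x\<^sub>j T + \<sigma>(j') \<partial>\<^sub>j\<^sub>'\<close>.
  In this frame \<open>D\<^sub>K(f) = 2 f T + \<Sum>\<^sub>j \<sigma>(j) X\<^sub>j(f) X\<^sub>j\<^sub>'\<close>, and the only nonzero commutators are
  \<open>[X\<^sub>j, X\<^sub>j\<^sub>'] = -2 \<sigma>(j) T\<close>, so that \<open>[D\<^sub>K(f), D\<^sub>K(g)] = D\<^sub>K(D\<^sub>K(f)(g) - 2 T(f) g)\<close>.
  The top coefficient of this contact bracket is \<open>2r + 4\<close> times that of \<open>f T(g)\<close>, hence
  \<open>K(2r+1)\<close> is spanned by all \<open>D\<^sub>K(x\<^sup>\<gamma>)\<close>, except for the top monomial when \<open>p\<close> divides \<open>2r + 4\<close>.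

  For a fixed monomial \<open>x\<^sup>\<alpha>\<close> in the first \<open>2r\<close> variables, the span of the \<open>D\<^sub>K(x\<^sup>\<alpha> t\<^sup>m)\<close> is the module of
  truncated tensor densities: \<open>g \<partial>\<close> acts on \<open>q(t)\<close> as \<open>g q' + c g' q\<close> with \<open>2c + 2 = |\<alpha>|\<close> modulo \<open>p\<close>.
  It is generated by \<open>t\<^sup>p\<^sup>-\<^sup>1\<close>, of weight \<open>c - 1\<close>, and is therefore \<open>V(c - 1)\<close>; it is simple
  unless \<open>c\<close> is \<open>0\<close> or \<open>1\<close>. Each weight occurs for \<open>p\<^sup>2\<^sup>r\<^sup>-\<^sup>1\<close> exponents \<open>\<alpha>\<close>, and the Jordan-Hoelder theorem
  transfers the resulting factors to every composition series.
\<close>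

text \<open>Since V(\<lambda>) is given by words modulo relations, an isomorphism needs two bounds.
  On one side the relations must hold on the module, the restricted ones for every vector field and
  not only for basis elements; for this the action is lifted from truncated to genuine polynomials,
  where the p-th power of a Lie derivative is computed once for all degrees. On the other side every
  word reduces to a combination of e_0^k with k < p, and these p words go to nonzero multiples of
  distinct basis vectors. The condition 2c + 2 = |\<alpha>| comes from the coefficient 2m +
  a(|\<alpha>| - 2) with which D_K(t^a) moves x^\<alpha> t^m, halved by \<Theta>_K. For c = 1 the
  action is q \<mapsto> (gq)', whose image misses t^(p-1); for c = 0 it is q \<mapsto> gq', which
  kills the constants. If p divides 2r + 4, the full exponent in the first 2r variables has
  |\<alpha>| = -2r = 4 modulo p, hence c = 1, and the missing top monomial is the generator of its
  V(0). What is left is the simple submodule of derivatives, the extra L(p-1).\<close>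

type_synonym 'a words = "nat list \<Rightarrow> 'a"
type_synonym 'a coeffs = "(nat \<Rightarrow> nat) \<Rightarrow> 'a"

abbreviation idxs :: "nat \<Rightarrow> nat \<Rightarrow> (nat \<Rightarrow> nat) set" where
  "idxs p n \<equiv> {\<alpha>. valid_idx p n \<alpha>}"

lemma sc_apply: "sc c f x = c * f x" by (simp add: sc_def)
lemma scD_apply: "scD c D j = sc c (D j)" by (simp add: scD_def)

interpretation fs: vector_space "sc :: 'a::field \<Rightarrow> ('i \<Rightarrow> 'a) \<Rightarrow> ('i \<Rightarrow> 'a)"
  by unfold_locales (auto simp: sc_def fun_eq_iff algebra_simps)

interpretation ds: vector_space "scD :: 'a::field \<Rightarrow> ('j \<Rightarrow> 'i \<Rightarrow> 'a) \<Rightarrow> ('j \<Rightarrow> 'i \<Rightarrow> 'a)"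
  by unfold_locales (auto simp: scD_def sc_def fun_eq_iff algebra_simps)

lemma sum_fun_apply: "(\<Sum>x\<in>A. f x) y = (\<Sum>x\<in>A. f x y)"
  by (induction A rule: infinite_finite_induct) auto

lemma fspanD_eq_span: "fspanD S = ds.span S"
  unfolding fspanD_def ds.span_explicit by blast

lemma fspan_eq_span: "fspan S = fs.span S"
  unfolding fspan_def fs.span_explicit by blast

lemma additive_sum:
  fixes h :: "'b::ab_group_add \<Rightarrow> 'c::ab_group_add"
  assumes "\<And>x y. h (x + y) = h x + h y"
  shows "h (\<Sum>x\<in>A. f x) = (\<Sum>x\<in>A. h (f x))"
proof -
  have z: "h 0 = 0" using assms[of 0 0] by simp
  show ?thesis by (induction A rule: infinite_finite_induct) (auto simp: assms z)
qed

section \<open>Truncated polynomial algebras\<close>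

lemma finite_valid_idx: "finite (idxs p n)"
proof -
  have "finite {\<alpha>. \<forall>i. (i \<in> {1..n} \<longrightarrow> \<alpha> i \<in> {..<p}) \<and> (i \<notin> {1..n} \<longrightarrow> \<alpha> i = (0::nat))}"
    by (rule finite_set_of_finite_funs) auto
  then show ?thesis
    by (rule rev_finite_subset) (auto simp: valid_idx_def)
qed

text \<open>Elements of A(n) are encoded as arbitrary functions on multi-indices; \<open>cut\<close>
  projects onto those supported on valid exponents. Products and derivatives do not see the values
  that it removes.\<close>

definition cut :: "nat \<Rightarrow> nat \<Rightarrow> 'a::field coeffs \<Rightarrow> 'a coeffs" where
  "cut p n f = (\<lambda>\<gamma>. if valid_idx p n \<gamma> then f \<gamma> else 0)"

lemma cut_expand: "(\<Sum>\<alpha>\<in>idxs p n. sc (f \<alpha>) (mono p n \<alpha>)) = cut p n f"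
proof
  fix \<gamma>
  have "(\<Sum>\<alpha>\<in>idxs p n. sc (f \<alpha>) (mono p n \<alpha>) \<gamma>)
    = (\<Sum>\<alpha>\<in>idxs p n. if \<alpha> = \<gamma> then f \<gamma> else 0)"
    by (rule sum.cong) (auto simp: sc_def mono_def)
  then show "(\<Sum>\<alpha>\<in>idxs p n. sc (f \<alpha>) (mono p n \<alpha>)) \<gamma> = cut p n f \<gamma>"
    by (simp add: sum_fun_apply cut_def finite_valid_idx)
qed

lemma cut_id: "(\<And>\<gamma>. f \<gamma> \<noteq> 0 \<Longrightarrow> valid_idx p n \<gamma>) \<Longrightarrow> cut p n f = f"
  by (auto simp: cut_def fun_eq_iff)

lemma mono_invalid: "\<not> valid_idx p n \<alpha> \<Longrightarrow> mono p n \<alpha> = 0"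
  by (auto simp: mono_def fun_eq_iff)

lemma valid_idx_le: "valid_idx p n \<gamma> \<Longrightarrow> (\<And>i. \<alpha> i \<le> \<gamma> i) \<Longrightarrow> valid_idx p n \<alpha>"
  unfolding valid_idx_def by (metis le_zero_eq order_le_less_trans)

lemma pmult_add_left: "pmult p n (f + g) h = pmult p n f h + pmult p n g h"
  by (auto simp: pmult_def fun_eq_iff sum.distrib[symmetric] algebra_simps intro!: sum.cong)

lemma pmult_add_right: "pmult p n f (g + h) = pmult p n f g + pmult p n f h"
  by (auto simp: pmult_def fun_eq_iff sum.distrib[symmetric] algebra_simps intro!: sum.cong)

lemma pmult_sc_left: "pmult p n (sc c f) h = sc c (pmult p n f h)"
  by (auto simp: pmult_def fun_eq_iff sc_def sum_distrib_left algebra_simps intro!: sum.cong)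

lemma pmult_sc_right: "pmult p n f (sc c h) = sc c (pmult p n f h)"
  by (auto simp: pmult_def fun_eq_iff sc_def sum_distrib_left algebra_simps intro!: sum.cong)

lemma pmult_sum_left: "pmult p n (\<Sum>x\<in>A. f x) h = (\<Sum>x\<in>A. pmult p n (f x) h)"
  by (rule additive_sum[where h = "\<lambda>f. pmult p n f h"]) (rule pmult_add_left)

lemma pmult_sum_right: "pmult p n h (\<Sum>x\<in>A. f x) = (\<Sum>x\<in>A. pmult p n h (f x))"
  by (rule additive_sum[where h = "pmult p n h"]) (rule pmult_add_right)

lemma pmult_zero_left [simp]: "pmult p n 0 h = 0"
  by (auto simp: pmult_def fun_eq_iff cong: if_cong)

lemma pmult_zero_right [simp]: "pmult p n h 0 = 0"
  by (auto simp: pmult_def fun_eq_iff cong: if_cong)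

lemma pmult_diff_left: "pmult p n (f - g) h = pmult p n f h - pmult p n g h"
  using pmult_add_left[of p n "f - g" g h] by simp

lemma pmult_diff_right: "pmult p n h (f - g) = pmult p n h f - pmult p n h g"
  using pmult_add_right[of p n h "f - g" g] by simp

lemma pmult_cut_left: "pmult p n (cut p n f) h = pmult p n f h"
  by (auto simp: pmult_def cut_def fun_eq_iff intro!: sum.cong)

text \<open>Truncation is hidden in \<open>mono\<close>, which vanishes at invalid exponents. An
  invalid \<open>\<delta>\<close> makes every exponent \<open>\<delta> i + \<gamma> i\<close>
  invalid as well, so both sides are then 0.\<close>

lemma pmult_mono_left:
  "pmult p n (mono p n \<delta>) h = (\<Sum>\<gamma>\<in>idxs p n. sc (h \<gamma>) (mono p n (\<lambda>i. \<delta> i + \<gamma> i)))"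
proof (cases "valid_idx p n \<delta>")
  case False
  have "\<not> valid_idx p n (\<lambda>i. \<delta> i + \<gamma> i)" for \<gamma>
    using False valid_idx_le[of p n "\<lambda>i. \<delta> i + \<gamma> i" \<delta>] by auto
  with False show ?thesis by (simp add: mono_invalid)
next
  case True
  show ?thesis
  proof
    fix \<eta>
    show "pmult p n (mono p n \<delta>) h \<eta>
      = (\<Sum>\<gamma>\<in>idxs p n. sc (h \<gamma>) (mono p n (\<lambda>i. \<delta> i + \<gamma> i))) \<eta>"
    proof (cases "valid_idx p n \<eta>")
      case v: True
      have "pmult p n (mono p n \<delta>) h \<eta> = (\<Sum>\<alpha>\<in>idxs p n.
          if \<alpha> = \<delta> then (if \<forall>i. \<delta> i \<le> \<eta> i then h (\<lambda>i. \<eta> i - \<delta> i) else 0) else 0)"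
        unfolding pmult_def if_P[OF v] using True by (intro sum.cong) (auto simp: mono_def)
      also have "\<dots> = (if \<forall>i. \<delta> i \<le> \<eta> i then h (\<lambda>i. \<eta> i - \<delta> i) else 0)"
        using True by (simp add: finite_valid_idx)
      also have "\<dots> = (\<Sum>\<gamma>\<in>idxs p n.
          if \<gamma> = (\<lambda>i. \<eta> i - \<delta> i) then (if \<forall>i. \<delta> i \<le> \<eta> i then h (\<lambda>i. \<eta> i - \<delta> i) else 0) else 0)"
        using valid_idx_le[OF v, of "\<lambda>i. \<eta> i - \<delta> i"] by (simp add: finite_valid_idx)
      also have "\<dots> = (\<Sum>\<gamma>\<in>idxs p n. sc (h \<gamma>) (mono p n (\<lambda>i. \<delta> i + \<gamma> i)) \<eta>)"
      proof (rule sum.cong)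
        fix \<gamma>
        have "\<eta> = (\<lambda>i. \<delta> i + \<gamma> i) \<longleftrightarrow> \<gamma> = (\<lambda>i. \<eta> i - \<delta> i) \<and> (\<forall>i. \<delta> i \<le> \<eta> i)"
          by (auto simp: fun_eq_iff)
        then show "(if \<gamma> = (\<lambda>i. \<eta> i - \<delta> i) then (if \<forall>i. \<delta> i \<le> \<eta> i then h (\<lambda>i. \<eta> i - \<delta> i) else 0) else 0)
          = sc (h \<gamma>) (mono p n (\<lambda>i. \<delta> i + \<gamma> i)) \<eta>"
          using v by (auto simp: sc_def mono_def)
      qed simp
      finally show ?thesis by (simp add: sum_fun_apply)
    next
      case False
      then have "sc (h \<gamma>) (mono p n (\<lambda>i. \<delta> i + \<gamma> i)) \<eta> = 0" for \<gamma>
        by (auto simp: sc_def mono_def)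
      with False show ?thesis by (simp add: pmult_def sum_fun_apply)
    qed
  qed
qed

lemma pmult_expand_left:
  "pmult p n f h = (\<Sum>\<alpha>\<in>idxs p n. sc (f \<alpha>) (pmult p n (mono p n \<alpha>) h))"
proof -
  have "pmult p n f h = pmult p n (\<Sum>\<alpha>\<in>idxs p n. sc (f \<alpha>) (mono p n \<alpha>)) h"
    by (simp add: cut_expand pmult_cut_left)
  then show ?thesis by (simp add: pmult_sum_left pmult_sc_left)
qed

lemma pmult_expand:
  "pmult p n f h = (\<Sum>\<alpha>\<in>idxs p n. \<Sum>\<beta>\<in>idxs p n.
     sc (f \<alpha> * h \<beta>) (mono p n (\<lambda>i. \<alpha> i + \<beta> i)))"
  by (subst pmult_expand_left) (simp add: pmult_mono_left fs.scale_sum_right)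

lemma pmult_commute: "pmult p n f h = pmult p n h f"
  by (subst (1 2) pmult_expand, subst sum.swap) (simp add: mult.commute add.commute)

text \<open>Both bracketings expand into the same triple sum over exponents; the right-nested one is
  first turned round by commutativity, so that a single expansion serves both.\<close>

lemma pmult_assoc: "pmult p n (pmult p n f g) h = pmult p n f (pmult p n g h)"
proof -
  have L: "pmult p n (pmult p n f g) h = (\<Sum>\<alpha>\<in>idxs p n. \<Sum>\<beta>\<in>idxs p n.
     \<Sum>\<gamma>\<in>idxs p n. sc (f \<alpha> * g \<beta> * h \<gamma>) (mono p n (\<lambda>i. \<alpha> i + \<beta> i + \<gamma> i)))" for f g h :: "'a coeffs"
    by (subst pmult_expand) (simp add: pmult_sum_left pmult_sc_left pmult_mono_left fs.scale_sum_right)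
  have "pmult p n f (pmult p n g h) = pmult p n (pmult p n g h) f" by (rule pmult_commute)
  also have "\<dots> = (\<Sum>\<alpha>\<in>idxs p n. \<Sum>\<beta>\<in>idxs p n.
     \<Sum>\<gamma>\<in>idxs p n. sc (f \<gamma> * g \<alpha> * h \<beta>) (mono p n (\<lambda>i. \<gamma> i + \<alpha> i + \<beta> i)))"
    by (simp add: L mult_ac add_ac)
  also have "\<dots> = (\<Sum>\<alpha>\<in>idxs p n. \<Sum>\<gamma>\<in>idxs p n.
     \<Sum>\<beta>\<in>idxs p n. sc (f \<gamma> * g \<alpha> * h \<beta>) (mono p n (\<lambda>i. \<gamma> i + \<alpha> i + \<beta> i)))"
    by (intro sum.cong refl sum.swap)
  also have "\<dots> = (\<Sum>\<gamma>\<in>idxs p n. \<Sum>\<alpha>\<in>idxs p n.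
     \<Sum>\<beta>\<in>idxs p n. sc (f \<gamma> * g \<alpha> * h \<beta>) (mono p n (\<lambda>i. \<gamma> i + \<alpha> i + \<beta> i)))"
    by (rule sum.swap)
  finally show ?thesis by (simp add: L)
qed

lemma pmult_left_commute: "pmult p n f (pmult p n g h) = pmult p n g (pmult p n f h)"
  by (metis pmult_assoc pmult_commute)

lemmas pmult_ac = pmult_assoc pmult_commute pmult_left_commute

lemma pmult_mono_mono:
  assumes "valid_idx p n \<beta>"
  shows "pmult p n (mono p n \<alpha>) (mono p n \<beta>) = mono p n (\<lambda>i. \<alpha> i + \<beta> i)"
proof -
  have "pmult p n (mono p n \<alpha>) (mono p n \<beta>) = (\<Sum>\<gamma>\<in>idxs p n.
    if \<gamma> = \<beta> then mono p n (\<lambda>i. \<alpha> i + \<beta> i) else 0)"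
    unfolding pmult_mono_left using assms
    by (intro sum.cong) (auto simp: mono_def[of p n \<beta>])
  then show ?thesis using assms by (simp add: finite_valid_idx)
qed

lemma pmult_one: "p > 0 \<Longrightarrow> pmult p n (mono p n (\<lambda>_. 0)) f = cut p n f"
  by (simp add: pmult_mono_left cut_expand)

lemma pderiv_i_add: "pderiv_i p n i (f + g) = pderiv_i p n i f + pderiv_i p n i g"
  by (auto simp: pderiv_i_def fun_eq_iff algebra_simps)

lemma pderiv_i_sc: "pderiv_i p n i (sc c f) = sc c (pderiv_i p n i f)"
  by (auto simp: pderiv_i_def fun_eq_iff sc_def algebra_simps)

lemma pderiv_i_sum: "pderiv_i p n i (\<Sum>x\<in>A. f x) = (\<Sum>x\<in>A. pderiv_i p n i (f x))"
  by (rule additive_sum[where h = "pderiv_i p n i"]) (rule pderiv_i_add)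

lemma pderiv_i_zero [simp]: "pderiv_i p n i 0 = 0"
  by (auto simp: pderiv_i_def fun_eq_iff)

lemma pderiv_i_diff: "pderiv_i p n i (f - g) = pderiv_i p n i f - pderiv_i p n i g"
  using pderiv_i_add[of p n i "f - g" g] by simp

lemma pderiv_i_cut: "pderiv_i p n i (cut p n f) = pderiv_i p n i f"
  by (auto simp: pderiv_i_def cut_def fun_eq_iff)

lemma cut_pderiv_i: "cut p n (pderiv_i p n i f) = pderiv_i p n i f"
  by (auto simp: pderiv_i_def cut_def fun_eq_iff)

lemma pderiv_i_expand:
  "pderiv_i p n i f = (\<Sum>\<alpha>\<in>idxs p n. sc (f \<alpha>) (pderiv_i p n i (mono p n \<alpha>)))"
  using pderiv_i_cut[of p n i f] by (simp add: cut_expand[symmetric] pderiv_i_sum pderiv_i_sc)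

locale truncated =
  fixes p n :: nat and ty :: "'a::field itself"
  assumes char_p: "CHAR('a) = p" and p_gt_1: "p > 1"
begin

lemma of_nat_eq_0_iff: "(of_nat k :: 'a) = 0 \<longleftrightarrow> p dvd k"
  using of_nat_eq_0_iff_char_dvd[where 'a='a] char_p by simp

text \<open>If \<open>\<alpha> i = p\<close>, then the exponent on the right may be valid although \<open>\<alpha>\<close> is not, but the coefficient
  vanishes in characteristic \<open>p\<close>.\<close>
lemma pderiv_i_mono:
  assumes "1 \<le> i" "i \<le> n"
  shows "pderiv_i p n i (mono p n \<alpha>) = sc (of_nat (\<alpha> i) :: 'a) (mono p n (\<alpha>(i := \<alpha> i - 1)))"
proof
  fix \<gamma>
  show "pderiv_i p n i (mono p n \<alpha>) \<gamma> = sc (of_nat (\<alpha> i) :: 'a) (mono p n (\<alpha>(i := \<alpha> i - 1))) \<gamma>"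
  proof (cases "valid_idx p n \<gamma> \<and> \<alpha> i \<noteq> 0 \<and> \<gamma> = \<alpha>(i := \<alpha> i - 1)")
    case True
    then have g: "\<gamma>(i := Suc (\<gamma> i)) = \<alpha>" "Suc (\<gamma> i) = \<alpha> i" by auto
    have "of_nat (\<alpha> i) = (0::'a)" if "\<not> valid_idx p n \<alpha>"
    proof -
      have "valid_idx p n (\<alpha>(i := \<alpha> i - 1))" using True by metis
      then have v: "(1 \<le> k \<and> k \<le> n \<longrightarrow> (\<alpha>(i := \<alpha> i - 1)) k < p)
        \<and> (\<not> (1 \<le> k \<and> k \<le> n) \<longrightarrow> (\<alpha>(i := \<alpha> i - 1)) k = 0)" for k
        unfolding valid_idx_def by blast
      have "valid_idx p n \<alpha>" if "\<alpha> i < p"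
        unfolding valid_idx_def
      proof
        fix k
        show "(1 \<le> k \<and> k \<le> n \<longrightarrow> \<alpha> k < p) \<and> (\<not> (1 \<le> k \<and> k \<le> n) \<longrightarrow> \<alpha> k = 0)"
          using v[of k] that assms by (cases "k = i") auto
      qed
      with that have "\<not> \<alpha> i < p" by blast
      moreover have "\<alpha> i - 1 < p" using v[of i] assms by simp
      ultimately have "\<alpha> i = p" by simp
      then show ?thesis using of_nat_eq_0_iff by simp
    qed
    with True g show ?thesis by (auto simp: pderiv_i_def mono_def sc_def)
  next
    case False
    have "\<alpha> i \<noteq> 0 \<and> \<gamma> = \<alpha>(i := \<alpha> i - 1)" if "\<alpha> = \<gamma>(i := Suc (\<gamma> i))"
      using that by simp
    with False show ?thesis by (auto simp: pderiv_i_def mono_def sc_def)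
  qed
qed

text \<open>On monomials this is additivity of the exponent of variable \<open>i\<close>. The
  delicate case is \<open>\<alpha> i + \<beta> i = p\<close>, where the product vanishes but the two
  terms on the right need not vanish separately; \<open>pderiv_i_mono\<close> absorbs it, as it
  holds for invalid exponents too.\<close>

lemma pderiv_i_pmult:
  fixes f g :: "'a coeffs"
  assumes i: "1 \<le> i" "i \<le> n"
  shows "pderiv_i p n i (pmult p n f g) = pmult p n (pderiv_i p n i f) g + pmult p n f (pderiv_i p n i g)"
proof -
  let ?V = "idxs p n"
  have E: "pmult p n (pderiv_i p n i f) g = (\<Sum>\<alpha>\<in>?V. \<Sum>\<beta>\<in>?V.
      sc (f \<alpha> * g \<beta> * of_nat (\<alpha> i)) (mono p n ((\<lambda>j. \<alpha> j + \<beta> j)(i := \<alpha> i + \<beta> i - 1))))" for f g :: "'a coeffs"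
  proof -
    \<comment> \<open>Subtraction on \<open>nat\<close> is truncated, so the two exponents may
      differ for \<open>\<alpha> i = 0\<close>; the coefficient is then 0.\<close>
    have *: "sc (f \<alpha> * of_nat (\<alpha> i) * g \<beta>) (mono p n (\<lambda>j. (\<alpha>(i := \<alpha> i - 1)) j + \<beta> j))
       = sc (f \<alpha> * g \<beta> * of_nat (\<alpha> i)) (mono p n ((\<lambda>j. \<alpha> j + \<beta> j)(i := \<alpha> i + \<beta> i - 1)))" for \<alpha> \<beta>
    proof (cases "\<alpha> i = 0")
      case False
      then have "(\<lambda>j. (\<alpha>(i := \<alpha> i - 1)) j + \<beta> j) = (\<lambda>j. \<alpha> j + \<beta> j)(i := \<alpha> i + \<beta> i - 1)"
        by (auto simp: fun_eq_iff)
      then show ?thesis by (simp add: mult_ac)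
    qed simp
    have "pmult p n (pderiv_i p n i f) g = (\<Sum>\<alpha>\<in>?V. \<Sum>\<beta>\<in>?V.
      sc (f \<alpha> * of_nat (\<alpha> i) * g \<beta>) (mono p n (\<lambda>j. (\<alpha>(i := \<alpha> i - 1)) j + \<beta> j)))"
      by (subst pderiv_i_expand)
        (simp only: pmult_sum_left pmult_sc_left pderiv_i_mono[OF i] pmult_mono_left fs.scale_sum_right
          fs.scale_scale mult.assoc)
    then show ?thesis unfolding * .
  qed
  have "pmult p n f (pderiv_i p n i g) = pmult p n (pderiv_i p n i g) f" by (rule pmult_commute)
  also have "\<dots> = (\<Sum>\<alpha>\<in>?V. \<Sum>\<beta>\<in>?V.
      sc (f \<alpha> * g \<beta> * of_nat (\<beta> i)) (mono p n ((\<lambda>j. \<alpha> j + \<beta> j)(i := \<alpha> i + \<beta> i - 1))))"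
    by (subst E, subst sum.swap) (simp add: mult_ac add_ac)
  finally have R: "pmult p n f (pderiv_i p n i g) = \<dots>" .
  show ?thesis
    unfolding E R
    by (subst pmult_expand)
      (simp add: pderiv_i_sum pderiv_i_sc pderiv_i_mono[OF i] algebra_simps fs.scale_left_distrib sum.distrib)
qed

lemma pderiv_i_commute:
  fixes f :: "'a coeffs"
  assumes "1 \<le> i" "i \<le> n" "1 \<le> j" "j \<le> n"
  shows "pderiv_i p n i (pderiv_i p n j f) = pderiv_i p n j (pderiv_i p n i f)"
proof (cases "i = j")
  case False
  then have "pderiv_i p n i (pderiv_i p n j (mono p n \<alpha>)) = pderiv_i p n j (pderiv_i p n i (mono p n \<alpha> :: _ \<Rightarrow> 'a))" for \<alpha>
    using assms by (simp add: pderiv_i_mono pderiv_i_sc fun_upd_twist mult_ac)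
  then show ?thesis
    by (subst (2 4) pderiv_i_expand) (simp add: pderiv_i_sum pderiv_i_sc)
qed simp

lemma pderiv_i_var:
  assumes "1 \<le> i" "i \<le> n"
  shows "pderiv_i p n i (var p n j) = (if i = j then mono p n (\<lambda>_. 0) else 0 :: _ \<Rightarrow> 'a)"
proof -
  have "(\<lambda>k. if k = j then 1 else 0)(j := 0) = (\<lambda>_. 0::nat)" by auto
  then show ?thesis by (simp add: var_def pderiv_i_mono[OF assms])
qed

end

section \<open>The contact bracket\<close>

lemma DK_add: "DK p r (f + g) = DK p r f + DK p r g"
  by (rule ext)
    (simp add: DK_def DK_comp_def pmult_add_right pderiv_i_add fs.scale_right_distrib sum.distrib)

lemma DK_sc: "DK p r (sc c f) = scD c (DK p r f)"
  by (rule ext)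
    (simp add: DK_def DK_comp_def scD_apply pmult_add_right pmult_sc_right pderiv_i_sc fs.scale_right_distrib
      fs.scale_right_diff_distrib fs.scale_sum_right mult_ac)

lemma DK_sum: "DK p r (\<Sum>x\<in>A. f x) = (\<Sum>x\<in>A. DK p r (f x))"
  by (rule additive_sum[where h = "DK p r"]) (rule DK_add)

lemma bracket_add_right: "bracket p n D (E + F) = bracket p n D E + bracket p n D F"
  by (rule ext)
    (simp add: bracket_def pmult_add_right pmult_add_left pderiv_i_add sum.distrib sum_subtractf algebra_simps)

lemma bracket_sc_right: "bracket p n D (scD c E) = scD c (bracket p n D E)"
  by (rule ext)
    (simp add: bracket_def scD_apply pmult_sc_right pmult_sc_left pderiv_i_sc fs.scale_sum_right
      fs.scale_right_diff_distrib)

lemma bracket_sc_left: "bracket p n (scD c D) E = scD c (bracket p n D E)"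
  by (rule ext)
    (simp add: bracket_def scD_apply pmult_sc_right pmult_sc_left pderiv_i_sc fs.scale_sum_right
      fs.scale_right_diff_distrib)

locale contact =
  fixes p r n :: nat and ty :: "'a::field itself"
  assumes char_p: "CHAR('a) = p" and prime_p: "prime p" and p_gt_2: "p > 2" and r_pos: "r \<ge> 1"
    and n_eq: "n = 2*r+1"
begin

sublocale truncated p n ty
  using char_p p_gt_2 by unfold_locales auto

abbreviation mul :: "'a coeffs \<Rightarrow> 'a coeffs \<Rightarrow> 'a coeffs" (infixl "\<odot>" 70)
  where "f \<odot> g \<equiv> pmult p n f g"
abbreviation T :: "'a coeffs \<Rightarrow> 'a coeffs" where "T \<equiv> pderiv_i p n n"
abbreviation X :: "nat \<Rightarrow> 'a coeffs \<Rightarrow> 'a coeffs" where "X j f \<equiv> DK_comp p r f j"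
definition J where "J = {1..2*r}"
abbreviation pr where "pr \<equiv> prime_idx r"
abbreviation sg :: "nat \<Rightarrow> 'a" where "sg \<equiv> sigma r"
abbreviation vr :: "nat \<Rightarrow> 'a coeffs" where "vr \<equiv> var p n"

lemma two_neq_0: "(2::'a) \<noteq> 0"
proof
  assume "(2::'a) = 0"
  then have "(of_nat 2 :: 'a) = 0" by simp
  then have "p dvd 2" unfolding of_nat_eq_0_iff .
  then show False using p_gt_2 by (auto dest: dvd_imp_le)
qed

lemma J_finite [simp]: "finite J" by (simp add: J_def)
lemma J_bounds: "j \<in> J \<Longrightarrow> 1 \<le> j" "j \<in> J \<Longrightarrow> j \<le> n" "j \<in> J \<Longrightarrow> j \<noteq> n"
  by (auto simp: J_def n_eq)
lemma n_pos: "Suc 0 \<le> n" "0 < n" by (simp_all add: n_eq)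
lemma range_n: "{1..n} = insert n J" by (auto simp: J_def n_eq)
lemma n_notin_J: "n \<notin> J" by (auto simp: J_def n_eq)

lemma X_def: "X j f = vr j \<odot> T f + sc (sg (pr j)) (pderiv_i p n (pr j) f)"
  unfolding DK_comp_def n_eq ..

lemma pr_J [simp]: "j \<in> J \<Longrightarrow> pr j \<in> J"
  by (auto simp: prime_idx_def J_def)

lemma pr_pr [simp]: "j \<in> J \<Longrightarrow> pr (pr j) = j"
  by (auto simp: prime_idx_def J_def)

lemma pr_eq_iff: "i \<in> J \<Longrightarrow> j \<in> J \<Longrightarrow> i = pr j \<longleftrightarrow> j = pr i"
  by (auto simp: prime_idx_def J_def)

lemma sg_pr [simp]: "j \<in> J \<Longrightarrow> sg (pr j) = - sg j"
  by (auto simp: prime_idx_def sigma_def J_def)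

lemma sg_sg [simp]: "sg j * sg j = 1" "sg j * (sg j * x) = x"
  by (auto simp: sigma_def)

lemma sum_pr: "(\<Sum>j\<in>J. F (pr j)) = (\<Sum>j\<in>J. F j)"
  by (rule sum.reindex_bij_witness[of _ pr pr]) (use pr_J pr_pr in auto)

lemma sum_delta_J:
  assumes "i \<in> J"
  shows "(\<Sum>j\<in>J. if j = i then F j else 0) = F i"
  using assms by (simp add: sum.delta')

lemma X_add: "X j (f + g) = X j f + X j g"
  by (simp add: X_def pmult_add_right pderiv_i_add fs.scale_right_distrib)

lemma X_sc: "X j (sc c f) = sc c (X j f)"
  by (simp add: X_def pmult_sc_right pderiv_i_sc fs.scale_right_distrib mult_ac)

lemma X_sum: "X j (\<Sum>x\<in>A. f x) = (\<Sum>x\<in>A. X j (f x))"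
  by (rule additive_sum[where h = "X j"]) (rule X_add)

lemma X_diff: "X j (f - g) = X j f - X j g"
  using X_add[where f = "f - g" and g = g] by simp

lemma cut_X: "j \<in> J \<Longrightarrow> cut p n (X j f) = X j f"
  by (auto simp: X_def cut_def fun_eq_iff pmult_def pderiv_i_def sc_def)

lemma X_mul:
  assumes "j \<in> J"
  shows "X j (f \<odot> g) = X j f \<odot> g + f \<odot> X j g"
proof -
  have "1 \<le> pr j" "pr j \<le> n" using J_bounds pr_J[OF assms] by blast+
  then show ?thesis
    by (simp add: X_def pderiv_i_pmult n_pos pmult_add_right pmult_add_left pmult_sc_left pmult_sc_right
        fs.scale_right_distrib) (simp add: pmult_ac)
qed

lemma T_vr: "j \<in> J \<Longrightarrow> T (vr j) = 0"
  by (use J_bounds(3) in \<open>auto simp: pderiv_i_var n_pos\<close>)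

lemma T_X:
  assumes "j \<in> J"
  shows "T (X j f) = X j (T f)"
proof -
  have "1 \<le> pr j" "pr j \<le> n" using J_bounds pr_J[OF assms] by blast+
  then show ?thesis using assms
    by (simp add: X_def pderiv_i_add pderiv_i_diff pderiv_i_pmult n_pos pderiv_i_sc T_vr pderiv_i_commute[of n "pr j"] n_pos)
qed

lemma X_vr:
  assumes "i \<in> J" "j \<in> J"
  shows "X i (vr j) = (if j = pr i then sc (- sg i) (mono p n (\<lambda>_. 0)) else 0)"
proof -
  have "1 \<le> pr i" "pr i \<le> n" using J_bounds pr_J[OF assms(1)] by blast+
  then show ?thesis using assms T_vr by (auto simp: X_def pderiv_i_var)
qed

text \<open>In the expansion \<open>XX\<close> the first four terms together are symmetric in
  \<open>i\<close> and \<open>j\<close>. Only the last one is not: it stems from the partial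
  derivative in \<open>X i\<close> hitting the coefficient \<open>vr j\<close>, and it changes sign
  under the exchange because \<open>sg (pr i) = - sg i\<close>.\<close>

lemma X_commutator:
  assumes "i \<in> J" "j \<in> J"
  shows "X i (X j f) = X j (X i f) + (if j = pr i then sc (- 2 * sg i) (T f) else 0)"
proof -
  have i: "1 \<le> pr i" "pr i \<le> n" using J_bounds pr_J[OF assms(1)] by blast+
  have XX: "X i (X j f) = vr i \<odot> (vr j \<odot> T (T f)) + sc (- sg j) (vr i \<odot> T (pderiv_i p n (pr j) f))
      + sc (- sg i) (vr j \<odot> T (pderiv_i p n (pr i) f))
      + sc (sg i * sg j) (pderiv_i p n (pr i) (pderiv_i p n (pr j) f))
      + (if j = pr i then sc (- sg i) (T f) else 0)" if ij: "i \<in> J" "j \<in> J" for i j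
  proof -
    have i: "1 \<le> pr i" "pr i \<le> n" using J_bounds pr_J[OF ij(1)] by blast+
    have one: "mono p n (\<lambda>_. 0) \<odot> T f = T f"
      using p_gt_2 by (simp add: pmult_one cut_pderiv_i)
    have "pderiv_i p n (pr i) (vr j \<odot> T f) = (if j = pr i then T f else 0) + vr j \<odot> T (pderiv_i p n (pr i) f)"
      using i one by (auto simp: pderiv_i_pmult n_pos pderiv_i_var pderiv_i_commute[of "pr i" n] n_pos)
    moreover have "T (vr j \<odot> T f) = vr j \<odot> T (T f)"
      using ij T_vr by (simp add: pderiv_i_pmult n_pos)
    ultimately show ?thesis using ij unfolding X_def
      by (auto simp: pderiv_i_add pderiv_i_diff pderiv_i_sc pmult_add_right pmult_diff_right pmult_sc_right
          fs.scale_right_distrib fs.scale_right_diff_distrib)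
  qed
  have j: "1 \<le> pr j" "pr j \<le> n" using J_bounds pr_J[OF assms(2)] by blast+
  have e: "pderiv_i p n (pr i) (pderiv_i p n (pr j) f) = pderiv_i p n (pr j) (pderiv_i p n (pr i) f)"
    using i j by (simp add: pderiv_i_commute)
  have k: "i = pr j \<longleftrightarrow> j = pr i" using assms by (rule pr_eq_iff)
  show ?thesis
    unfolding XX[OF assms] XX[OF assms(2,1)] e k using assms(1)
    by (auto simp: fun_eq_iff sc_def algebra_simps pmult_left_commute[of _ _ "vr j" "vr i"])
qed

text \<open>A Poisson bracket with the fields \<open>X j\<close> in place of the partial
  derivatives.\<close>

definition horiz :: "'a coeffs \<Rightarrow> 'a coeffs \<Rightarrow> 'a coeffs" where
  "horiz f g = (\<Sum>j\<in>J. sc (sg j) (X j f \<odot> X (pr j) g))"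

text \<open>The involution \<open>pr\<close> exchanges the two factors of each summand and flips its
  sign.\<close>

lemma horiz_swap: "horiz g f = - horiz f g"
proof -
  have "horiz g f = (\<Sum>j\<in>J. sc (sg (pr j)) (X (pr j) g \<odot> X (pr (pr j)) f))"
    unfolding horiz_def by (rule sum_pr[symmetric])
  also have "\<dots> = (\<Sum>j\<in>J. - sc (sg j) (X j f \<odot> X (pr j) g))"
    by (rule sum.cong) (simp_all add: pmult_commute)
  finally show ?thesis by (simp add: horiz_def sum_negf)
qed

definition app :: "'a coeffs \<Rightarrow> 'a coeffs \<Rightarrow> 'a coeffs" where
  "app f g = sc 2 (f \<odot> T g) + horiz f g"

text \<open>The Lagrange (Jacobi) bracket. The correction appears because D_K(f) does not preserve
  the contact form but rescales it by 2 T(f).\<close>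

definition contact_bracket :: "'a coeffs \<Rightarrow> 'a coeffs \<Rightarrow> 'a coeffs" where
  "contact_bracket f g = app f g - sc 2 (T f \<odot> g)"

lemma DK_J: "j \<in> J \<Longrightarrow> DK p r f j = X j f"
  by (simp add: DK_def J_def)

lemma DK_n: "DK p r f n = sc 2 f - (\<Sum>j\<in>J. sc (sg j) (vr j \<odot> X (pr j) f))"
  unfolding n_eq J_def by (simp add: DK_def)

text \<open>In the frame \<open>T, X 1, \<dots>, X (2r)\<close>, the coordinates \<open>vr j\<close> in \<open>DK f\<close> cancel.\<close>
lemma DK_app: "(\<Sum>i\<in>{1..n}. DK p r f i \<odot> pderiv_i p n i g) = app f g"
proof -
  have d: "pderiv_i p n j g = sc (sg j) (X (pr j) g) - sc (sg j) (vr (pr j) \<odot> T g)" if "j \<in> J" for j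
    using that by (simp add: X_def fs.scale_right_distrib)
  have "(\<Sum>i\<in>{1..n}. DK p r f i \<odot> pderiv_i p n i g)
     = DK p r f n \<odot> T g + (\<Sum>j\<in>J. DK p r f j \<odot> pderiv_i p n j g)"
    unfolding range_n by (simp add: n_notin_J)
  also have "(\<Sum>j\<in>J. DK p r f j \<odot> pderiv_i p n j g)
     = (\<Sum>j\<in>J. sc (sg j) (X j f \<odot> X (pr j) g) - sc (sg j) (X j f \<odot> (vr (pr j) \<odot> T g)))"
    by (rule sum.cong) (simp_all add: DK_J d pmult_diff_right pmult_sc_right)
  also have "\<dots> = horiz f g - (\<Sum>j\<in>J. sc (sg j) (X j f \<odot> (vr (pr j) \<odot> T g)))"
    by (simp add: horiz_def sum_subtractf)
  also have "(\<Sum>j\<in>J. sc (sg j) (X j f \<odot> (vr (pr j) \<odot> T g)))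
     = (\<Sum>j\<in>J. sc (sg (pr j)) (X (pr j) f \<odot> (vr (pr (pr j)) \<odot> T g)))"
    by (rule sum_pr[symmetric])
  also have "\<dots> = - (\<Sum>j\<in>J. sc (sg j) (vr j \<odot> X (pr j) f \<odot> T g))"
    unfolding sum_negf[symmetric] by (rule sum.cong) (simp_all add: pmult_ac)
  finally have "(\<Sum>i\<in>{1..n}. DK p r f i \<odot> pderiv_i p n i g) = DK p r f n \<odot> T g
      + (horiz f g - - (\<Sum>j\<in>J. sc (sg j) (vr j \<odot> X (pr j) f \<odot> T g)))" .
  then show ?thesis
    by (simp add: app_def DK_n pmult_diff_left pmult_sc_left pmult_sum_left)
qed

lemma app_mul: "app f (u \<odot> v) = app f u \<odot> v + u \<odot> app f v"
proof -
  have "horiz f (u \<odot> v) = horiz f u \<odot> v + u \<odot> horiz f v"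
    unfolding horiz_def pmult_sum_left pmult_sum_right sum.distrib[symmetric]
    by (rule sum.cong) (simp_all add: X_mul pmult_add_right fs.scale_right_distrib pmult_sc_left
        pmult_sc_right pmult_ac)
  moreover have "f \<odot> T (u \<odot> v) = f \<odot> T u \<odot> v + u \<odot> (f \<odot> T v)"
    by (simp add: pderiv_i_pmult n_pos pmult_add_right) (simp add: pmult_ac)
  ultimately show ?thesis
    by (simp add: app_def pmult_add_left pmult_add_right pmult_sc_left pmult_sc_right fs.scale_right_distrib)
qed

lemma app_add: "app f (u + v) = app f u + app f v"
  by (simp add: app_def horiz_def X_add pderiv_i_add pmult_add_right fs.scale_right_distrib sum.distrib)

lemma app_sc: "app f (sc c u) = sc c (app f u)"
  by (simp add: app_def horiz_def X_sc pderiv_i_sc pmult_sc_right fs.scale_right_distrib fs.scale_sum_right mult_ac)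

lemma app_sum: "app f (\<Sum>x\<in>A. u x) = (\<Sum>x\<in>A. app f (u x))"
  by (rule additive_sum[where h = "app f"]) (rule app_add)

lemma app_diff: "app f (u - v) = app f u - app f v"
  using app_add[of f "u - v" v] by simp

lemma app_vr:
  assumes "j \<in> J"
  shows "app f (vr j) = X j f"
proof -
  have "horiz f (vr j) = (\<Sum>i\<in>J. if i = j then X i f else 0)"
    unfolding horiz_def
  proof (rule sum.cong)
    fix i assume i: "i \<in> J"
    have "X i f \<odot> mono p n (\<lambda>_. 0) = X i f"
      using p_gt_2 i by (subst pmult_commute) (simp add: pmult_one cut_X)
    moreover have "sg i * - sg (pr i) = 1" using i by simp
    ultimately show "sc (sg i) (X i f \<odot> X (pr i) (vr j)) = (if i = j then X i f else 0)"
      using i assms by (auto simp: X_vr[OF pr_J] pmult_sc_right)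
  qed simp
  then show ?thesis using assms by (simp add: app_def T_vr sum_delta_J)
qed

text \<open>In the summand \<open>j = i\<close> the commutator of \<open>X (pr i)\<close> and
  \<open>X i\<close> contributes 2 X_i(f) T(g), exactly what \<open>X i\<close> makes of the
  coefficient in 2 f T(g). No T(g) survives: D_K(f) preserves the span of the X_j.\<close>

lemma app_X:
  assumes i: "i \<in> J"
  shows "app f (X i g) = X i (app f g) - (\<Sum>j\<in>J. sc (sg j) (X i (X j f) \<odot> X (pr j) g))"
proof -
  have "horiz f (X i g) = (\<Sum>j\<in>J. sc (sg j) (X j f \<odot> X i (X (pr j) g)) + (if j = i then sc 2 (X j f \<odot> T g) else 0))"
    unfolding horiz_def
  proof (rule sum.cong)
    fix j assume j: "j \<in> J"
    have "X (pr j) (X i g) = X i (X (pr j) g) + (if j = i then sc (2 * sg j) (T g) else 0)"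
      using X_commutator[OF pr_J[OF j] i, of g] i j by auto
    then show "sc (sg j) (X j f \<odot> X (pr j) (X i g))
      = sc (sg j) (X j f \<odot> X i (X (pr j) g)) + (if j = i then sc 2 (X j f \<odot> T g) else 0)"
      by (auto simp: pmult_add_right pmult_sc_right fs.scale_right_distrib mult.left_commute)
  qed simp
  then have "horiz f (X i g) = (\<Sum>j\<in>J. sc (sg j) (X j f \<odot> X i (X (pr j) g))) + sc 2 (X i f \<odot> T g)"
    unfolding sum.distrib using sum_delta_J[OF i, of "\<lambda>j. sc 2 (X j f \<odot> T g)"] by simp
  moreover have "X i (horiz f g) = (\<Sum>j\<in>J. sc (sg j) (X i (X j f) \<odot> X (pr j) g))
       + (\<Sum>j\<in>J. sc (sg j) (X j f \<odot> X i (X (pr j) g)))"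
    by (simp add: horiz_def X_sum X_sc X_mul[OF i] fs.scale_right_distrib sum.distrib)
  ultimately show ?thesis
    using i by (simp add: app_def X_add X_sc X_mul T_X fs.scale_right_distrib)
qed

text \<open>The second-order sum \<open>?P\<close> occurs in both terms, once through
  \<open>app_X\<close> and once after reindexing by \<open>pr\<close>, and cancels. What remains of
  \<open>app g (X i f)\<close> is X_i of 2 T(f) g.\<close>

lemma app_X_diff:
  assumes i: "i \<in> J"
  shows "app f (X i g) - app g (X i f) = X i (contact_bracket f g)"
proof -
  let ?P = "\<Sum>j\<in>J. sc (sg j) (X i (X j f) \<odot> X (pr j) g)"
  have "horiz g (X i f) = (\<Sum>j\<in>J. sc (sg (pr j)) (X (pr j) g \<odot> X (pr (pr j)) (X i f)))"
    unfolding horiz_def by (rule sum_pr[symmetric])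
  also have "\<dots> = (\<Sum>j\<in>J. - sc (sg j) (X i (X j f) \<odot> X (pr j) g) + (if j = pr i then sc 2 (X i g \<odot> T f) else 0))"
  proof (rule sum.cong)
    fix j assume j: "j \<in> J"
    have "X j (X i f) = X i (X j f) + (if j = pr i then sc (-2 * sg j) (T f) else 0)"
      using X_commutator[OF j i, of f] pr_eq_iff[OF i j] by auto
    then show "sc (sg (pr j)) (X (pr j) g \<odot> X (pr (pr j)) (X i f)) =
         - sc (sg j) (X i (X j f) \<odot> X (pr j) g) + (if j = pr i then sc 2 (X i g \<odot> T f) else 0)"
      using i j
      by (auto simp: pmult_add_right pmult_sc_right fs.scale_right_distrib mult.left_commute pmult_commute)
  qed simp
  also have "\<dots> = - ?P + sc 2 (X i g \<odot> T f)"
    unfolding sum.distrib sum_negf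
    using sum_delta_J[OF pr_J[OF i], of "\<lambda>_. sc 2 (X i g \<odot> T f)"] by simp
  finally have "app g (X i f) = sc 2 (g \<odot> X i (T f)) - ?P + sc 2 (X i g \<odot> T f)"
    using i by (simp add: app_def T_X)
  moreover have "X i (sc 2 (T f \<odot> g)) = sc 2 (g \<odot> X i (T f)) + sc 2 (X i g \<odot> T f)"
    using i by (simp add: X_sc X_mul fs.scale_right_distrib pmult_commute)
  ultimately show ?thesis
    by (simp add: contact_bracket_def X_diff app_X[OF i])
qed

text \<open>The Leibniz rule on the products of \<open>vr j\<close> and \<open>X (pr j) g\<close>
  gives one extra \<open>horiz f g\<close>, because \<open>app f (vr j) = X j f\<close>.\<close>

lemma app_DK_n:
  "app f (DK p r g n) = sc 2 (app f g) - horiz f g - (\<Sum>j\<in>J. sc (sg j) (vr j \<odot> app f (X (pr j) g)))"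
proof -
  have "app f (\<Sum>j\<in>J. sc (sg j) (vr j \<odot> X (pr j) g))
      = (\<Sum>j\<in>J. sc (sg j) (X j f \<odot> X (pr j) g) + sc (sg j) (vr j \<odot> app f (X (pr j) g)))"
    unfolding app_sum by (rule sum.cong) (simp_all add: app_sc app_mul app_vr fs.scale_right_distrib)
  then show ?thesis by (simp add: DK_n app_diff app_sc horiz_def sum.distrib)
qed

text \<open>The components in \<open>J\<close> are \<open>app_X_diff\<close>. The last component of
  a D_K is determined by its function and the other components, so \<open>app_X_diff\<close> settles
  most of it too.\<close>

theorem bracket_DK: "bracket p n (DK p r f) (DK p r g) = DK p r (contact_bracket f g)"
proof
  fix j
  have b: "bracket p n (DK p r f) (DK p r g) j = app f (DK p r g j) - app g (DK p r f j)" if "j \<in> {1..n}"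
    unfolding bracket_def using that DK_app[of f "DK p r g j"] DK_app[of g "DK p r f j"]
    by (simp add: sum_subtractf del: sum.cl_ivl_Suc)
  consider "j \<in> J" | "j = n" | "j \<notin> {1..n}" unfolding range_n by blast
  then show "bracket p n (DK p r f) (DK p r g) j = DK p r (contact_bracket f g) j"
  proof cases
    case 1
    then have "j \<in> {1..n}" unfolding range_n by simp
    from b[OF this] show ?thesis unfolding DK_J[OF 1] app_X_diff[OF 1] .
  next
    case 2
    have "app f (DK p r g n) - app g (DK p r f n) = sc 2 (app f g) - horiz f g - (sc 2 (app g f) - horiz g f)
       - (\<Sum>j\<in>J. sc (sg j) (vr j \<odot> app f (X (pr j) g)) - sc (sg j) (vr j \<odot> app g (X (pr j) f)))"
      unfolding app_DK_n sum_subtractf by simp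
    also have "(\<Sum>j\<in>J. sc (sg j) (vr j \<odot> app f (X (pr j) g)) - sc (sg j) (vr j \<odot> app g (X (pr j) f)))
       = (\<Sum>j\<in>J. sc (sg j) (vr j \<odot> X (pr j) (contact_bracket f g)))"
      by (rule sum.cong)
        (simp_all add: app_X_diff[OF pr_J, symmetric] pmult_diff_right fs.scale_right_diff_distrib)
    \<comment> \<open>By antisymmetry the four multiples of \<open>horiz\<close> add up to 2
      \<open>horiz f g\<close>, as the right side requires.\<close>
    also have "sc 2 (app f g) - horiz f g - (sc 2 (app g f) - horiz g f) = sc 2 (contact_bracket f g)"
      unfolding contact_bracket_def app_def horiz_swap[of g f] pmult_commute[of _ _ g]
      by (auto simp: fun_eq_iff sc_def algebra_simps)
    finally have "app f (DK p r g n) - app g (DK p r f n) = DK p r (contact_bracket f g) n"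
      unfolding DK_n[of "contact_bracket f g"] .
    then show ?thesis using 2 b n_pos by simp
  next
    case 3
    then show ?thesis by (auto simp: bracket_def DK_def n_eq)
  qed
qed

text \<open>The last component plus the sum of \<sigma>(j) x_j f_j', that is, the contact form
  evaluated on D_K(f), is 2f; so f can be read off.\<close>

lemma DK_inj:
  assumes "DK p r f = (0 :: 'a der)"
  shows "f = 0"
proof -
  have "X j f = 0" if "j \<in> J" for j using DK_J[OF that, of f] assms by simp
  then have "(\<Sum>j\<in>J. sc (sg j) (vr j \<odot> X (pr j) f)) = 0"
    by (intro sum.neutral) (use pr_J in auto)
  then have "sc 2 f = 0" using DK_n[of f] assms by simp
  then show ?thesis using two_neq_0 by simp
qed

end

section \<open>The derived algebra and the action of W(1) on monomials\<close>

context contact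
begin

abbreviation mon :: "(nat \<Rightarrow> nat) \<Rightarrow> 'a coeffs" where "mon \<equiv> mono p n"

lemma DK_zero [simp]: "DK p r (0 :: 'a coeffs) = 0"
  using DK_sc[of p r "0::'a" 0] by simp

definition top_idx :: "nat \<Rightarrow> nat" where
  "top_idx = (\<lambda>i. if 1 \<le> i \<and> i \<le> n then p - 1 else 0)"

definition K_idx :: "(nat \<Rightarrow> nat) set" where
  "K_idx = {\<gamma>. valid_idx p n \<gamma> \<and> \<not> ((2*r+4) mod p = 0 \<and> \<gamma> = top_idx)}"

text \<open>Described by supports of coefficient functions: as \<open>DK\<close> is injective,
  unions and disjointness of exponent sets become sums and trivial intersections of
  submodules.\<close>

definition DKs :: "(nat \<Rightarrow> nat) set \<Rightarrow> 'a der set" where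
  "DKs S = DK p r ` {f. \<forall>\<gamma>. f \<gamma> \<noteq> 0 \<longrightarrow> \<gamma> \<in> S}"

lemma subspace_DKs: "ds.subspace (DKs S)"
  unfolding ds.subspace_def
proof (intro conjI ballI allI)
  show "0 \<in> DKs S" unfolding DKs_def
    by (rule image_eqI[of _ _ 0]) simp_all
  show "x + y \<in> DKs S" if "x \<in> DKs S" "y \<in> DKs S" for x y
  proof -
    from that obtain f g where "x = DK p r f" "y = DK p r g" "\<forall>\<gamma>. f \<gamma> \<noteq> 0 \<longrightarrow> \<gamma> \<in> S" "\<forall>\<gamma>. g \<gamma> \<noteq> 0 \<longrightarrow> \<gamma> \<in> S"
      unfolding DKs_def by auto
    moreover from this have "(f + g) \<gamma> \<noteq> 0 \<longrightarrow> \<gamma> \<in> S" for \<gamma>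
      by (cases "f \<gamma> = 0") auto
    ultimately show ?thesis unfolding DKs_def by (intro image_eqI[of _ _ "f + g"]) (auto simp: DK_add)
  qed
  show "scD c x \<in> DKs S" if "x \<in> DKs S" for c x
  proof -
    from that obtain f where "x = DK p r f" "\<forall>\<gamma>. f \<gamma> \<noteq> 0 \<longrightarrow> \<gamma> \<in> S"
      unfolding DKs_def by auto
    then show ?thesis unfolding DKs_def by (intro image_eqI[of _ _ "sc c f"]) (auto simp: DK_sc sc_apply)
  qed
qed

lemmas zero_in_DKs = ds.subspace_0[OF subspace_DKs]

lemma DK_mono_in_DKs: "\<gamma> \<in> S \<Longrightarrow> DK p r (mon \<gamma>) \<in> DKs S"
  unfolding DKs_def by (rule imageI) (auto simp: mono_def)

lemma DK_expand:
  assumes "\<And>\<gamma>. f \<gamma> \<noteq> 0 \<Longrightarrow> \<gamma> \<in> S" "S \<subseteq> idxs p n"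
  shows "DK p r f = (\<Sum>\<gamma>\<in>S. scD (f \<gamma>) (DK p r (mon \<gamma> :: _ \<Rightarrow> 'a)))"
proof -
  have "(\<Sum>\<gamma>\<in>S. sc (f \<gamma>) (mon \<gamma>)) = (\<Sum>\<gamma>\<in>idxs p n. sc (f \<gamma>) (mon \<gamma>))"
    using assms by (intro sum.mono_neutral_left finite_valid_idx) (auto simp: subset_iff)
  also have "\<dots> = f" unfolding cut_expand by (rule cut_id) (use assms in auto)
  finally have "f = (\<Sum>\<gamma>\<in>S. sc (f \<gamma>) (mon \<gamma>))" ..
  then have "DK p r f = DK p r (\<Sum>\<gamma>\<in>S. sc (f \<gamma>) (mon \<gamma>))" by simp
  then show ?thesis unfolding DK_sum DK_sc .
qed

lemma DKs_eq_span:
  assumes "S \<subseteq> idxs p n"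
  shows "DKs S = ds.span ((\<lambda>\<gamma>. DK p r (mon \<gamma>)) ` S)"
proof
  show "DKs S \<subseteq> ds.span ((\<lambda>\<gamma>. DK p r (mon \<gamma>)) ` S)"
  proof
    fix x assume "x \<in> DKs S"
    then obtain f where f: "x = DK p r f" "\<forall>\<gamma>. f \<gamma> \<noteq> 0 \<longrightarrow> \<gamma> \<in> S" unfolding DKs_def by auto
    then have "x = (\<Sum>\<gamma>\<in>S. scD (f \<gamma>) (DK p r (mon \<gamma>)))" using DK_expand[OF _ assms] by auto
    also have "\<dots> \<in> ds.span ((\<lambda>\<gamma>. DK p r (mon \<gamma>)) ` S)"
      by (intro ds.span_sum ds.span_scale) (rule ds.span_base, simp)
    finally show "x \<in> ds.span ((\<lambda>\<gamma>. DK p r (mon \<gamma>)) ` S)" .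
  qed
  show "ds.span ((\<lambda>\<gamma>. DK p r (mon \<gamma>)) ` S) \<subseteq> DKs S"
    by (rule ds.span_minimal) (auto simp: subspace_DKs DK_mono_in_DKs)
qed

lemma Ktilde_eq: "Ktilde p r = DKs (idxs p n)"
proof -
  have "{DK p r (mono p (2*r+1) \<alpha>) | \<alpha>. valid_idx p (2*r+1) \<alpha>} = (\<lambda>\<gamma>. DK p r (mon \<gamma> :: _ \<Rightarrow> 'a)) ` (idxs p n)"
    unfolding n_eq by auto
  then show ?thesis unfolding Ktilde_def fspanD_eq_span by (simp add: DKs_eq_span)
qed

lemma pderiv_i_top: "1 \<le> i \<Longrightarrow> i \<le> n \<Longrightarrow> pderiv_i p n i f top_idx = 0"
proof -
  assume i: "1 \<le> i" "i \<le> n"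
  have "\<not> valid_idx p n (top_idx(i := Suc (top_idx i)))"
  proof
    assume "valid_idx p n (top_idx(i := Suc (top_idx i)))"
    then have "(top_idx(i := Suc (top_idx i))) i < p" using i unfolding valid_idx_def by blast
    then show False using i p_gt_2 by (simp add: top_idx_def)
  qed
  then show ?thesis by (simp add: pderiv_i_def)
qed

lemma T_top: "T f top_idx = 0"
  using pderiv_i_top[of n f] n_pos by simp

text \<open>Since \<open>T (vr j) = 0\<close>, the term \<open>vr j \<odot> T f\<close> equals
  \<open>T (vr j \<odot> f)\<close>, so \<open>X j f\<close> is a sum of derivatives.\<close>

lemma X_top:
  assumes "j \<in> J"
  shows "X j f top_idx = 0"
proof -
  have "T (vr j \<odot> f) = vr j \<odot> T f" using assms by (simp add: pderiv_i_pmult n_pos T_vr)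
  then have "(vr j \<odot> T f) top_idx = 0" using T_top by metis
  moreover have "pderiv_i p n (pr j) f top_idx = 0"
    using J_bounds pr_J[OF assms] by (intro pderiv_i_top) auto
  ultimately show ?thesis by (simp add: X_def sc_apply)
qed

text \<open>Integration by parts along each \<open>X j\<close> leaves minus the top coefficient of
  \<open>f \<odot> Z\<close>, with Z the sum of \<sigma>(j) X_j X_j' (g). Reindexing by
  \<open>pr\<close> and commuting gives Z = -Z - 4r T(g), hence Z = -2r T(g).\<close>

lemma horiz_top: "horiz f g top_idx = of_nat (2*r) * (f \<odot> T g) top_idx"
proof -
  define Z where "Z = (\<Sum>j\<in>J. sc (sg j) (X j (X (pr j) g)))"
  have "Z = (\<Sum>j\<in>J. sc (sg (pr j)) (X (pr j) (X (pr (pr j)) g)))"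
    unfolding Z_def by (rule sum_pr[symmetric])
  also have "\<dots> = (\<Sum>j\<in>J. - sc (sg j) (X j (X (pr j) g)) + - sc 2 (T g))"
  proof (rule sum.cong)
    fix j assume j: "j \<in> J"
    have "X j (X (pr j) g) = X (pr j) (X j g) + sc (- 2 * sg j) (T g)"
      using X_commutator[OF j pr_J[OF j]] by simp
    then show "sc (sg (pr j)) (X (pr j) (X (pr (pr j)) g)) = - sc (sg j) (X j (X (pr j) g)) + - sc 2 (T g)"
      using j by (simp add: fs.scale_right_distrib fs.scale_right_diff_distrib mult.left_commute)
  qed simp
  finally have "Z = (\<Sum>j\<in>J. - sc (sg j) (X j (X (pr j) g)) + - sc 2 (T g))" .
  also have "\<dots> = - Z - sc (of_nat (2*r)) (sc 2 (T g))"
    unfolding sum.distrib sum_negf Z_def[symmetric]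
    by (auto simp: J_def sum_fun_apply sc_def fun_eq_iff algebra_simps)
  finally have "Z = - Z - sc (of_nat (2*r)) (sc 2 (T g))" .
  then have "Z \<gamma> = - Z \<gamma> - of_nat (2*r) * (2 * T g \<gamma>)" for \<gamma>
    by (metis (no_types, lifting) minus_apply sc_apply uminus_apply)
  then have "2 * (Z \<gamma> + of_nat (2*r) * T g \<gamma>) = 0" for \<gamma>
    by (simp add: algebra_simps eq_neg_iff_add_eq_0 eq_diff_eq)
  then have "Z \<gamma> + of_nat (2*r) * T g \<gamma> = 0" for \<gamma>
    using two_neq_0 unfolding mult_eq_0_iff by blast
  then have "Z \<gamma> = - (of_nat (2*r) * T g \<gamma>)" for \<gamma>
    unfolding eq_neg_iff_add_eq_0 .
  then have Z: "Z = sc (- of_nat (2*r)) (T g)" by (auto simp: sc_def fun_eq_iff)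
  have "horiz f g top_idx = (\<Sum>j\<in>J. - sc (sg j) (f \<odot> X j (X (pr j) g)) top_idx)"
    unfolding horiz_def sum_fun_apply
  proof (rule sum.cong)
    fix j assume j: "j \<in> J"
    have "(X j f \<odot> X (pr j) g + f \<odot> X j (X (pr j) g)) top_idx = 0"
      unfolding X_mul[OF j, symmetric] by (rule X_top[OF j])
    then show "sc (sg j) (X j f \<odot> X (pr j) g) top_idx = - sc (sg j) (f \<odot> X j (X (pr j) g)) top_idx"
      by (simp add: sc_apply eq_neg_iff_add_eq_0 flip: distrib_left)
  qed simp
  also have "\<dots> = - (f \<odot> Z) top_idx"
    by (simp add: Z_def pmult_sum_right pmult_sc_right sum_fun_apply sum_negf)
  finally show ?thesis unfolding Z pmult_sc_right by (simp add: sc_apply)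
qed

text \<open>\<open>f \<mapsto> f top_idx\<close> is the Berezin-type integral vanishing on derivatives, and \<open>2r + 4\<close> arises by
  integrating the contact bracket by parts.\<close>
lemma contact_bracket_top: "contact_bracket f g top_idx = of_nat (2*r+4) * (f \<odot> T g) top_idx"
proof -
  have "(T f \<odot> g + f \<odot> T g) top_idx = 0"
    using T_top[of "f \<odot> g"] by (simp add: pderiv_i_pmult n_pos)
  then have "(T f \<odot> g) top_idx = - (f \<odot> T g) top_idx" by (simp add: eq_neg_iff_add_eq_0)
  then show ?thesis by (simp add: contact_bracket_def app_def horiz_top sc_apply algebra_simps)
qed

lemma contact_bracket_valid:
  assumes "contact_bracket f g \<gamma> \<noteq> 0"
  shows "valid_idx p n \<gamma>"
proof (rule ccontr)
  assume v: "\<not> valid_idx p n \<gamma>"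
  then have "(u \<odot> v) \<gamma> = 0" for u v by (simp add: pmult_def)
  then have "contact_bracket f g \<gamma> = 0"
    by (simp add: contact_bracket_def app_def horiz_def sum_fun_apply sc_apply)
  with assms show False by simp
qed

definition tpow :: "nat \<Rightarrow> 'a coeffs" where
  "tpow a = mon (\<lambda>k. if k = n then a else 0)"

text \<open>A power of t depends on t alone, so \<open>X j\<close> acts on it as x_j T. In the sum
  that remains the terms with x_j x_j' T(g) cancel in pairs under \<open>pr\<close>, and the Euler
  operator of the first 2r variables is left.\<close>

lemma horiz_tpow: "horiz (tpow a) (mon \<gamma>) = sc (of_nat (\<Sum>j\<in>J. \<gamma> j)) (T (tpow a) \<odot> mon \<gamma>)"
proof (cases "valid_idx p n \<gamma>")
  case False
  then show ?thesis by (simp add: mono_invalid horiz_def X_def)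
next
  case True
  let ?g = "mon \<gamma> :: _ \<Rightarrow> 'a"
  have d: "pderiv_i p n j (tpow a) = 0" if "j \<in> J" for j
    using J_bounds[OF that] by (auto simp: tpow_def pderiv_i_mono)
  define A where "A = (\<Sum>j\<in>J. sc (sg j) (vr j \<odot> (vr (pr j) \<odot> T ?g)))"
  have "A = (\<Sum>j\<in>J. sc (sg (pr j)) (vr (pr j) \<odot> (vr (pr (pr j)) \<odot> T ?g)))"
    unfolding A_def by (rule sum_pr[symmetric])
  also have "\<dots> = (\<Sum>j\<in>J. - sc (sg j) (vr j \<odot> (vr (pr j) \<odot> T ?g)))"
    by (rule sum.cong) (simp_all add: pmult_left_commute[of p n "vr (pr _)" "vr _"])
  also have "\<dots> = - A" by (simp add: A_def sum_negf)
  finally have "A = - A" .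
  then have "A \<eta> = - A \<eta>" for \<eta> by (metis uminus_apply)
  then have "2 * A \<eta> = 0" for \<eta> by (simp add: eq_neg_iff_add_eq_0 flip: mult_2)
  then have A: "A = 0" using two_neq_0 by (auto simp: fun_eq_iff)
  have "horiz (tpow a) ?g = (\<Sum>j\<in>J. T (tpow a) \<odot> sc (sg j) (vr j \<odot> X (pr j) ?g))"
    unfolding horiz_def
  proof (rule sum.cong)
    fix j assume "j \<in> J"
    then have "X j (tpow a) = vr j \<odot> T (tpow a)" using d[OF pr_J] by (simp add: X_def)
    then show "sc (sg j) (X j (tpow a) \<odot> X (pr j) ?g) = T (tpow a) \<odot> sc (sg j) (vr j \<odot> X (pr j) ?g)"
      by (simp add: pmult_sc_right pmult_ac)
  qed simp
  also have "\<dots> = T (tpow a) \<odot> (\<Sum>j\<in>J. sc (sg j) (vr j \<odot> X (pr j) ?g))"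
    by (simp add: pmult_sum_right)
  also have "(\<Sum>j\<in>J. sc (sg j) (vr j \<odot> X (pr j) ?g)) = (\<Sum>j\<in>J. sc (sg j) (vr j \<odot> (vr (pr j) \<odot> T ?g)) + sc (of_nat (\<gamma> j)) ?g)"
  proof (rule sum.cong)
    fix j assume j: "j \<in> J"
    note b = J_bounds[OF j]
    have "vr j \<odot> pderiv_i p n j ?g = sc (of_nat (\<gamma> j)) ?g"
    proof (cases "\<gamma> j = 0")
      case False
      have "valid_idx p n (\<gamma>(j := \<gamma> j - 1))" by (rule valid_idx_le[OF True]) auto
      moreover have "(\<lambda>i. (if i = j then 1 else 0) + (\<gamma>(j := \<gamma> j - 1)) i) = \<gamma>"
        using False by (auto simp: fun_eq_iff)
      ultimately show ?thesis using b
        by (simp add: pderiv_i_mono pmult_sc_right var_def pmult_mono_mono)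
    qed (use b in \<open>simp add: pderiv_i_mono\<close>)
    then show "sc (sg j) (vr j \<odot> X (pr j) ?g) = sc (sg j) (vr j \<odot> (vr (pr j) \<odot> T ?g)) + sc (of_nat (\<gamma> j)) ?g"
      using j by (simp add: X_def pmult_add_right pmult_sc_right fs.scale_right_distrib mult.assoc[symmetric])
  qed simp
  also have "\<dots> = sc (of_nat (\<Sum>j\<in>J. \<gamma> j)) ?g"
    unfolding sum.distrib A_def[symmetric] A by (simp add: fs.scale_sum_left)
  finally show ?thesis by (simp add: pmult_sc_right)
qed

text \<open>The exponent uses truncated subtraction: it is off only for
  \<open>\<gamma> n = 0\<close> and \<open>a = 0\<close>, where the coefficient is 0.\<close>

lemma contact_bracket_tpow:
  assumes v: "valid_idx p n \<gamma>"
  shows "contact_bracket (tpow a) (mon \<gamma>)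
    = sc (2 * of_nat (\<gamma> n) + of_nat a * (of_nat (\<Sum>j\<in>J. \<gamma> j) - 2)) (mon (\<gamma>(n := \<gamma> n + a - 1)))"
proof -
  let ?m = "mon (\<gamma>(n := \<gamma> n + a - 1)) :: _ \<Rightarrow> 'a"
  have 1: "tpow a \<odot> T (mon \<gamma>) = sc (of_nat (\<gamma> n)) ?m"
  proof (cases "\<gamma> n = 0")
    case False
    have "valid_idx p n (\<gamma>(n := \<gamma> n - 1))" by (rule valid_idx_le[OF v]) auto
    moreover have "(\<lambda>i. (if i = n then a else 0) + (\<gamma>(n := \<gamma> n - 1)) i) = \<gamma>(n := \<gamma> n + a - 1)"
      using False by (auto simp: fun_eq_iff)
    ultimately show ?thesis by (simp add: tpow_def pderiv_i_mono n_pos pmult_sc_right pmult_mono_mono)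
  qed (simp add: pderiv_i_mono n_pos)
  have 2: "T (tpow a) \<odot> mon \<gamma> = sc (of_nat a) ?m"
  proof (cases "a = 0")
    case False
    have "(\<lambda>i. ((\<lambda>k. if k = n then a else 0)(n := a - 1)) i + \<gamma> i) = \<gamma>(n := \<gamma> n + a - 1)"
      using False by (auto simp: fun_eq_iff)
    then show ?thesis using v by (simp add: tpow_def pderiv_i_mono n_pos pmult_sc_left pmult_mono_mono)
  qed (simp add: tpow_def pderiv_i_mono n_pos)
  show ?thesis
    unfolding contact_bracket_def app_def horiz_tpow 1 2
    by (auto simp: fun_eq_iff sc_def algebra_simps)
qed

lemma actK_DK: "actK p r a (DK p r f) = scD (inverse 2) (DK p r (contact_bracket (tpow a) f))"
  unfolding actK_def ThetaK_def bracket_sc_left n_eq[symmetric] tpow_def[symmetric] bracket_DK ..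

text \<open>The factor 1/2 in \<Theta>_K turns 2m + a(|\<gamma>| - 2), with |\<gamma>| the degree in
  the first 2r variables, into m + ac. This is the structure constant of densities of degree
  c.\<close>

lemma actK_DK_mono:
  assumes "valid_idx p n \<gamma>" "(of_nat (\<Sum>j\<in>J. \<gamma> j) :: 'a) = of_nat (2 * c + 2)"
  shows "actK p r a (DK p r (mon \<gamma>))
    = scD (of_nat (\<gamma> n + a * c) :: 'a) (DK p r (mon (\<gamma>(n := \<gamma> n + a - 1))))"
proof -
  have "inverse 2 * (2 * of_nat (\<gamma> n) + of_nat a * (of_nat (2 * c + 2) - 2)) = (of_nat (\<gamma> n + a * c) :: 'a)"
    using two_neq_0 by (simp add: field_simps)
  then show ?thesis
    unfolding actK_DK contact_bracket_tpow[OF assms(1)] assms(2) by (simp add: DK_sc)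
qed

text \<open>The hypotheses are equations so that the definitions of \<open>tpow\<close> and
  \<open>var\<close> can be plugged in. Exponents may be invalid, in which case \<open>mon\<close>
  is 0.\<close>

lemma bracket_in_Kalg:
  assumes "f = mon \<alpha>" "g = mon \<beta>"
  shows "DK p r (contact_bracket f g) \<in> Kalg p r"
proof -
  have m: "DK p r (mon \<alpha>) \<in> Ktilde p r" for \<alpha>
  proof (cases "valid_idx p n \<alpha>")
    case True
    then show ?thesis unfolding Ktilde_eq by (simp add: DK_mono_in_DKs)
  next
    case False
    then have "mon \<alpha> = 0" by (rule mono_invalid)
    then show ?thesis using zero_in_DKs unfolding Ktilde_eq by simp
  qed
  have "bracket p (2*r+1) (DK p r f) (DK p r g) \<in> Kalg p r"
    unfolding Kalg_def fspanD_eq_span by (rule ds.span_base) (use m assms in blast)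
  then show ?thesis unfolding n_eq[symmetric] bracket_DK .
qed

lemma subspace_Kalg: "ds.subspace (Kalg p r :: 'a der set)"
  unfolding Kalg_def fspanD_eq_span by (rule ds.subspace_span)

lemmas zero_in_Kalg = ds.subspace_0[OF subspace_Kalg]

lemma scD_cancel_in:
  assumes "ds.subspace V" "scD c x \<in> V" "c \<noteq> 0"
  shows "x \<in> V"
  using ds.subspace_scale[OF assms(1,2), of "inverse c"] assms(3) by simp

lemma of_nat_neq_0: "0 < k \<Longrightarrow> k < p \<Longrightarrow> (of_nat k :: 'a) \<noteq> 0"
  unfolding of_nat_eq_0_iff by (auto dest: dvd_imp_le)

lemma valid_upd: "valid_idx p n \<gamma> \<Longrightarrow> 1 \<le> i \<Longrightarrow> i \<le> n \<Longrightarrow> k < p \<Longrightarrow> valid_idx p n (\<gamma>(i := k))"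
  by (auto simp: valid_idx_def)

text \<open>The contact bracket with 1 is 2T, and lowering the exponent of t reaches everything
  below p-1.\<close>

lemma DK_mono_in_Kalg_low:
  assumes "valid_idx p n \<gamma>" "\<gamma> n < p - 1"
  shows "DK p r (mon \<gamma>) \<in> Kalg p r"
proof -
  let ?g = "\<gamma>(n := Suc (\<gamma> n))"
  have v: "valid_idx p n ?g" using assms n_pos by (intro valid_upd) auto
  have "contact_bracket (tpow 0) (mon ?g) = sc (2 * of_nat (Suc (\<gamma> n))) (mon \<gamma>)"
    unfolding contact_bracket_tpow[OF v] by simp
  then have "scD (2 * of_nat (Suc (\<gamma> n))) (DK p r (mon \<gamma>)) \<in> Kalg p r"
    using bracket_in_Kalg[OF tpow_def[of 0] refl, of ?g] by (simp add: DK_sc)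
  moreover have "(2 * of_nat (Suc (\<gamma> n)) :: 'a) \<noteq> 0"
    using of_nat_neq_0[of "Suc (\<gamma> n)"] two_neq_0 assms(2) by (simp del: of_nat_Suc)
  ultimately show ?thesis using scD_cancel_in[OF subspace_Kalg] by blast
qed

text \<open>This is \<open>X i\<close> with the sign of the partial derivative reversed. It lowers
  the exponent of x_i' without changing that of t, up to a term of lower t-exponent.\<close>

lemma contact_bracket_vr:
  assumes "i \<in> J"
  shows "contact_bracket (vr i) g = vr i \<odot> T g + sc (sg i) (pderiv_i p n (pr i) g)"
proof -
  have "horiz (vr i) g = - X i g"
    using app_vr[OF assms, of g] horiz_swap[of "vr i" g] T_vr[OF assms] by (simp add: app_def)
  then show ?thesis using assms
    by (auto simp: contact_bracket_def app_def T_vr X_def sc_def fun_eq_iff)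
qed

lemma DK_mono_in_Kalg:
  assumes "\<gamma> \<in> K_idx"
  shows "DK p r (mon \<gamma>) \<in> Kalg p r"
proof -
  have v: "valid_idx p n \<gamma>" using assms by (simp add: K_idx_def)
  have le: "\<gamma> j \<le> p - 1" for j
  proof (cases "1 \<le> j \<and> j \<le> n")
    case True
    then have "\<gamma> j < p" using v unfolding valid_idx_def by blast
    then show ?thesis by simp
  next
    case False
    then have "\<gamma> j = 0" using v unfolding valid_idx_def by blast
    then show ?thesis by simp
  qed
  consider "\<gamma> n < p - 1" | j where "\<gamma> n = p - 1" "j \<in> J" "\<gamma> j < p - 1" | "\<forall>j\<in>insert n J. \<gamma> j = p - 1"
    using le by (metis insert_iff nat_less_le)
  then show ?thesis
  proof cases
    case 1
    with v show ?thesis by (rule DK_mono_in_Kalg_low)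
  next
    case (2 j)
    \<comment> \<open>The contact bracket of x_i, for i = j', with x^\<gamma> x_j brings the
      exponent of x_j back down. The additional term has t-exponent p-2, so
      \<open>DK_mono_in_Kalg_low\<close> covers it unless it is 0.\<close>
    define i where "i = pr j"
    have i: "i \<in> J" "pr i = j" using 2 pr_J[of j] pr_pr[of j] by (simp_all add: i_def)
    have b: "1 \<le> j" "j \<le> n" "j \<noteq> n" using J_bounds[OF 2(2)] by auto
    let ?g = "\<gamma>(j := Suc (\<gamma> j))"
    have vg: "valid_idx p n ?g" using v 2 b by (intro valid_upd) auto
    let ?h = "(\<lambda>k. (if k = i then 1 else 0) + (?g(n := p - 2)) k)"
    have vg': "valid_idx p n (?g(n := p - 2))" using p_gt_2 n_pos by (intro valid_upd[OF vg]) auto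
    have T: "vr i \<odot> T (mon ?g) = sc (of_nat (p - 1)) (mon ?h)"
    proof -
      have "?g n = p - 1" "?g n - 1 = p - 2" using 2 b by auto
      then have "T (mon ?g) = sc (of_nat (p - 1)) (mon (?g(n := p - 2)) :: _ \<Rightarrow> 'a)"
        using pderiv_i_mono[of n ?g] n_pos by simp
      then show ?thesis
        by (simp add: var_def pmult_sc_right pmult_mono_mono[OF vg'])
    qed
    have d: "pderiv_i p n j (mon ?g) = sc (of_nat (Suc (\<gamma> j)) :: 'a) (mon \<gamma>)"
      using b by (simp add: pderiv_i_mono)
    have in1: "DK p r (contact_bracket (vr i) (mon ?g)) \<in> Kalg p r"
      by (rule bracket_in_Kalg[OF var_def refl])
    have in2: "DK p r (mon ?h) \<in> Kalg p r"
    proof (cases "valid_idx p n ?h")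
      case True
      have "i \<noteq> n" using J_bounds(3)[OF i(1)] .
      then show ?thesis using True p_gt_2 by (intro DK_mono_in_Kalg_low) auto
    next
      case False
      then show ?thesis using zero_in_Kalg by (simp add: mono_invalid)
    qed
    have "contact_bracket (vr i) (mon ?g)
        = sc (of_nat (p - 1)) (mon ?h) + sc (sg i * of_nat (Suc (\<gamma> j))) (mon \<gamma>)"
      unfolding contact_bracket_vr[OF i(1)] i(2) T d by simp
    then have e: "DK p r (contact_bracket (vr i) (mon ?g)) - scD (of_nat (p - 1)) (DK p r (mon ?h))
       = scD (sg i * of_nat (Suc (\<gamma> j))) (DK p r (mon \<gamma>))"
      by (simp only: DK_add DK_sc add_diff_cancel_left')
    have "scD (sg i * of_nat (Suc (\<gamma> j))) (DK p r (mon \<gamma>)) \<in> Kalg p r"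
      unfolding e[symmetric]
      by (intro ds.subspace_diff[OF subspace_Kalg] ds.subspace_scale[OF subspace_Kalg] in1 in2)
    moreover have "sg i * of_nat (Suc (\<gamma> j)) \<noteq> 0"
      using of_nat_neq_0[of "Suc (\<gamma> j)"] 2 by (simp add: sigma_def del: of_nat_Suc)
    ultimately show ?thesis using scD_cancel_in[OF subspace_Kalg] by blast
  next
    case 3
    \<comment> \<open>Only the top monomial is left. It is an eigenvector of the contact bracket
      with t, with eigenvalue -(2r+4), which is nonzero because the exponent lies in
      \<open>K_idx\<close>.\<close>
    have "\<gamma> j = top_idx j" for j
    proof (cases "j \<in> {1..n}")
      case True
      then show ?thesis using 3 unfolding range_n[symmetric] by (simp add: top_idx_def)
    next
      case False
      then have "\<gamma> j = 0" using v unfolding valid_idx_def by auto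
      then show ?thesis using False by (auto simp: top_idx_def)
    qed
    then have "\<gamma> = top_idx" ..
    then have nz: "(2*r+4) mod p \<noteq> 0" using assms by (simp add: K_idx_def)
    have s: "(\<Sum>j\<in>J. \<gamma> j) = 2*r*(p-1)" using 3 by (simp add: J_def)
    have m1: "(of_nat (p - 1) :: 'a) = - 1"
      using p_gt_2 of_nat_eq_0_iff[of p] by (simp add: of_nat_diff)
    have g: "\<gamma>(n := \<gamma> n + 1 - 1) = \<gamma>" by simp
    have gn: "\<gamma> n = p - 1" using 3 by simp
    have "contact_bracket (tpow 1) (mon \<gamma>) = sc (- of_nat (2*r+4)) (mon \<gamma>)"
    proof -
      have "2 * of_nat (\<gamma> n) + of_nat 1 * (of_nat (\<Sum>j\<in>J. \<gamma> j) - 2) = (- of_nat (2*r+4) :: 'a)"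
        unfolding s gn of_nat_mult m1 by (simp add: algebra_simps)
      then show ?thesis unfolding contact_bracket_tpow[OF v] g by (rule arg_cong)
    qed
    then have "scD (- of_nat (2*r+4)) (DK p r (mon \<gamma>)) \<in> Kalg p r"
      using bracket_in_Kalg[OF tpow_def[of 1] refl, of \<gamma>] by (simp only: DK_sc)
    moreover have "(- of_nat (2*r+4) :: 'a) \<noteq> 0"
      using nz of_nat_eq_0_iff[of "2*r+4"] unfolding dvd_eq_mod_eq_0 by (metis neg_equal_0_iff_equal)
    ultimately show ?thesis using scD_cancel_in[OF subspace_Kalg] by blast
  qed
qed

lemma Kalg_eq: "Kalg p r = DKs K_idx"
proof
  show "DKs K_idx \<subseteq> Kalg p r"
    by (subst DKs_eq_span, force simp: K_idx_def, rule ds.span_minimal[OF _ subspace_Kalg])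
      (auto intro: DK_mono_in_Kalg)
  show "Kalg p r \<subseteq> DKs K_idx"
    unfolding Kalg_def fspanD_eq_span
  proof (rule ds.span_minimal[OF _ subspace_DKs])
    have "bracket p n (DK p r f) (DK p r g) \<in> DKs K_idx" for f g :: "'a coeffs"
      unfolding bracket_DK DKs_def
    proof (rule imageI, rule CollectI, intro allI impI)
      fix \<gamma> assume nz: "contact_bracket f g \<gamma> \<noteq> 0"
      have "(of_nat (2*r+4) :: 'a) = 0" if "(2*r+4) mod p = 0"
        using that of_nat_eq_0_iff[of "2*r+4"] unfolding dvd_eq_mod_eq_0 by (rule iffD2[rotated])
      then have "contact_bracket f g top_idx = 0" if "(2*r+4) mod p = 0"
        using that contact_bracket_top[of f g] by simp
      with nz show "\<gamma> \<in> K_idx" using contact_bracket_valid[OF nz] by (auto simp: K_idx_def)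
    qed
    then show "{bracket p (2*r+1) D E | D E. D \<in> Ktilde p r \<and> E \<in> Ktilde p r} \<subseteq> DKs K_idx"
      unfolding Ktilde_eq n_eq by (auto simp: DKs_def)
  qed
qed

end

section \<open>Tensor densities on the line\<close>

text \<open>\<open>dop c g\<close> is the Lie derivative along \<open>g \<partial>\<close> on tensor densities of degree \<open>c\<close>.\<close>
definition dop :: "nat \<Rightarrow> 'a::field poly \<Rightarrow> 'a poly \<Rightarrow> 'a poly" where
  "dop c g q = g * pderiv q + of_nat c * pderiv g * q"

lemma dop_mult: "dop (c + d) g (a * b) = dop c g a * b + a * dop d g b"
  by (simp add: dop_def pderiv_mult algebra_simps)

lemma dop_add: "dop c g (a + b) = dop c g a + dop c g b"
  by (simp add: dop_def pderiv_add algebra_simps)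

lemma dop_smult: "dop c g (smult k a) = smult k (dop c g a)"
  by (simp add: dop_def pderiv_smult smult_add_right)

lemma dop_add_left: "dop c (g + h) a = dop c g a + dop c h a"
  by (simp add: dop_def pderiv_add algebra_simps)

lemma dop_of_nat_mult: "dop c g (of_nat k * a) = of_nat k * dop c g a"
  by (simp add: of_nat_poly dop_smult)

lemma dop_sum: "dop c g (\<Sum>x\<in>A. f x) = (\<Sum>x\<in>A. dop c g (f x))"
  by (rule additive_sum[where h = "dop c g"]) (rule dop_add)

lemma dop_sum_left: "dop c (\<Sum>x\<in>A. g x) q = (\<Sum>x\<in>A. dop c (g x) q)"
  by (rule additive_sum[where h = "\<lambda>g. dop c g q"]) (rule dop_add_left)

text \<open>Densities of each degree form a module for the vector fields on the line, with g h' - h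
  g' as their bracket. The identity lives in genuine polynomials, where no truncation
  interferes.\<close>

lemma dop_commutator:
  "dop c g (dop c h q) - dop c h (dop c g q) = dop c (g * pderiv h - h * pderiv g) q"
  by (simp add: dop_def pderiv_mult pderiv_add pderiv_diff pderiv_of_nat algebra_simps)

lemma dop_funpow_mult:
  "(dop (c + d) g ^^ n) (a * b) = (\<Sum>k\<le>n. of_nat (n choose k) * ((dop c g ^^ k) a * (dop d g ^^ (n - k)) b))"
proof (induction n)
  case (Suc n)
  let ?F = "\<lambda>k. (dop c g ^^ k) a" and ?H = "\<lambda>k. (dop d g ^^ k) b"
  have "(dop (c + d) g ^^ Suc n) (a * b)
      = (\<Sum>k\<le>n. of_nat (n choose k) * (?F (Suc k) * ?H (n - k) + ?F k * ?H (Suc (n - k))))"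
    by (simp add: Suc dop_sum dop_of_nat_mult dop_mult)
  also have "\<dots> = (\<Sum>k\<le>n. of_nat (n choose k) * (?F (Suc k) * ?H (n - k)))
      + (\<Sum>k\<le>n. of_nat (n choose k) * (?F k * ?H (Suc n - k)))"
    by (simp add: distrib_left sum.distrib Suc_diff_le del: funpow.simps)
  also have "(\<Sum>k\<le>n. of_nat (n choose k) * (?F k * ?H (Suc n - k)))
      = ?F 0 * ?H (Suc n) + (\<Sum>k\<le>n. of_nat (n choose Suc k) * (?F (Suc k) * ?H (n - k)))"
  proof -
    have "(\<Sum>k\<le>n. of_nat (n choose k) * (?F k * ?H (Suc n - k)))
      = (\<Sum>k\<le>Suc n. of_nat (n choose k) * (?F k * ?H (Suc n - k)))" by (simp add: binomial_eq_0)
    also have "\<dots> = ?F 0 * ?H (Suc n) + (\<Sum>k\<le>n. of_nat (n choose Suc k) * (?F (Suc k) * ?H (n - k)))"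
      by (subst sum.atMost_Suc_shift) (simp del: funpow.simps(2))
    finally show ?thesis .
  qed
  also have "(\<Sum>k\<le>n. of_nat (n choose k) * (?F (Suc k) * ?H (n - k)))
      + (?F 0 * ?H (Suc n) + (\<Sum>k\<le>n. of_nat (n choose Suc k) * (?F (Suc k) * ?H (n - k))))
      = ?F 0 * ?H (Suc n) + (\<Sum>k\<le>n. of_nat (Suc n choose Suc k) * (?F (Suc k) * ?H (n - k)))"
    by (simp add: sum.distrib algebra_simps del: funpow.simps(2))
  also have "\<dots> = (\<Sum>k\<le>Suc n. of_nat (Suc n choose k) * (?F k * ?H (Suc n - k)))"
    by (subst sum.atMost_Suc_shift) (simp del: funpow.simps(2) binomial_Suc_Suc)
  finally show ?case .
qed simp

text \<open>The value at x of the p-th power of the derivation g \<partial>. In characteristic p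
  that power is again a derivation, so this is its coefficient.\<close>

definition pth_power_field :: "nat \<Rightarrow> 'a::field poly \<Rightarrow> 'a poly" where
  "pth_power_field p g = (dop 0 g ^^ p) [:0, 1:]"

text \<open>The exterior derivative intertwines degrees 0 and 1, and 1 is the derivative of the
  coordinate.\<close>

lemma dop_1_funpow_1: "(dop 1 g ^^ Suc n) 1 = pderiv ((dop 0 g ^^ Suc n) [:0, 1:])"
proof (induction n)
  case 0
  show ?case by (simp add: dop_def pderiv_pCons)
next
  case (Suc n)
  have "dop 1 g (pderiv q) = pderiv (dop 0 g q)" for q
    by (simp add: dop_def pderiv_mult algebra_simps)
  then show ?case using Suc by simp
qed

context
  fixes p :: nat and ty :: "'a::field itself"
  assumes char_p: "CHAR('a) = p" and prime_p: "prime p"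
begin

text \<open>All inner binomial coefficients are divisible by p.\<close>

lemma dop_funpow_p_mult:
  fixes g :: "'a poly"
  shows "(dop (c + d) g ^^ p) (a * b) = (dop c g ^^ p) a * b + a * (dop d g ^^ p) b"
proof -
  have p: "p > 0" using prime_p by (rule prime_gt_0_nat)
  have z: "(of_nat (p choose k) :: 'a poly) = 0" if "0 < k" "k < p" for k
  proof -
    have "p dvd (p choose k)" using that prime_p by (intro dvd_choose_prime) auto
    then have "(of_nat (p choose k) :: 'a) = 0"
      using of_nat_eq_0_iff_char_dvd[where 'a='a] char_p by simp
    then show ?thesis by (simp add: of_nat_poly)
  qed
  have "(dop (c + d) g ^^ p) (a * b) = (\<Sum>k\<le>p. of_nat (p choose k) * ((dop c g ^^ k) a * (dop d g ^^ (p - k)) b))"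
    by (rule dop_funpow_mult)
  also have "\<dots> = (\<Sum>k\<in>{0, p}. of_nat (p choose k) * ((dop c g ^^ k) a * (dop d g ^^ (p - k)) b))"
    by (rule sum.mono_neutral_right) (auto simp: z)
  also have "\<dots> = (dop c g ^^ p) a * b + a * (dop d g ^^ p) b" using p by simp
  finally show ?thesis .
qed

text \<open>The p-th power obeys the Leibniz rule and kills constants, so it is determined by its
  value at x; the induction peels off one factor x at a time.\<close>

lemma dop_0_funpow_p:
  fixes g :: "'a poly"
  shows "(dop 0 g ^^ p) q = pth_power_field p g * pderiv q"
proof (induction q)
  case 0
  have "(dop 0 g ^^ n) 0 = 0" for n by (induction n) (auto simp: dop_def)
  then show ?case by simp
next
  case (pCons a q)
  have p: "p > 0" using prime_p by (rule prime_gt_0_nat)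
  have zero: "(dop 0 g ^^ n) 0 = 0" for n by (induction n) (auto simp: dop_def)
  have add: "(dop 0 g ^^ n) (u + v) = (dop 0 g ^^ n) u + (dop 0 g ^^ n) v" for n u v
    by (induction n) (auto simp: dop_add)
  have const: "(dop 0 g ^^ p) [:a:] = 0"
    using p zero by (cases p) (auto simp: funpow_swap1 dop_def pderiv_pCons simp del: funpow.simps simp: funpow_Suc_right)
  have "pCons a q = [:a:] + [:0, 1:] * q" by simp
  then have "(dop 0 g ^^ p) (pCons a q) = (dop (0 + 0) g ^^ p) ([:0, 1:] * q)"
    using const by (simp only: add) simp
  also have "\<dots> = pth_power_field p g * q + [:0, 1:] * (dop 0 g ^^ p) q"
    by (subst dop_funpow_p_mult) (simp add: pth_power_field_def)
  also have "\<dots> = pth_power_field p g * pderiv (pCons a q)"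
    by (simp add: pCons.IH pderiv_pCons algebra_simps)
  finally show ?case .
qed

text \<open>Densities of degree \<open>c\<close> are \<open>c\<close>-fold tensor powers of differential forms, and the Leibniz rule
  for \<open>p\<close>-th powers is additive, so the identity reduces to degrees \<open>0\<close> and \<open>1\<close>.\<close>
lemma dop_funpow_p:
  fixes g :: "'a poly"
  shows "(dop c g ^^ p) q = dop c (pth_power_field p g) q"
proof (induction c)
  case 0
  show ?case by (simp add: dop_0_funpow_p) (simp add: dop_def)
next
  case (Suc c)
  obtain m where m: "p = Suc m" using prime_gt_0_nat[OF prime_p] by (cases p) auto
  have "(dop (c + 1) g ^^ p) (q * 1) = (dop c g ^^ p) q * 1 + q * (dop 1 g ^^ p) 1"
    by (rule dop_funpow_p_mult)
  moreover have "(dop 1 g ^^ p) 1 = pderiv (pth_power_field p g)"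
    unfolding m dop_1_funpow_1 pth_power_field_def ..
  ultimately have "(dop (Suc c) g ^^ p) q = dop c (pth_power_field p g) q + q * pderiv (pth_power_field p g)"
    using Suc by simp
  also have "\<dots> = dop (Suc c) (pth_power_field p g) q" by (simp add: dop_def algebra_simps)
  finally show ?case .
qed

text \<open>Nothing is assumed about coefficients of \<open>q\<close> from x^p on. That of x^p could
  reach degree p-1 by differentiation, but it arrives with the factor p = 0.\<close>

lemma W1_apply_coeff:
  fixes c f :: "nat \<Rightarrow> 'a"
  assumes c: "\<And>k. k < p \<Longrightarrow> coeff g k = c k" and f: "\<And>k. k < p \<Longrightarrow> coeff q k = f k" and j: "j < p"
  shows "W1_apply p c f j = coeff (dop 0 g q) j"
proof -
  have z: "(of_nat p :: 'a) = 0" using char_p of_nat_CHAR by metis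
  have "coeff (dop 0 g q) j = (\<Sum>k\<le>j. coeff g k * (of_nat (Suc (j - k)) * coeff q (Suc (j - k))))"
    by (simp add: dop_def coeff_mult coeff_pderiv)
  also have "\<dots> = (\<Sum>k\<le>j. if j - k + 1 < p then c k * of_nat (j - k + 1) * f (j - k + 1) else 0)"
  proof (rule sum.cong)
    fix k assume "k \<in> {..j}"
    then have k: "k < p" using j by auto
    show "coeff g k * (of_nat (Suc (j - k)) * coeff q (Suc (j - k)))
      = (if j - k + 1 < p then c k * of_nat (j - k + 1) * f (j - k + 1) else 0)"
    proof (cases "j - k + 1 < p")
      case True
      then show ?thesis using c[OF k] f[of "Suc (j - k)"] by simp
    next
      case False
      then have "Suc (j - k) = p" using j by auto
      then have "(of_nat (Suc (j - k)) :: 'a) = 0" using z by (simp only:)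
      then show ?thesis using False by (simp del: of_nat_Suc)
    qed
  qed simp
  also have "\<dots> = (\<Sum>k<p. if k \<le> j \<and> j - k + 1 < p then c k * of_nat (j - k + 1) * f (j - k + 1) else 0)"
    using j by (intro sum.mono_neutral_cong_left) auto
  finally show ?thesis using j by (simp add: W1_apply_def)
qed

lemma W1_pmap_coeff:
  fixes c :: "nat \<Rightarrow> 'a"
  assumes c: "\<And>k. k < p \<Longrightarrow> coeff g k = c k" and j: "j < p"
  shows "W1_pmap p c j = coeff (pth_power_field p g) j"
proof -
  have "(W1_apply p c ^^ n) (\<lambda>j. if j = 1 then 1 else 0) j = coeff ((dop 0 g ^^ n) [:0, 1:]) j" if "j < p" for n j
    using that
  proof (induction n arbitrary: j)
    case 0
    show ?case by (cases j) (auto simp: coeff_pCons split: nat.splits)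
  next
    case (Suc n)
    then show ?case using W1_apply_coeff[OF c, of "(dop 0 g ^^ n) [:0, 1:]"] by simp
  qed
  then show ?thesis using j by (simp add: W1_pmap_def pth_power_field_def)
qed

end

section \<open>Words, submodules and composition series\<close>

lemma actK_add: "actK p r a (x + y) = actK p r a x + actK p r a y"
  by (simp add: actK_def bracket_add_right)

lemma actK_sc: "actK p r a (scD c x) = scD c (actK p r a x)"
  by (simp add: actK_def bracket_sc_right)

lemma actK_zero [simp]: "actK p r a 0 = 0"
  using actK_sc[of p r a 0 0] by simp

lemma actK_diff: "actK p r a (x - y) = actK p r a x - actK p r a y"
  using actK_add[of p r a "x - y" y] by simp

lemma actK_sum: "actK p r a (\<Sum>x\<in>A. f x) = (\<Sum>x\<in>A. actK p r a (f x))"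
  by (rule additive_sum[where h = "actK p r a"]) (rule actK_add)

lemma is_submod_iff:
  "is_submod p r N \<longleftrightarrow> N \<subseteq> Kalg p r \<and> ds.subspace N \<and> (\<forall>a<p. \<forall>x\<in>N. actK p r a x \<in> N)"
  unfolding is_submod_def ds.subspace_def by blast

lemma is_submod_subspace: "is_submod p r N \<Longrightarrow> ds.subspace N"
  by (simp add: is_submod_iff)

lemma is_submod_actK: "is_submod p r N \<Longrightarrow> a < p \<Longrightarrow> x \<in> N \<Longrightarrow> actK p r a x \<in> N"
  by (simp add: is_submod_iff)

lemma is_submod_0: "is_submod p r {0}"
  unfolding is_submod_iff using ds.subspace_0[OF ds.subspace_span]
  by (auto simp: Kalg_def fspanD_eq_span ds.subspace_def)

lemma is_submod_Int: "is_submod p r A \<Longrightarrow> is_submod p r B \<Longrightarrow> is_submod p r (A \<inter> B)"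
  unfolding is_submod_iff by (auto intro: ds.subspace_inter)

section \<open>Sums of submodules and the second isomorphism theorem\<close>

definition msum :: "'b::ab_group_add set \<Rightarrow> 'b set \<Rightarrow> 'b set" where
  "msum A B = {x + y | x y. x \<in> A \<and> y \<in> B}"

lemma msumI: "x \<in> A \<Longrightarrow> y \<in> B \<Longrightarrow> x + y \<in> msum A B"
  by (auto simp: msum_def)

lemma msumE: "x \<in> msum A B \<Longrightarrow> (\<And>a b. a \<in> A \<Longrightarrow> b \<in> B \<Longrightarrow> x = a + b \<Longrightarrow> P) \<Longrightarrow> P"
  by (auto simp: msum_def)

lemma msum_commute: "msum A B = msum B A"
  by (auto simp: msum_def add.commute) (metis add.commute)+

lemma msum_upper: "0 \<in> B \<Longrightarrow> A \<subseteq> msum A B" "0 \<in> A \<Longrightarrow> B \<subseteq> msum A B"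
  using msumI by (metis add.right_neutral subsetI, metis add_0 subsetI msumI)

lemma is_submod_msum:
  assumes A: "is_submod p r A" and B: "is_submod p r B"
  shows "is_submod p r (msum A B)"
proof -
  have s: "msum A B = {x + y | x y. x \<in> A \<and> y \<in> B}" by (simp add: msum_def)
  have K: "ds.subspace (Kalg p r)" unfolding Kalg_def fspanD_eq_span by (rule ds.subspace_span)
  have "ds.subspace (msum A B)"
    unfolding s by (rule ds.subspace_sums[OF is_submod_subspace[OF A] is_submod_subspace[OF B]])
  moreover have "msum A B \<subseteq> Kalg p r"
    using A B ds.subspace_add[OF K] by (auto simp: is_submod_iff elim!: msumE)
  moreover have "actK p r a x \<in> msum A B" if "a < p" "x \<in> msum A B" for a x
    using that(2)
    by (rule msumE) (auto simp: actK_add intro!: msumI is_submod_actK[OF A that(1)] is_submod_actK[OF B that(1)])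
  ultimately show ?thesis by (simp add: is_submod_iff)
qed

lemma msum_least: "ds.subspace C \<Longrightarrow> A \<subseteq> C \<Longrightarrow> B \<subseteq> C \<Longrightarrow> msum A B \<subseteq> C"
  by (auto elim!: msumE intro: ds.subspace_add)

text \<open>The correspondence behind (A + B)/B \<cong> A/(A \<inter> B): a submodule C between B
  and A + B is determined by C \<inter> A, because the A-part of an element of C differs from it by
  an element of B.\<close>

lemma simple_subq_up:
  assumes A: "is_submod p r A" and B: "is_submod p r B" and s: "simple_subq p r A (A \<inter> B)"
  shows "simple_subq p r (msum A B) B"
  unfolding simple_subq_def
proof (intro conjI allI impI)
  have A0: "0 \<in> A" and B0: "0 \<in> B" using A B by (auto simp: is_submod_def)
  show "is_submod p r (msum A B)" using A B by (rule is_submod_msum)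
  show "is_submod p r B" by fact
  obtain a where "a \<in> A" "a \<notin> B" using s by (auto simp: simple_subq_def)
  then show "B \<subset> msum A B" using msum_upper(1)[OF B0, of A] msum_upper(2)[OF A0, of B] by blast
  fix C assume C: "is_submod p r C \<and> B \<subseteq> C \<and> C \<subseteq> msum A B"
  then have sC: "ds.subspace C" using is_submod_subspace by blast
  have "is_submod p r (C \<inter> A)" using C A by (intro is_submod_Int) auto
  then have "C \<inter> A = A \<inter> B \<or> C \<inter> A = A" using s C unfolding simple_subq_def by blast
  then show "C = B \<or> C = msum A B"
  proof
    assume e: "C \<inter> A = A \<inter> B"
    have "x \<in> B" if x: "x \<in> C" for x
    proof -
      from x C have "x \<in> msum A B" by blast
      then obtain a b where ab: "a \<in> A" "b \<in> B" "x = a + b" by (rule msumE)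
      then have "a = x - b" by simp
      then have "a \<in> C" using ds.subspace_diff[OF sC x, of b] ab C by auto
      with ab e have "a \<in> B" by blast
      with ab show ?thesis using ds.subspace_add[OF is_submod_subspace[OF B]] by simp
    qed
    with C show ?thesis by blast
  next
    assume "C \<inter> A = A"
    then have "msum A B \<subseteq> C" using C by (intro msum_least[OF sC]) auto
    with C show ?thesis by blast
  qed
qed

text \<open>The inverse correspondence sends C to C + B, and C is recovered inside A since a - c
  lies in A \<inter> B whenever it lies in B.\<close>

lemma simple_subq_down:
  assumes A: "is_submod p r A" and B: "is_submod p r B" and s: "simple_subq p r (msum A B) B"
  shows "simple_subq p r A (A \<inter> B)"
  unfolding simple_subq_def
proof (intro conjI allI impI)
  show "is_submod p r A" "is_submod p r (A \<inter> B)" using A B by (auto intro: is_submod_Int)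
  have "\<not> A \<subseteq> B"
  proof
    assume "A \<subseteq> B"
    then have "msum A B \<subseteq> B" by (intro msum_least is_submod_subspace[OF B]) auto
    with s show False by (auto simp: simple_subq_def)
  qed
  then show "A \<inter> B \<subset> A" by blast
  fix C assume C: "is_submod p r C \<and> A \<inter> B \<subseteq> C \<and> C \<subseteq> A"
  have C0: "0 \<in> C" and B0: "0 \<in> B" using C B by (auto simp: is_submod_def)
  have "is_submod p r (msum C B)" using C B by (intro is_submod_msum) auto
  moreover have "B \<subseteq> msum C B" by (rule msum_upper(2)[OF C0])
  moreover have "msum C B \<subseteq> msum A B" using C by (auto simp: msum_def)
  ultimately have "msum C B = B \<or> msum C B = msum A B" using s unfolding simple_subq_def by blast
  then show "C = A \<inter> B \<or> C = A"
  proof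
    assume "msum C B = B"
    then have "C \<subseteq> B" using msum_upper(1)[OF B0, of C] by blast
    with C show ?thesis by blast
  next
    assume e: "msum C B = msum A B"
    have "a \<in> C" if a: "a \<in> A" for a
    proof -
      have "a \<in> msum C B" using a msum_upper(1)[OF B0, of A] e by blast
      then obtain c b where cb: "c \<in> C" "b \<in> B" "a = c + b" by (rule msumE)
      then have "b = a - c" by simp
      then have "b \<in> A" using ds.subspace_diff[OF is_submod_subspace[OF A]] a cb C by blast
      with cb C show ?thesis using ds.subspace_add[OF is_submod_subspace] by blast
    qed
    with C show ?thesis by blast
  qed
qed

section \<open>Finite combinations of words and homomorphisms from induced modules\<close>

lemma subspace_fin_comb: "fs.subspace (fin_comb p)"
  unfolding fs.subspace_def
proof (intro conjI ballI allI)
  show "0 \<in> fin_comb p" by (simp add: fin_comb_def)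
  show "x + y \<in> fin_comb p" if "x \<in> fin_comb p" "y \<in> fin_comb p" for x y :: "'a words"
  proof -
    have "{w. (x + y) w \<noteq> 0} \<subseteq> {w. x w \<noteq> 0} \<union> {w. y w \<noteq> 0}" by auto
    then show ?thesis using that unfolding fin_comb_def
      by (auto intro: finite_subset)
  qed
  show "sc c x \<in> fin_comb p" if "x \<in> fin_comb p" for c and x :: "'a words"
    using that by (auto simp: fin_comb_def sc_def)
qed

lemmas fin_comb_add = fs.subspace_add[OF subspace_fin_comb]
  and fin_comb_diff = fs.subspace_diff[OF subspace_fin_comb]
  and fin_comb_scale = fs.subspace_scale[OF subspace_fin_comb]
  and fin_comb_sum = fs.subspace_sum[OF subspace_fin_comb]
  and fin_comb_0 = fs.subspace_0[OF subspace_fin_comb]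

lemma wd_fin_comb: "valid_word p w \<Longrightarrow> wd w \<in> fin_comb p"
  by (auto simp: fin_comb_def wd_def)

lemma valid_word_append [simp]: "valid_word p (u @ v) \<longleftrightarrow> valid_word p u \<and> valid_word p v"
  by (auto simp: valid_word_def)

lemma valid_word_Cons [simp]: "valid_word p (a # v) \<longleftrightarrow> a < p \<and> valid_word p v"
  by (auto simp: valid_word_def)

lemma valid_word_Nil [simp]: "valid_word p []"
  by (auto simp: valid_word_def)

lemma Rel_fin_comb: "Rel p lam \<subseteq> (fin_comb p :: 'a::field words set)"
proof -
  note sub = subspace_fin_comb[of p, where ?'a = 'a]
  have 1: "(if a + b - 1 < p then sc k (wd (u @ [a + b - 1] @ v)) else 0) \<in> fin_comb p"
    if "valid_word p u" "valid_word p v" for a b u v and k :: 'a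
    using that fs.subspace_0[OF sub] by (auto intro!: fs.subspace_scale[OF sub] wd_fin_comb)
  show ?thesis
    unfolding Rel_def
    by (intro Un_least subsetI; elim CollectE exE conjE; hypsubst;
        intro fs.subspace_diff[OF sub] 1 fs.subspace_sum[OF sub] fs.subspace_scale[OF sub] wd_fin_comb; simp)
qed

text \<open>\<open>ext\<close> sums over the support, which varies with the combination; linearity
  is proved on a common finite superset.\<close>

lemma ext_superset:
  assumes "finite F" "{w. \<rho> w \<noteq> 0} \<subseteq> F"
  shows "ext \<psi> \<rho> = (\<Sum>w\<in>F. scD (\<rho> w) (\<psi> w))"
  unfolding ext_def by (rule sum.mono_neutral_left) (use assms in auto)

lemma ext_add:
  assumes "\<rho> \<in> fin_comb p" "\<tau> \<in> fin_comb p"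
  shows "ext \<psi> (\<rho> + \<tau>) = ext \<psi> \<rho> + ext \<psi> \<tau>"
proof -
  let ?F = "{w. \<rho> w \<noteq> 0} \<union> {w. \<tau> w \<noteq> 0}"
  have F: "finite ?F" using assms by (simp add: fin_comb_def)
  have "ext \<psi> (\<rho> + \<tau>) = (\<Sum>w\<in>?F. scD ((\<rho> + \<tau>) w) (\<psi> w))" by (rule ext_superset[OF F]) auto
  also have "\<dots> = ext \<psi> \<rho> + ext \<psi> \<tau>"
    unfolding ext_superset[OF F Un_upper1] ext_superset[OF F Un_upper2]
    by (simp add: ds.scale_left_distrib sum.distrib)
  finally show ?thesis .
qed

lemma ext_sc:
  assumes "\<rho> \<in> fin_comb p"
  shows "ext \<psi> (sc c \<rho>) = scD c (ext \<psi> \<rho>)"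
proof -
  have F: "finite {w. \<rho> w \<noteq> 0}" using assms by (simp add: fin_comb_def)
  have "ext \<psi> (sc c \<rho>) = (\<Sum>w\<in>{w. \<rho> w \<noteq> 0}. scD (sc c \<rho> w) (\<psi> w))"
    by (rule ext_superset[OF F]) (auto simp: sc_apply)
  then show ?thesis by (simp add: ext_def sc_apply ds.scale_sum_right)
qed

lemma ext_diff:
  assumes "\<rho> \<in> fin_comb p" "\<tau> \<in> fin_comb p"
  shows "ext \<psi> (\<rho> - \<tau>) = ext \<psi> \<rho> - ext \<psi> \<tau>"
  using ext_add[OF fin_comb_diff[OF assms] assms(2), of \<psi>] by simp

lemma ext_zero [simp]: "ext \<psi> 0 = 0"
  by (simp add: ext_def)

lemma ext_wd [simp]: "ext \<psi> (wd w) = \<psi> w"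
  by (simp add: ext_def wd_def)

lemma ext_sum:
  assumes "\<And>x. x \<in> A \<Longrightarrow> f x \<in> fin_comb p"
  shows "ext \<psi> (\<Sum>x\<in>A. f x) = (\<Sum>x\<in>A. ext \<psi> (f x))"
  using assms
proof (induction A rule: infinite_finite_induct)
  case (insert x A)
  then have "ext \<psi> (f x + sum f A) = ext \<psi> (f x) + ext \<psi> (sum f A)"
    by (intro ext_add[of _ p] fin_comb_sum) auto
  moreover have "ext \<psi> (sum f A) = (\<Sum>x\<in>A. ext \<psi> (f x))" using insert by blast
  ultimately show ?case unfolding sum.insert[OF insert(1,2)] by (rule trans[OF _ arg_cong])
qed auto

lemma ext_in:
  assumes "ds.subspace A" "\<rho> \<in> fin_comb p" "\<And>w. valid_word p w \<Longrightarrow> \<psi> w \<in> A"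
  shows "ext \<psi> \<rho> \<in> A"
  unfolding ext_def using assms
  by (intro ds.subspace_sum ds.subspace_scale) (auto simp: fin_comb_def)

lemma ext_diff_fun: "ext (\<lambda>w. \<psi> w - \<phi> w) \<rho> = ext \<psi> \<rho> - ext \<phi> \<rho>"
  by (simp add: ext_def ds.scale_right_diff_distrib sum_subtractf)

lemma quot_hom_up:
  assumes A: "is_submod p r A" and B: "is_submod p r B" and q: "quot_hom p r lam A (A \<inter> B) \<psi>"
  shows "quot_hom p r lam (msum A B) B \<psi>"
proof -
  have B0: "0 \<in> B" using B by (auto simp: is_submod_def)
  have "\<exists>\<rho>\<in>fin_comb p. x - ext \<psi> \<rho> \<in> B" if "x \<in> msum A B" for x
  proof -
    from that obtain a b where ab: "a \<in> A" "b \<in> B" "x = a + b" by (rule msumE)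
    then obtain \<rho> where "\<rho> \<in> fin_comb p" "a - ext \<psi> \<rho> \<in> B" using q unfolding quot_hom_def by blast
    moreover have "x - ext \<psi> \<rho> = b + (a - ext \<psi> \<rho>)" using ab by simp
    ultimately show ?thesis using ab ds.subspace_add[OF is_submod_subspace[OF B]] by metis
  qed
  then show ?thesis using q msum_upper(1)[OF B0, of A] unfolding quot_hom_def by blast
qed

text \<open>Each \<open>\<psi> w\<close> is replaced by a representative in A, chosen word by word.
  The choices are independent of each other, which is harmless because \<open>quot_hom\<close> asks
  for compatibility only modulo the submodule.\<close>

lemma quot_hom_down:
  assumes A: "is_submod p r A" and B: "is_submod p r B" and q: "quot_hom p r lam (msum A B) B \<psi>"
  shows "\<exists>\<phi>. quot_hom p r lam A (A \<inter> B) \<phi>"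
proof -
  note sA = is_submod_subspace[OF A] and sB = is_submod_subspace[OF B]
  have "\<exists>y. y \<in> A \<and> \<psi> w - y \<in> B" if "valid_word p w" for w
  proof -
    have "\<psi> w \<in> msum A B" using q that unfolding quot_hom_def by blast
    then obtain a b where "a \<in> A" "b \<in> B" "\<psi> w = a + b" by (rule msumE)
    then show ?thesis by (intro exI[of _ a]) simp
  qed
  then obtain \<phi> where \<phi>: "\<And>w. valid_word p w \<Longrightarrow> \<phi> w \<in> A" "\<And>w. valid_word p w \<Longrightarrow> \<psi> w - \<phi> w \<in> B"
    by metis
  have e: "ext \<psi> \<rho> - ext \<phi> \<rho> \<in> B" if "\<rho> \<in> fin_comb p" for \<rho>
    unfolding ext_diff_fun[symmetric] by (rule ext_in[OF sB that]) (rule \<phi>)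
  have "quot_hom p r lam A (A \<inter> B) \<phi>"
    unfolding quot_hom_def
  proof (intro conjI allI impI ballI IntI)
    show "\<phi> w \<in> A" if "valid_word p w" for w using \<phi>(1)[OF that] .
    fix w a assume wa: "valid_word p w \<and> a < p"
    then have w: "valid_word p w" "valid_word p (a # w)" and a: "a < p" by auto
    show "actK p r a (\<phi> w) - \<phi> (a # w) \<in> A"
      by (intro ds.subspace_diff[OF sA] is_submod_actK[OF A a] \<phi>(1) w)
    have 1: "actK p r a (\<psi> w) - \<psi> (a # w) \<in> B" using q w a unfolding quot_hom_def by blast
    have 2: "actK p r a (\<psi> w - \<phi> w) \<in> B" using \<phi>(2)[OF w(1)] by (rule is_submod_actK[OF B a])
    have "(actK p r a (\<psi> w) - \<psi> (a # w)) + (\<psi> (a # w) - \<phi> (a # w)) - actK p r a (\<psi> w - \<phi> w) \<in> B"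
      by (intro ds.subspace_diff[OF sB] ds.subspace_add[OF sB] 1 2 \<phi>(2) w)
    then show "actK p r a (\<phi> w) - \<phi> (a # w) \<in> B" by (simp add: actK_diff)
  next
    fix \<rho> :: "'a words" assume \<rho>: "\<rho> \<in> Rel p lam"
    then have f: "\<rho> \<in> fin_comb p" using Rel_fin_comb by blast
    show "ext \<phi> \<rho> \<in> A" by (rule ext_in[OF sA f]) (rule \<phi>)
    have "ext \<psi> \<rho> \<in> B" using q \<rho> unfolding quot_hom_def by blast
    then have "ext \<psi> \<rho> - (ext \<psi> \<rho> - ext \<phi> \<rho>) \<in> B" by (intro ds.subspace_diff[OF sB] e[OF f])
    then show "ext \<phi> \<rho> \<in> B" by simp
  next
    fix x assume x: "x \<in> A"
    have "0 \<in> B" using ds.subspace_0[OF sB] .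
    then have "x \<in> msum A B" using x msum_upper(1) by blast
    then obtain \<rho> where \<rho>: "\<rho> \<in> fin_comb p" "x - ext \<psi> \<rho> \<in> B" using q unfolding quot_hom_def by blast
    have "(x - ext \<psi> \<rho>) + (ext \<psi> \<rho> - ext \<phi> \<rho>) \<in> B" by (intro ds.subspace_add[OF sB] \<rho> e)
    moreover have "x - ext \<phi> \<rho> \<in> A"
      by (intro ds.subspace_diff[OF sA] x ext_in[OF sA \<rho>(1)]) (rule \<phi>)
    ultimately have "x - ext \<phi> \<rho> \<in> A \<inter> B" by simp
    then show "\<exists>\<rho>\<in>fin_comb p. x - ext \<phi> \<rho> \<in> A \<inter> B" using \<rho>(1) by blast
  qed
  then show ?thesis by blast
qed

section \<open>The Jordan-Hoelder theorem with labels\<close>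

lemma subq_iso_L_up:
  assumes "is_submod p r A" "is_submod p r B" "subq_iso_L p r lam A (A \<inter> B)"
  shows "subq_iso_L p r lam (msum A B) B"
  using assms simple_subq_up quot_hom_up unfolding subq_iso_L_def by blast

lemma subq_iso_L_down:
  assumes "is_submod p r A" "is_submod p r B" "subq_iso_L p r lam (msum A B) B"
  shows "subq_iso_L p r lam A (A \<inter> B)"
  using assms simple_subq_down quot_hom_down unfolding subq_iso_L_def by blast

text \<open>Only the top module and the multiset of labels are recorded, since these are what the
  exchange argument compares; labels travel along second isomorphisms.\<close>

inductive labelled_series :: "nat \<Rightarrow> nat \<Rightarrow> 'a::field der set \<Rightarrow> nat multiset \<Rightarrow> bool" for p r where
  zero: "labelled_series p r {0} {#}"
| step: "labelled_series p r A L \<Longrightarrow> lam < p \<Longrightarrow> subq_iso_L p r lam X A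
    \<Longrightarrow> labelled_series p r X (add_mset lam L)"

lemma labelled_series_submod: "labelled_series p r X L \<Longrightarrow> is_submod p r X"
  by (induction rule: labelled_series.induct)
    (auto simp: is_submod_0 subq_iso_L_def simple_subq_def)

lemma labelled_series_0:
  assumes "labelled_series p r {0} L"
  shows "L = {#}"
  using assms
proof cases
  case (step A L' lam)
  then have "A \<subset> {0}" "0 \<in> A" by (auto simp: subq_iso_L_def simple_subq_def is_submod_def)
  then show ?thesis by blast
qed simp

text \<open>The exchange step of the Jordan-Hoelder theorem: if \<open>A \<noteq> B\<close> are maximal in \<open>X\<close>, then
  \<open>X / B \<cong> A / (A \<inter> B)\<close> and \<open>X / A \<cong> B / (A \<inter> B)\<close>.\<close>
lemma labelled_series_maximal:
  assumes "labelled_series p r X L" "simple_subq p r X B"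
  shows "\<exists>lam L'. lam < p \<and> L = add_mset lam L' \<and> subq_iso_L p r lam X B \<and> labelled_series p r B L'"
  using assms
proof (induction arbitrary: B rule: labelled_series.induct)
  case zero
  then have "B \<subset> {0}" "0 \<in> B" by (auto simp: simple_subq_def is_submod_def)
  then show ?case by blast
next
  case (step A L lam X)
  have sub: "is_submod p r A" "is_submod p r X" "is_submod p r B" "A \<subset> X" "B \<subset> X"
    using step by (auto simp: subq_iso_L_def simple_subq_def)
  show ?case
  proof (cases "A = B")
    case True
    then show ?thesis using step by blast
  next
    case False
    have A0: "0 \<in> A" and B0: "0 \<in> B" using sub by (auto simp: is_submod_def)
    \<comment> \<open>A + B lies between each of A, B and X, so maximality of both leaves only A + B
      = X when A and B differ.\<close>
    have "msum A B \<subseteq> X" using sub by (intro msum_least is_submod_subspace) auto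
    moreover have "B \<subseteq> msum A B" "A \<subseteq> msum A B" using A0 B0 msum_upper by blast+
    moreover have "is_submod p r (msum A B)" using sub by (intro is_submod_msum) auto
    ultimately have "msum A B = B \<or> msum A B = X" "msum A B = A \<or> msum A B = X"
      using step.prems step.hyps(3) unfolding simple_subq_def subq_iso_L_def by blast+
    then have X: "msum A B = X" "msum B A = X" using False msum_commute[of A B] by auto
    have "simple_subq p r A (A \<inter> B)"
      using step.prems X sub by (intro simple_subq_down) auto
    from step.IH[OF this] obtain \<mu> L' where \<mu>: "\<mu> < p" "L = add_mset \<mu> L'"
        "subq_iso_L p r \<mu> A (A \<inter> B)" "labelled_series p r (A \<inter> B) L'" by blast
    have "subq_iso_L p r \<mu> X B" using subq_iso_L_up[OF sub(1,3) \<mu>(3)] X by simp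
    moreover have "subq_iso_L p r lam B (B \<inter> A)"
      using step.hyps(3) X sub by (intro subq_iso_L_down) auto
    then have "labelled_series p r B (add_mset lam L')"
      using \<mu>(4) step.hyps(2) by (intro labelled_series.step) (auto simp: Int_commute)
    ultimately show ?thesis using \<mu> by (auto intro!: exI[of _ \<mu>] exI[of _ "add_mset lam L'"])
  qed
qed

text \<open>The series of A is continued by adding A to every term of the series of B. For
  consecutive terms B \<subseteq> X the quotient does not change, because X \<inter> (A + B) = B
  when X meets A trivially.\<close>

lemma labelled_series_direct_sum:
  assumes "labelled_series p r B L'" "labelled_series p r A L" "A \<inter> B = {0}"
  shows "labelled_series p r (msum A B) (L + L')"
  using assms
proof (induction rule: labelled_series.induct)
  case zero
  then show ?case by (simp add: msum_def)
next
  case (step B L' lam X)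
  have sub: "is_submod p r A" "is_submod p r B" "is_submod p r X" "B \<subseteq> X"
    using labelled_series_submod[OF step.prems(1)] step.hyps(3) by (auto simp: subq_iso_L_def simple_subq_def)
  have z: "0 \<in> A" "0 \<in> B" using sub by (auto simp: is_submod_def)
  then have "A \<inter> B = {0}" using sub step.prems by blast
  then have ser: "labelled_series p r (msum A B) (L + L')" using step by blast
  have sAB: "is_submod p r (msum A B)" using sub by (intro is_submod_msum)
  have int: "X \<inter> msum A B = B"
  proof
    show "B \<subseteq> X \<inter> msum A B" using sub msum_upper(2)[OF z(1), of B] by blast
    show "X \<inter> msum A B \<subseteq> B"
    proof
      fix x assume x: "x \<in> X \<inter> msum A B"
      then have "x \<in> msum A B" by blast
      then obtain a b where ab: "a \<in> A" "b \<in> B" "x = a + b" by (rule msumE)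
      then have "a = x - b" by simp
      then have "a \<in> X" using ds.subspace_diff[OF is_submod_subspace[OF sub(3)]] x ab sub by blast
      then have "a = 0" using ab step.prems by blast
      then show "x \<in> B" using ab by simp
    qed
  qed
  have e: "msum X (msum A B) = msum A X"
  proof
    show "msum X (msum A B) \<subseteq> msum A X"
    proof (rule msum_least)
      show "ds.subspace (msum A X)" using sub by (intro is_submod_subspace is_submod_msum)
      show "X \<subseteq> msum A X" by (rule msum_upper(2)[OF z(1)])
      show "msum A B \<subseteq> msum A X" using sub by (auto simp: msum_def)
    qed
    have "A \<subseteq> msum A B" using msum_upper(1)[OF z(2)] .
    then have "msum X A \<subseteq> msum X (msum A B)" by (auto simp: msum_def) blast
    then show "msum A X \<subseteq> msum X (msum A B)" by (simp add: msum_commute)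
  qed
  have "subq_iso_L p r lam (msum X (msum A B)) (msum A B)"
    using step.hyps(3) int sAB sub by (intro subq_iso_L_up) auto
  then show ?case using ser step.hyps(2) unfolding e by (auto intro: labelled_series.step)
qed

lemma labelled_series_list:
  "labelled_series p r X L \<Longrightarrow> \<exists>Ms. Ms \<noteq> [] \<and> hd Ms = {0} \<and> last Ms = X
     \<and> (\<forall>i. Suc i < length Ms \<longrightarrow> simple_subq p r (Ms ! Suc i) (Ms ! i))"
proof (induction rule: labelled_series.induct)
  case zero
  show ?case by (rule exI[of _ "[{0}]"]) (simp add: fun_eq_iff)
next
  case (step A L lam X)
  then obtain Ms where "Ms \<noteq> []" "hd Ms = {0}" "last Ms = A"
      "\<forall>i. Suc i < length Ms \<longrightarrow> simple_subq p r (Ms ! Suc i) (Ms ! i)" by blast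
  moreover have "simple_subq p r X A" using step by (simp add: subq_iso_L_def)
  moreover have "i = length Ms - Suc 0" if "Suc i = length Ms" for i using that by simp
  ultimately show ?case
    by (intro exI[of _ "Ms @ [X]"]) (auto simp: nth_append last_conv_nth less_Suc_eq simp del: zero_fun_apply)
qed

text \<open>Dropping the top term of an arbitrary series removes one label, by
  \<open>labelled_series_maximal\<close>. The induction therefore runs from the end of the list,
  with the module and its labels left free.\<close>

lemma labelled_series_unique:
  assumes "labelled_series p r X L" "Ms \<noteq> []" "hd Ms = {0}" "last Ms = X"
    "\<And>i. Suc i < length Ms \<Longrightarrow> simple_subq p r (Ms ! Suc i) (Ms ! i)"
  shows "\<exists>ls. length ls = length Ms - 1 \<and> mset ls = L
    \<and> (\<forall>i. Suc i < length Ms \<longrightarrow> ls ! i < p \<and> subq_iso_L p r (ls ! i) (Ms ! Suc i) (Ms ! i))"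
  using assms
proof (induction Ms arbitrary: X L rule: rev_induct)
  case (snoc Y Ms)
  show ?case
  proof (cases "Ms = []")
    case True
    with snoc.prems(3,4) have "X = {0}" by (metis append_Nil last.simps list.sel(1))
    then have "L = {#}" using snoc.prems(1) labelled_series_0 by blast
    then show ?thesis using True by (intro exI[of _ "[]"]) simp
  next
    case False
    let ?k = "length Ms - 1"
    have k: "Suc ?k = length Ms" using False by simp
    have Y: "Y = X" using snoc.prems by simp
    have "simple_subq p r X (last Ms)"
      using snoc.prems(5)[of ?k] False k Y by (simp add: nth_append last_conv_nth)
    from labelled_series_maximal[OF snoc.prems(1) this] obtain lam L' where
      l: "lam < p" "L = add_mset lam L'" "subq_iso_L p r lam X (last Ms)" "labelled_series p r (last Ms) L'" by blast
    have "simple_subq p r (Ms ! Suc i) (Ms ! i)" if "Suc i < length Ms" for i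
      using snoc.prems(5)[of i] that by (simp add: nth_append)
    moreover have "hd Ms = {0}" using snoc.prems(3) unfolding hd_append2[OF False] .
    ultimately obtain ls where ls: "length ls = ?k" "mset ls = L'"
      "\<forall>i. Suc i < length Ms \<longrightarrow> ls ! i < p \<and> subq_iso_L p r (ls ! i) (Ms ! Suc i) (Ms ! i)"
      using snoc.IH[OF l(4) False] by blast
    have "(ls @ [lam]) ! i < p \<and> subq_iso_L p r ((ls @ [lam]) ! i) ((Ms @ [Y]) ! Suc i) ((Ms @ [Y]) ! i)"
      if "Suc i < length (Ms @ [Y])" for i
    proof (cases "Suc i < length Ms")
      case True
      then have "i < length ls" using ls(1) by simp
      then show ?thesis using True ls(3) by (simp add: nth_append)
    next
      case F: False
      then have "i = ?k" using that by simp
      then show ?thesis using l ls(1) Y k False by (simp add: nth_append last_conv_nth)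
    qed
    then show ?thesis using ls l k by (intro exI[of _ "ls @ [lam]"]) auto
  qed
qed simp

lemma comp_factors_areI:
  assumes "labelled_series p r (Kalg p r :: 'a::field der set) L"
  shows "comp_factors_are p r L TYPE('a)"
  unfolding comp_factors_are_def
proof (intro conjI allI impI)
  show "\<exists>Ms :: 'a der set list. comp_series p r Ms"
    using labelled_series_list[OF assms] unfolding comp_series_def by blast
  fix Ms :: "'a der set list" assume "comp_series p r Ms"
  then obtain ls where ls: "length ls = length Ms - 1" "mset ls = L"
    "\<forall>i. Suc i < length Ms \<longrightarrow> ls ! i < p \<and> subq_iso_L p r (ls ! i) (Ms ! Suc i) (Ms ! i)"
    using labelled_series_unique[OF assms, of Ms] unfolding comp_series_def by blast
  have "map ((!) ls) [0..<length Ms - 1] = ls" using ls(1) map_nth[of ls] by simp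
  then show "\<exists>lab. (\<forall>i. Suc i < length Ms \<longrightarrow> lab i < p \<and> subq_iso_L p r (lab i) (Ms ! Suc i) (Ms ! i))
      \<and> mset (map lab [0..<length Ms - 1]) = L"
    using ls by (intro exI[of _ "(!) ls"]) auto
qed

section \<open>Reduction of words modulo the relations of the induced module\<close>

text \<open>Left multiplication by the generator e_a of the tensor algebra, on coefficient
  functions.\<close>

definition lmul :: "nat \<Rightarrow> 'a::field words \<Rightarrow> nat list \<Rightarrow> 'a" where
  "lmul a \<rho> = (\<lambda>w. case w of [] \<Rightarrow> 0 | x # w' \<Rightarrow> if x = a then \<rho> w' else 0)"

lemma lmul_add: "lmul a (x + y) = lmul a x + lmul a y"
  by (auto simp: lmul_def fun_eq_iff split: list.splits)

lemma lmul_sc: "lmul a (sc c x) = sc c (lmul a x)"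
  by (auto simp: lmul_def sc_def fun_eq_iff split: list.splits)

lemma lmul_zero [simp]: "lmul a 0 = 0"
  by (auto simp: lmul_def fun_eq_iff split: list.splits)

lemma lmul_diff: "lmul a (x - y) = lmul a x - lmul a y"
  using lmul_add[of a "x - y" y] by simp

lemma lmul_sum: "lmul a (\<Sum>x\<in>A. f x) = (\<Sum>x\<in>A. lmul a (f x))"
  by (rule additive_sum[where h = "lmul a"]) (rule lmul_add)

lemma lmul_wd: "lmul a (wd w) = wd (a # w)"
  by (auto simp: lmul_def wd_def fun_eq_iff split: list.splits)

lemma Rel_commutator:
  "valid_word p u \<Longrightarrow> valid_word p v \<Longrightarrow> a < p \<Longrightarrow> b < p \<Longrightarrow>
   wd (u @ [a, b] @ v) - wd (u @ [b, a] @ v)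
        - (if a + b - 1 < p then sc (of_nat b - of_nat a) (wd (u @ [a + b - 1] @ v)) else 0) \<in> Rel p lam"
  unfolding Rel_def by blast

lemma Rel_restricted:
  "valid_word p u \<Longrightarrow> valid_word p v \<Longrightarrow> \<forall>k\<ge>p. c k = 0 \<Longrightarrow>
   (\<Sum>t\<in>{t. length t = p \<and> valid_word p t}. sc (\<Prod>j<p. c (t ! j)) (wd (u @ t @ v)))
        - (\<Sum>k<p. sc (W1_pmap p c k) (wd (u @ [k] @ v))) \<in> Rel p lam"
  unfolding Rel_def by blast

lemma Rel_highest:
  "valid_word p u \<Longrightarrow> 1 \<le> a \<Longrightarrow> a < p \<Longrightarrow> wd (u @ [a]) - sc (chi lam a) (wd u) \<in> Rel p lam"
  unfolding Rel_def by blast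

lemma Rel_cases:
  assumes "\<rho> \<in> Rel p lam"
  obtains (commutator) u v a b where "valid_word p u" "valid_word p v" "a < p" "b < p"
      "\<rho> = wd (u @ [a, b] @ v) - wd (u @ [b, a] @ v)
        - (if a + b - 1 < p then sc (of_nat b - of_nat a) (wd (u @ [a + b - 1] @ v)) else 0)"
    | (restricted) u v c where "valid_word p u" "valid_word p v" "\<forall>k\<ge>p. c k = 0"
      "\<rho> = (\<Sum>t\<in>{t. length t = p \<and> valid_word p t}. sc (\<Prod>j<p. c (t ! j)) (wd (u @ t @ v)))
        - (\<Sum>k<p. sc (W1_pmap p c k) (wd (u @ [k] @ v)))"
    | (highest) u a where "valid_word p u" "1 \<le> a" "a < p" "\<rho> = wd (u @ [a]) - sc (chi lam a) (wd u)"
  using assms unfolding Rel_def by blast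

text \<open>Every family of relations carries an arbitrary left factor \<open>u\<close>, and
  \<open>u\<close> simply becomes \<open>x # u\<close>.\<close>

lemma lmul_Rel:
  assumes "\<rho> \<in> Rel p lam" "x < p"
  shows "lmul x \<rho> \<in> Rel p lam"
  using assms(1)
proof (cases rule: Rel_cases)
  case (commutator u v a b)
  have "lmul x \<rho> = wd ((x # u) @ [a, b] @ v) - wd ((x # u) @ [b, a] @ v)
        - (if a + b - 1 < p then sc (of_nat b - of_nat a) (wd ((x # u) @ [a + b - 1] @ v)) else 0)"
    unfolding commutator(5) by (simp add: lmul_diff lmul_wd lmul_sc)
  then show ?thesis using Rel_commutator[of p "x # u" v a b lam] commutator assms(2) by simp
next
  case (restricted u v c)
  have "lmul x \<rho> = (\<Sum>t\<in>{t. length t = p \<and> valid_word p t}. sc (\<Prod>j<p. c (t ! j)) (wd ((x # u) @ t @ v)))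
        - (\<Sum>k<p. sc (W1_pmap p c k) (wd ((x # u) @ [k] @ v)))"
    unfolding restricted(4) by (simp add: lmul_diff lmul_wd lmul_sc lmul_sum)
  then show ?thesis using Rel_restricted[of p "x # u" v c lam] restricted assms(2) by simp
next
  case (highest u a)
  have "lmul x \<rho> = wd ((x # u) @ [a]) - sc (chi lam a) (wd (x # u))"
    unfolding highest(4) by (simp add: lmul_diff lmul_wd lmul_sc)
  then show ?thesis using Rel_highest[of p "x # u" a lam] highest assms(2) by simp
qed

text \<open>The field is \<partial>, which sends x to 1 and 1 to 0; since p is at least 2, its p-th
  power kills x.\<close>

lemma W1_pmap_delta_0:
  assumes "p > 1"
  shows "W1_pmap p (\<lambda>k. if k = 0 then 1 else 0 :: 'a::field) k = 0"
proof -
  let ?D = "W1_apply p (\<lambda>k. if k = 0 then 1 else 0 :: 'a)"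
  have one: "?D (\<lambda>j. if j = 1 then 1 else 0) = (\<lambda>j. if j = 0 then 1 else 0)"
  proof
    fix j
    show "?D (\<lambda>j. if j = 1 then 1 else 0) j = (if j = 0 then 1 else 0)"
    proof (cases "j < p")
      case True
      have "?D (\<lambda>j. if j = 1 then 1 else 0) j = (\<Sum>k<p. if k = 0 then (if j = 0 then 1 else 0) else 0)"
        unfolding W1_apply_def if_P[OF True] using assms by (intro sum.cong) auto
      then show ?thesis using assms by simp
    qed (use assms in \<open>auto simp: W1_apply_def\<close>)
  qed
  have const: "?D (\<lambda>j. if j = 0 then 1 else 0) = 0"
    by (auto simp: W1_apply_def fun_eq_iff intro!: sum.neutral)
  have zero: "?D 0 = 0"
    by (auto simp: W1_apply_def fun_eq_iff intro!: sum.neutral)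
  have "(f ^^ m) z = z" if "f z = z" for f :: "(nat \<Rightarrow> 'a) \<Rightarrow> nat \<Rightarrow> 'a" and z m
    using that by (induction m) auto
  from this[of ?D 0] zero have "(?D ^^ m) 0 = 0" for m by blast
  moreover have "(?D ^^ p) (\<lambda>j. if j = 1 then 1 else 0)
      = (?D ^^ (p - 2)) (?D (?D (\<lambda>j. if j = 1 then 1 else 0)))"
  proof -
    have e: "Suc (Suc (p - 2)) = p" using assms by simp
    have "(f ^^ Suc (Suc m)) x = (f ^^ m) (f (f x))" for f :: "(nat \<Rightarrow> 'a) \<Rightarrow> nat \<Rightarrow> 'a" and x m
      by (simp add: funpow_swap1)
    from this[of "p - 2" ?D] show ?thesis unfolding e .
  qed
  ultimately have "(?D ^^ p) (\<lambda>j. if j = 1 then 1 else 0) = 0" by (simp only: one const)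
  then show ?thesis by (simp only: W1_pmap_def zero_fun_apply)
qed

abbreviation normal_gens :: "nat \<Rightarrow> nat \<Rightarrow> 'a::field words set" where
  "normal_gens p lam \<equiv> Rel p lam \<union> (\<lambda>k. wd (replicate k 0)) ` {..<p}"

text \<open>The combinations congruent to some combination of e_0^k with k < p. That all words
  belong here amounts to dim V(\<lambda>) \<le> p.\<close>

definition normal_span :: "nat \<Rightarrow> nat \<Rightarrow> 'a::field words set" where
  "normal_span p lam = fs.span (normal_gens p lam)"

lemma subspace_normal_span: "fs.subspace (normal_span p lam)"
  unfolding normal_span_def by (rule fs.subspace_span)

lemma Rel_normal_span: "\<rho> \<in> Rel p lam \<Longrightarrow> \<rho> \<in> normal_span p lam"
  unfolding normal_span_def by (auto intro: fs.span_base)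

lemma replicate_normal_span:
  assumes "p > 1"
  shows "k \<le> p \<Longrightarrow> wd (replicate k 0) \<in> (normal_span p lam :: 'a::field words set)"
proof (cases "k < p")
  case True
  then show ?thesis unfolding normal_span_def by (auto intro: fs.span_base)
next
  case False
  assume "k \<le> p"
  with False have k: "k = p" by simp
  \<comment> \<open>The restricted relation for \<partial>: the only word with a nonzero coefficient
    is e_0^p, and the p-map of \<partial> is 0, so e_0^p is itself a relation.\<close>
  let ?c = "\<lambda>k. if k = 0 then 1 else 0 :: 'a"
  have "(\<Sum>t\<in>{t. length t = p \<and> valid_word p t}. sc (\<Prod>j<p. ?c (t ! j)) (wd ([] @ t @ [])))
      = (\<Sum>t\<in>{t. length t = p \<and> valid_word p t}. if t = replicate p 0 then wd (replicate p 0) else 0)"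
  proof (rule sum.cong)
    fix t assume t: "t \<in> {t. length t = p \<and> valid_word p t}"
    show "sc (\<Prod>j<p. ?c (t ! j)) (wd ([] @ t @ [])) = (if t = replicate p 0 then wd (replicate p 0) else 0)"
    proof (cases "t = replicate p 0")
      case False
      then obtain j where "j < p" "t ! j \<noteq> 0" using t by (auto simp: list_eq_iff_nth_eq)
      then have "(\<Prod>j<p. ?c (t ! j)) = 0" by (intro prod_zero) auto
      then show ?thesis using False by simp
    qed simp
  qed simp
  also have "\<dots> = wd (replicate p 0)"
  proof -
    have "{t. length t = p \<and> valid_word p t} = {xs. set xs \<subseteq> {..<p} \<and> length xs = p}"
      by (auto simp: valid_word_def)
    then have "finite {t. length t = p \<and> valid_word p t}" using finite_lists_length_eq[of "{..<p}" p] by simp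
    moreover have "valid_word p (replicate p 0)" using assms by (auto simp: valid_word_def)
    ultimately show ?thesis by simp
  qed
  finally have "wd (replicate p 0) \<in> (Rel p lam :: 'a words set)"
    using Rel_restricted[of p "[]" "[]" ?c lam] assms by (simp add: W1_pmap_delta_0)
  then show ?thesis unfolding k by (rule Rel_normal_span)
qed

lemma lmul_span:
  assumes "x \<in> fs.span S" "\<And>y. y \<in> S \<Longrightarrow> lmul a y \<in> fs.span S'"
  shows "lmul a x \<in> fs.span S'"
  using assms(1)
proof (induction rule: fs.span_induct_alt)
  case (step c x y)
  then show ?case
    unfolding lmul_add lmul_sc using fs.span_add[OF fs.span_scale[OF assms(2)]] by blast
next
  case base
  have "lmul a 0 \<in> fs.span S'" unfolding lmul_zero by (rule fs.span_zero)
  then show ?case .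
qed

text \<open>Moving a letter \<open>a > 0\<close> to the right past the zeros with the commutator relations.\<close>
lemma Cons_replicate_normal_span:
  assumes "p > 1"
  shows "a < p \<Longrightarrow> k < p \<Longrightarrow> wd (a # replicate k 0) \<in> (normal_span p lam :: 'a::field words set)"
proof (induction k arbitrary: a)
  case 0
  show ?case
  proof (cases "a = 0")
    case True
    then show ?thesis using replicate_normal_span[OF assms, of 1 lam] assms by simp
  next
    case False
    have "wd ([] @ [a]) - sc (chi lam a) (wd []) \<in> (normal_span p lam :: 'a words set)"
      using Rel_highest[of p "[]" a lam] False 0 by (intro Rel_normal_span) simp
    moreover have "wd [] \<in> (normal_span p lam :: 'a words set)"
      using replicate_normal_span[OF assms, of 0 lam] by simp
    ultimately have "wd ([] @ [a]) - sc (chi lam a) (wd []) + sc (chi lam a) (wd [])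
        \<in> (normal_span p lam :: 'a words set)"
      by (intro fs.subspace_add[OF subspace_normal_span] fs.subspace_scale[OF subspace_normal_span])
    then show ?thesis by simp
  qed
next
  case (Suc k)
  show ?case
  proof (cases "a = 0")
    case True
    have "wd (replicate (Suc (Suc k)) 0) \<in> (normal_span p lam :: 'a words set)"
      using Suc.prems by (intro replicate_normal_span[OF assms]) simp
    then show ?thesis using True by simp
  next
    case False
    let ?N = "normal_span p lam :: 'a words set"
    note sub = subspace_normal_span[of p lam, where ?'a = 'a]
    have k: "k < p" using Suc.prems by simp
    have IH: "wd (b # replicate k 0) \<in> ?N" if "b < p" for b using Suc.IH[OF that k] .
    have a1: "a - 1 < p" using Suc.prems(1) by simp
    have "wd ([] @ [a, 0] @ replicate k 0) - wd ([] @ [0, a] @ replicate k 0)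
        - (if a + 0 - 1 < p then sc (of_nat 0 - of_nat a) (wd ([] @ [a + 0 - 1] @ replicate k 0)) else 0) \<in> ?N"
      using Suc.prems assms by (intro Rel_normal_span Rel_commutator) (auto simp: valid_word_def)
    then have R: "wd (a # 0 # replicate k 0) - wd (0 # a # replicate k 0)
        - sc (of_nat 0 - of_nat a) (wd ((a - 1) # replicate k 0)) \<in> ?N"
      unfolding add_0_right if_P[OF a1] by simp
    have "lmul 0 (wd (a # replicate k 0)) \<in> ?N"
      unfolding normal_span_def
    proof (rule lmul_span)
      show "(wd (a # replicate k 0) :: 'a words) \<in> fs.span (normal_gens p lam)"
        using IH[OF Suc.prems(1)] unfolding normal_span_def .
      fix y :: "'a words" assume "y \<in> normal_gens p lam"
      then show "lmul 0 y \<in> fs.span (normal_gens p lam)"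
      proof
        assume "y \<in> Rel p lam"
        then show ?thesis using lmul_Rel[of y p lam 0] assms by (auto intro: fs.span_base)
      next
        assume "y \<in> (\<lambda>k. wd (replicate k 0)) ` {..<p}"
        then obtain j where j: "j < p" "y = wd (replicate j 0)" by auto
        then have "lmul 0 y = wd (replicate (Suc j) 0)" by (simp add: lmul_wd)
        then show ?thesis using replicate_normal_span[OF assms, of "Suc j" lam] j
          by (simp add: normal_span_def)
      qed
    qed
    then have 1: "wd (0 # a # replicate k 0) \<in> ?N" by (simp add: lmul_wd)
    have "(wd (a # 0 # replicate k 0) - wd (0 # a # replicate k 0)
        - sc (of_nat 0 - of_nat a) (wd ((a - 1) # replicate k 0)))
        + sc (of_nat 0 - of_nat a) (wd ((a - 1) # replicate k 0)) + wd (0 # a # replicate k 0) \<in> ?N"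
      by (intro fs.subspace_add[OF sub] fs.subspace_scale[OF sub] R 1 IH a1)
    then show ?thesis by simp
  qed
qed

text \<open>Left multiplication by a letter maps the normal span into itself, by
  \<open>lmul_Rel\<close> on relations and \<open>Cons_replicate_normal_span\<close> on the powers
  of e_0.\<close>

lemma wd_normal_span:
  assumes "p > 1"
  shows "valid_word p w \<Longrightarrow> wd w \<in> (normal_span p lam :: 'a::field words set)"
proof (induction w)
  case Nil
  show ?case using replicate_normal_span[OF assms, of 0 lam] by simp
next
  case (Cons a w)
  have "lmul a (wd w) \<in> (normal_span p lam :: 'a words set)"
    unfolding normal_span_def
  proof (rule lmul_span)
    show "(wd w :: 'a words) \<in> fs.span (normal_gens p lam)"
      using Cons unfolding normal_span_def by simp
    fix y :: "'a words" assume "y \<in> normal_gens p lam"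
    then show "lmul a y \<in> fs.span (normal_gens p lam)"
    proof
      assume "y \<in> Rel p lam"
      then show ?thesis using lmul_Rel[of y p lam a] Cons.prems by (auto intro: fs.span_base)
    next
      assume "y \<in> (\<lambda>k. wd (replicate k 0)) ` {..<p}"
      then show ?thesis using Cons_replicate_normal_span[OF assms] Cons.prems
        by (auto simp: normal_span_def lmul_wd)
    qed
  qed
  then show ?case by (simp add: lmul_wd)
qed

lemma word_normal_form:
  fixes \<rho> :: "'a::field words"
  assumes "p > 1" "\<rho> \<in> fin_comb p"
  shows "\<exists>\<tau>\<in>fs.span (Rel p lam). \<exists>b. \<rho> = \<tau> + (\<Sum>k<p. sc (b k) (wd (replicate k 0)))"
proof -
  have fin: "finite {w. \<rho> w \<noteq> 0}" using assms by (simp add: fin_comb_def)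
  have "\<rho> = (\<Sum>w\<in>{w. \<rho> w \<noteq> 0}. sc (\<rho> w) (wd w))"
  proof
    fix v
    have "(\<Sum>w\<in>{w. \<rho> w \<noteq> 0}. sc (\<rho> w) (wd w) v) = (\<Sum>w\<in>{w. \<rho> w \<noteq> 0}. if w = v then \<rho> v else 0)"
      by (rule sum.cong) (auto simp: sc_def wd_def)
    then show "\<rho> v = (\<Sum>w\<in>{w. \<rho> w \<noteq> 0}. sc (\<rho> w) (wd w)) v"
      using fin by (simp add: sum_fun_apply)
  qed
  also have "\<dots> \<in> normal_span p lam"
    using assms(2) by (intro fs.subspace_sum[OF subspace_normal_span] fs.subspace_scale[OF subspace_normal_span]
      wd_normal_span[OF assms(1)]) (auto simp: fin_comb_def)
  finally have "\<rho> \<in> normal_span p lam" .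
  then obtain \<tau> y where y: "\<rho> = \<tau> + y" "\<tau> \<in> fs.span (Rel p lam)"
      "y \<in> fs.span ((\<lambda>k. wd (replicate k 0)) ` {..<p})"
    unfolding normal_span_def fs.span_Un by blast
  from y(3) have "\<exists>b. y = (\<Sum>k<p. sc (b k) (wd (replicate k 0)))"
  proof (induction rule: fs.span_induct_alt)
    case base
    show ?case by (rule exI[of _ "\<lambda>_. 0"]) simp
  next
    case (step c x z)
    then obtain b j where b: "z = (\<Sum>k<p. sc (b k) (wd (replicate k 0)))" "j < p" "x = wd (replicate j 0)" by auto
    have "sc c x = (\<Sum>k<p. sc (if k = j then c else 0) (wd (replicate k 0)))"
      using b by (simp add: if_distrib[of "\<lambda>c. sc c _"] cong: if_cong)
    then have "sc c x + z = (\<Sum>k<p. sc ((if k = j then c else 0) + b k) (wd (replicate k 0)))"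
      by (simp only: b(1) sum.distrib[symmetric] fs.scale_left_distrib)
    then show ?case by (intro exI[of _ "\<lambda>k. (if k = j then c else 0) + b k"])
  qed
  with y show ?thesis by blast
qed

section \<open>The submodule of a fixed monomial in the first \<open>2r\<close> variables\<close>

abbreviation word_act :: "nat \<Rightarrow> nat \<Rightarrow> nat list \<Rightarrow> 'a::field der \<Rightarrow> 'a der" where
  "word_act p r \<equiv> foldr (actK p r)"

lemma word_act_add: "word_act p r w (x + y) = word_act p r w x + word_act p r w y"
  by (induction w) (simp_all add: actK_add del: plus_fun_apply)

lemma word_act_sc: "word_act p r w (scD c x) = scD c (word_act p r w x)"
  by (induction w) (auto simp: actK_sc)

lemma word_act_zero [simp]: "word_act p r w 0 = 0"
  using word_act_sc[of p r w 0 0] by simp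

lemma word_act_diff: "word_act p r w (x - y) = word_act p r w x - word_act p r w y"
  using word_act_add[of p r w "x - y" y] by simp

lemma word_act_sum: "word_act p r w (\<Sum>x\<in>A. f x) = (\<Sum>x\<in>A. word_act p r w (f x))"
  by (rule additive_sum[where h = "word_act p r w"]) (rule word_act_add)

text \<open>The degree of the densities is c = lam + 1, so that the weight condition reads
  |\<alpha>| = 2c + 2 in the field; \<open>lam\<close> is the weight (p-1) + c of t^(p-1).\<close>

locale density_string = contact p r n ty
  for p r n :: nat and ty :: "'a::field itself" +
  fixes \<alpha> :: "nat \<Rightarrow> nat" and lam :: nat
  assumes valid: "valid_idx p (2*r) \<alpha>" and lam_less: "lam < p"
    and weight: "(of_nat (\<Sum>j\<in>J. \<alpha> j) :: 'a) = of_nat (2 * lam + 4)"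
begin

definition B :: "nat \<Rightarrow> 'a der" where
  "B m = DK p r (mon (\<alpha>(n := m)))"

lemma valid_string: "valid_idx p n (\<alpha>(n := m)) \<longleftrightarrow> m < p"
proof
  assume "valid_idx p n (\<alpha>(n := m))"
  moreover have "1 \<le> n \<and> n \<le> n" using n_pos by simp
  ultimately have "(\<alpha>(n := m)) n < p" unfolding valid_idx_def by blast
  then show "m < p" by simp
next
  assume "m < p"
  show "valid_idx p n (\<alpha>(n := m))"
    unfolding valid_idx_def
  proof
    fix i
    have "1 \<le> i \<and> i \<le> 2*r \<longrightarrow> \<alpha> i < p" "\<not> (1 \<le> i \<and> i \<le> 2*r) \<longrightarrow> \<alpha> i = 0"
      using valid unfolding valid_idx_def by blast+
    then show "(1 \<le> i \<and> i \<le> n \<longrightarrow> (\<alpha>(n := m)) i < p) \<and> (\<not> (1 \<le> i \<and> i \<le> n) \<longrightarrow> (\<alpha>(n := m)) i = 0)"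
      using \<open>m < p\<close> by (cases "i = n") (auto simp: n_eq)
  qed
qed

lemma B_ge: "p \<le> m \<Longrightarrow> B m = 0"
  using valid_string[of m] by (simp add: B_def mono_invalid)

lemma actK_B:
  assumes "m < p"
  shows "actK p r a (B m) = scD (of_nat (m + a * Suc lam)) (B (m + a - 1))"
proof -
  have "(\<Sum>j\<in>J. (\<alpha>(n := m)) j) = (\<Sum>j\<in>J. \<alpha> j)"
    using n_notin_J by (intro sum.cong) auto
  then have "(of_nat (\<Sum>j\<in>J. (\<alpha>(n := m)) j) :: 'a) = of_nat (2 * Suc lam + 2)"
    using weight by simp
  from actK_DK_mono[OF iffD2[OF valid_string assms] this, of a] show ?thesis
    unfolding B_def fun_upd_same fun_upd_upd .
qed

text \<open>The truncation map, on polynomials of any degree; its kernel consists of the multiples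
  of t^p. Identities for \<open>dop\<close> are carried along it to the W(1)-action.\<close>

definition phi :: "'a poly \<Rightarrow> 'a der" where
  "phi q = (\<Sum>m<p. scD (coeff q m) (B m))"

lemma phi_add: "phi (x + y) = phi x + phi y"
  by (simp add: phi_def ds.scale_left_distrib sum.distrib)

lemma phi_smult: "phi (smult c x) = scD c (phi x)"
  by (simp add: phi_def ds.scale_sum_right)

lemma phi_zero [simp]: "phi 0 = 0"
  by (simp add: phi_def)

lemma phi_diff: "phi (x - y) = phi x - phi y"
  using phi_add[of "x - y" y] by simp

lemma phi_sum: "phi (\<Sum>x\<in>A. f x) = (\<Sum>x\<in>A. phi (f x))"
  by (rule additive_sum[where h = phi]) (rule phi_add)

lemma phi_monom: "phi (monom b k) = scD b (B k)"
proof (cases "k < p")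
  case True
  have "phi (monom b k) = (\<Sum>m<p. if m = k then scD b (B k) else 0)"
    unfolding phi_def by (rule sum.cong) auto
  then show ?thesis using True by simp
next
  case False
  then show ?thesis by (auto simp: phi_def B_ge intro!: sum.neutral)
qed

lemma phi_eq_0_iff: "phi q = 0 \<longleftrightarrow> (\<forall>m<p. coeff q m = 0)"
proof
  assume "phi q = 0"
  then have "DK p r (\<Sum>m<p. sc (coeff q m) (mon (\<alpha>(n := m)))) = 0"
    by (simp add: phi_def B_def DK_sum DK_sc)
  then have z: "(\<Sum>m<p. sc (coeff q m) (mon (\<alpha>(n := m)))) = 0" by (rule DK_inj)
  show "\<forall>m<p. coeff q m = 0"
  proof (intro allI impI)
    fix k assume k: "k < p"
    have "(\<Sum>m<p. sc (coeff q m) (mon (\<alpha>(n := m))) (\<alpha>(n := k))) = (\<Sum>m<p. if m = k then coeff q k else 0)"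
    proof (rule sum.cong)
      fix m assume "m \<in> {..<p}"
      then have "valid_idx p n (\<alpha>(n := m))" using valid_string by simp
      moreover have "\<alpha>(n := k) = \<alpha>(n := m) \<longleftrightarrow> m = k" by (metis fun_upd_same)
      ultimately show "sc (coeff q m) (mon (\<alpha>(n := m))) (\<alpha>(n := k)) = (if m = k then coeff q k else 0)"
        by (simp add: sc_def mono_def)
    qed simp
    then show "coeff q k = 0" using fun_cong[OF z, of "\<alpha>(n := k)"] k by (simp add: sum_fun_apply)
  qed
qed (simp add: phi_def)

lemma dop_monom: "dop c (monom h a) (monom b m) = monom (h * b * of_nat (m + a * c) :: 'a) (m + a - 1)"
proof -
  have 1: "monom h a * pderiv (monom b m) = monom (h * b * of_nat m) (m + a - 1)"
    by (cases m) (simp_all add: pderiv_monom mult_monom algebra_simps)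
  have 2: "of_nat c * pderiv (monom h a) * monom b m = monom (h * b * of_nat (a * c)) (m + a - 1)"
    by (cases a) (simp_all add: pderiv_monom mult_monom of_nat_poly smult_monom algebra_simps)
  show ?thesis unfolding dop_def 1 2 by (simp add: add_monom algebra_simps)
qed

lemma phi_dop_monom:
  "phi (dop (Suc lam) (monom h k) q) = (if k < p then scD h (actK p r k (phi q)) else 0)"
proof -
  have *: "phi (dop (Suc lam) (monom h k) (monom b m)) = (if k < p then scD h (actK p r k (phi (monom b m))) else 0)" for b m
  proof (cases "m < p \<and> k < p")
    case True
    then show ?thesis by (simp add: dop_monom phi_monom actK_sc actK_B mult_ac del: of_nat_add of_nat_mult)
  next
    case False
    \<comment> \<open>A product with a factor of exponent at least p falls back below t^p only for
      t^p and \<partial>, or for 1 and t^p \<partial>; both have a structure constant divisible by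
      p.\<close>
    have "of_nat (m + k * Suc lam) = (0::'a)" if "m + k - 1 < p"
    proof -
      have "m = p \<and> k = 0 \<or> m = 0 \<and> k = p" using that False by auto
      then show ?thesis unfolding of_nat_eq_0_iff by auto
    qed
    then have "phi (dop (Suc lam) (monom h k) (monom b m)) = 0"
      by (cases "m + k - 1 < p") (simp_all add: dop_monom phi_monom B_ge del: of_nat_add of_nat_mult)
    then show ?thesis using False by (auto simp: phi_monom B_ge)
  qed
  have q: "q = (\<Sum>i\<le>degree q. monom (coeff q i) i)" by (simp add: poly_as_sum_of_monoms)
  show ?thesis
    by (subst (1 2) q) (simp add: dop_sum phi_sum * actK_sum ds.scale_sum_right del: poly_as_sum_of_monoms)
qed

lemma phi_dop: "phi (dop (Suc lam) h q) = (\<Sum>k<p. scD (coeff h k) (actK p r k (phi q)))"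
proof -
  have "h = (\<Sum>i\<le>degree h. monom (coeff h i) i)" by (simp add: poly_as_sum_of_monoms)
  then have "phi (dop (Suc lam) h q) = phi (dop (Suc lam) (\<Sum>i\<le>degree h. monom (coeff h i) i) q)"
    by (rule arg_cong)
  also have "\<dots> = (\<Sum>k\<le>degree h. if k < p then scD (coeff h k) (actK p r k (phi q)) else 0)"
    by (simp add: dop_sum_left phi_sum phi_dop_monom del: poly_as_sum_of_monoms)
  also have "\<dots> = (\<Sum>k\<in>{..degree h} \<union> {..<p}. if k < p then scD (coeff h k) (actK p r k (phi q)) else 0)"
    by (rule sum.mono_neutral_left) (auto simp: coeff_eq_0)
  also have "\<dots> = (\<Sum>k<p. scD (coeff h k) (actK p r k (phi q)))"
    by (rule sum.mono_neutral_cong_right) auto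
  finally show ?thesis .
qed

lemma phi_actK: "a < p \<Longrightarrow> actK p r a (phi q) = phi (dop (Suc lam) (monom 1 a) q)"
  by (simp add: phi_dop_monom)

lemma word_act_phi: "valid_word p w \<Longrightarrow> \<exists>q'. word_act p r w (phi q) = phi q'"
proof (induction w)
  case (Cons a w)
  then obtain q' where "word_act p r w (phi q) = phi q'" by auto
  then show ?case using Cons.prems phi_actK[of a q'] by auto
qed auto

text \<open>Read off from \<open>dop_commutator\<close>, as x^a \<partial> and x^b \<partial> have
  the bracket (b - a) x^(a+b-1) \<partial>. If that exponent is p or more,
  \<open>phi_dop_monom\<close> returns 0.\<close>

lemma actK_commutator:
  assumes "a < p" "b < p"
  shows "actK p r a (actK p r b (phi q)) - actK p r b (actK p r a (phi q))
    = (if a + b - 1 < p then scD (of_nat b - of_nat a) (actK p r (a + b - 1) (phi q)) else 0)"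
proof -
  have 1: "monom 1 a * pderiv (monom 1 b) - monom 1 b * pderiv (monom 1 a) = monom (of_nat b - of_nat a :: 'a) (a + b - 1)"
  proof -
    have "monom 1 a * pderiv (monom 1 b) = monom (of_nat b :: 'a) (a + b - 1)" for a b
      by (cases b) (simp_all add: pderiv_monom mult_monom)
    from this[of a b] this[of b a] show ?thesis by (simp add: diff_monom add.commute)
  qed
  have "actK p r a (actK p r b (phi q)) - actK p r b (actK p r a (phi q))
     = phi (dop (Suc lam) (monom (of_nat b - of_nat a) (a + b - 1)) q)"
    using assms by (simp only: phi_actK phi_diff[symmetric] dop_commutator 1)
  then show ?thesis unfolding phi_dop_monom .
qed

lemma words_of_length_Suc:
  "{t. length t = Suc m \<and> valid_word p t} = (\<lambda>(k, t). k # t) ` ({..<p} \<times> {t. length t = m \<and> valid_word p t})"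
  by (auto simp: length_Suc_conv image_iff)

text \<open>The sum over words is the expanded m-th power of the operator by which the sum of the
  \<open>cc k\<close> e_k acts; on polynomials that operator is the single Lie derivative along
  \<open>g\<close>.\<close>

lemma sum_words_phi:
  assumes g: "\<And>k. k < p \<Longrightarrow> coeff g k = cc k"
  shows "(\<Sum>t\<in>{t. length t = m \<and> valid_word p t}. scD (\<Prod>j<m. cc (t ! j)) (word_act p r t (phi q)))
     = phi ((dop (Suc lam) g ^^ m) q)"
proof (induction m)
  case 0
  have "{t. length t = 0 \<and> valid_word p t} = {[]}" by auto
  then show ?case by simp
next
  case (Suc m)
  let ?W = "{t. length t = m \<and> valid_word p t}"
  have inj: "inj_on (\<lambda>(k, t). k # t) ({..<p} \<times> ?W)" by (auto simp: inj_on_def)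
  have "(\<Sum>t\<in>{t. length t = Suc m \<and> valid_word p t}. scD (\<Prod>j<Suc m. cc (t ! j)) (word_act p r t (phi q)))
     = (\<Sum>(k, t)\<in>{..<p} \<times> ?W. scD (\<Prod>j<Suc m. cc ((k # t) ! j)) (word_act p r (k # t) (phi q)))"
    unfolding words_of_length_Suc sum.reindex[OF inj] by (simp add: case_prod_beta)
  also have "\<dots> = (\<Sum>k<p. \<Sum>t\<in>?W. scD (\<Prod>j<Suc m. cc ((k # t) ! j)) (word_act p r (k # t) (phi q)))"
    by (rule sum.cartesian_product[symmetric])
  also have "\<dots> = (\<Sum>k<p. scD (cc k) (actK p r k (\<Sum>t\<in>?W. scD (\<Prod>j<m. cc (t ! j)) (word_act p r t (phi q)))))"
    unfolding prod.lessThan_Suc_shift by (simp add: actK_sum actK_sc ds.scale_sum_right)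
  also have "\<dots> = (\<Sum>k<p. scD (coeff g k) (actK p r k (phi ((dop (Suc lam) g ^^ m) q))))"
    unfolding Suc by (rule sum.cong) (simp_all add: g)
  also have "\<dots> = phi ((dop (Suc lam) g ^^ Suc m) q)" by (simp add: phi_dop)
  finally show ?case .
qed

lemma actK_restricted:
  assumes "\<forall>k\<ge>p. cc k = 0"
  shows "(\<Sum>t\<in>{t. length t = p \<and> valid_word p t}. scD (\<Prod>j<p. cc (t ! j)) (word_act p r t (phi q)))
     = (\<Sum>k<p. scD (W1_pmap p cc k) (actK p r k (phi q)))"
proof -
  define g where "g = (\<Sum>k<p. monom (cc k) k)"
  have g: "coeff g k = cc k" if "k < p" for k
    using that by (simp add: g_def coeff_sum if_distrib cong: if_cong)
  have "(\<Sum>t\<in>{t. length t = p \<and> valid_word p t}. scD (\<Prod>j<p. cc (t ! j)) (word_act p r t (phi q)))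
     = phi ((dop (Suc lam) g ^^ p) q)" by (rule sum_words_phi[OF g])
  also have "\<dots> = phi (dop (Suc lam) (pth_power_field p g) q)"
    by (simp add: dop_funpow_p[OF char_p prime_p])
  also have "\<dots> = (\<Sum>k<p. scD (W1_pmap p cc k) (actK p r k (phi q)))"
    unfolding phi_dop by (rule sum.cong) (simp_all add: W1_pmap_coeff[OF char_p prime_p g])
  finally show ?thesis .
qed

text \<open>A singular vector of weight \<open>\<mu>\<close> satisfies all relations: a right factor
  of a word moves it inside the image of \<open>phi\<close>, where the operator identities hold, and
  a left factor is applied afterwards. The weight is not tied to \<open>lam\<close>, since proper
  segments have other generators.\<close>

lemma ext_Rel_eq_0:
  assumes v: "v = phi q" and hw: "\<And>a. 1 \<le> a \<Longrightarrow> a < p \<Longrightarrow> actK p r a v = scD (chi \<mu> a) v"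
    and "\<rho> \<in> Rel p \<mu>"
  shows "ext (\<lambda>w. word_act p r w v) \<rho> = 0"
  using assms(3)
proof (cases rule: Rel_cases)
  let ?\<psi> = "\<lambda>w. word_act p r w v"
  note fc = wd_fin_comb fin_comb_scale fin_comb_diff
    fin_comb_sum fin_comb_0
  {
    case (commutator u w a b)
    obtain q' where q': "word_act p r w v = phi q'" using word_act_phi[OF commutator(2)] v by auto
    have f: "(if a + b - 1 < p then sc (of_nat b - of_nat a) (wd (u @ [a + b - 1] @ w)) else 0) \<in> fin_comb p"
      using commutator by (auto intro!: fc)
    have f1: "wd (u @ [a, b] @ w) \<in> (fin_comb p :: 'a words set)"
        "wd (u @ [b, a] @ w) \<in> (fin_comb p :: 'a words set)"
      using commutator by (auto intro!: wd_fin_comb)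
    have "ext ?\<psi> \<rho> = ?\<psi> (u @ [a, b] @ w) - ?\<psi> (u @ [b, a] @ w)
        - ext ?\<psi> (if a + b - 1 < p then sc (of_nat b - of_nat a) (wd (u @ [a + b - 1] @ w)) else 0)"
      unfolding commutator(5) ext_diff[OF fin_comb_diff[OF f1] f] ext_diff[OF f1] ext_wd ..
    also have "ext ?\<psi> (if a + b - 1 < p then sc (of_nat b - of_nat a) (wd (u @ [a + b - 1] @ w)) else 0)
       = word_act p r u (if a + b - 1 < p then scD (of_nat b - of_nat a) (actK p r (a + b - 1) (phi q')) else 0)"
      using commutator by (simp add: ext_sc[of _ p] fc q' word_act_sc)
    also have "?\<psi> (u @ [a, b] @ w) - ?\<psi> (u @ [b, a] @ w)
       = word_act p r u (actK p r a (actK p r b (phi q')) - actK p r b (actK p r a (phi q')))"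
      by (simp add: q' word_act_diff)
    finally show ?thesis unfolding actK_commutator[OF commutator(3,4)] fun_eq_iff by simp
  next
    case (restricted u w c)
    obtain q' where q': "word_act p r w v = phi q'" using word_act_phi[OF restricted(2)] v by auto
    let ?W = "{t. length t = p \<and> valid_word p t}"
    have "ext ?\<psi> \<rho> = ext ?\<psi> (\<Sum>t\<in>?W. sc (\<Prod>j<p. c (t ! j)) (wd (u @ t @ w)))
        - ext ?\<psi> (\<Sum>k<p. sc (W1_pmap p c k) (wd (u @ [k] @ w)))"
      unfolding restricted(4) using restricted by (intro ext_diff[of _ p] fc) auto
    also have "ext ?\<psi> (\<Sum>t\<in>?W. sc (\<Prod>j<p. c (t ! j)) (wd (u @ t @ w)))
        = (\<Sum>t\<in>?W. ext ?\<psi> (sc (\<Prod>j<p. c (t ! j)) (wd (u @ t @ w))))"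
      using restricted by (intro ext_sum[of _ _ p] fc) auto
    also have "\<dots> = (\<Sum>t\<in>?W. word_act p r u (scD (\<Prod>j<p. c (t ! j)) (word_act p r t (phi q'))))"
      using restricted by (intro sum.cong) (auto simp: ext_sc[of _ p] fc word_act_sc q')
    also have "\<dots> = word_act p r u (\<Sum>t\<in>?W. scD (\<Prod>j<p. c (t ! j)) (word_act p r t (phi q')))"
      by (rule word_act_sum[symmetric])
    also have "ext ?\<psi> (\<Sum>k<p. sc (W1_pmap p c k) (wd (u @ [k] @ w)))
        = (\<Sum>k<p. ext ?\<psi> (sc (W1_pmap p c k) (wd (u @ [k] @ w))))"
      using restricted by (intro ext_sum[of _ _ p] fc) auto
    also have "\<dots> = (\<Sum>k<p. word_act p r u (scD (W1_pmap p c k) (actK p r k (phi q'))))"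
      using restricted by (intro sum.cong) (auto simp: ext_sc[of _ p] fc word_act_sc q')
    also have "\<dots> = word_act p r u (\<Sum>k<p. scD (W1_pmap p c k) (actK p r k (phi q')))"
      by (rule word_act_sum[symmetric])
    finally show ?thesis unfolding actK_restricted[OF restricted(3)] fun_eq_iff by simp
  next
    case (highest u a)
    have f: "wd (u @ [a]) \<in> (fin_comb p :: 'a words set)" "wd u \<in> (fin_comb p :: 'a words set)"
      using highest by (auto intro!: wd_fin_comb)
    have "ext ?\<psi> \<rho> = ?\<psi> (u @ [a]) - scD (chi \<mu> a) (?\<psi> u)"
      unfolding highest(4) ext_diff[OF f(1) fin_comb_scale[OF f(2)]] ext_sc[OF f(2)] ext_wd ..
    also have "\<dots> = word_act p r u (actK p r a v - scD (chi \<mu> a) v)"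
      by (simp add: word_act_diff word_act_sc)
    finally show ?thesis unfolding hw[OF highest(2,3)] by simp
  }
qed

end

section \<open>Segments of a string and their simple subquotients\<close>

context density_string
begin

text \<open>Given by polynomials rather than as a span, so that elements have leading coefficients
  to argue with.\<close>

definition seg :: "nat \<Rightarrow> 'a der set" where
  "seg u = phi ` {q. \<forall>m\<ge>u. coeff q m = 0}"

lemma subspace_seg: "ds.subspace (seg u)"
  unfolding ds.subspace_def
proof (intro conjI ballI allI)
  show "0 \<in> seg u" unfolding seg_def by (rule image_eqI[of _ _ 0]) auto
  show "x + y \<in> seg u" if "x \<in> seg u" "y \<in> seg u" for x y
  proof -
    from that obtain f g where "x = phi f" "y = phi g" "\<forall>m\<ge>u. coeff f m = 0" "\<forall>m\<ge>u. coeff g m = 0"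
      unfolding seg_def by blast
    then show ?thesis unfolding seg_def by (intro image_eqI[of _ _ "f + g"]) (auto simp: phi_add)
  qed
  show "scD c x \<in> seg u" if "x \<in> seg u" for c x
  proof -
    from that obtain f where "x = phi f" "\<forall>m\<ge>u. coeff f m = 0" unfolding seg_def by blast
    then show ?thesis unfolding seg_def by (intro image_eqI[of _ _ "smult c f"]) (auto simp: phi_smult)
  qed
qed

lemmas zero_in_seg = ds.subspace_0[OF subspace_seg]

lemma B_phi: "B k = phi (monom 1 k)"
  by (simp add: phi_monom)

lemma B_in_seg: "k < u \<Longrightarrow> B k \<in> seg u"
  unfolding B_phi seg_def by (rule imageI) auto

lemma phi_in: "ds.subspace C \<Longrightarrow> (\<And>m. m < p \<Longrightarrow> coeff q m \<noteq> 0 \<Longrightarrow> B m \<in> C) \<Longrightarrow> phi q \<in> C"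
  unfolding phi_def
proof (rule ds.subspace_sum)
  fix m assume C: "ds.subspace C" and B: "\<And>m. m < p \<Longrightarrow> coeff q m \<noteq> 0 \<Longrightarrow> B m \<in> C" and m: "m \<in> {..<p}"
  show "scD (coeff q m) (B m) \<in> C"
  proof (cases "coeff q m = 0")
    case True
    show ?thesis unfolding True ds.scale_zero_left by (rule ds.subspace_0[OF C])
  next
    case False
    then show ?thesis using B m by (intro ds.subspace_scale[OF C]) simp
  qed
qed

lemma seg_least: "ds.subspace C \<Longrightarrow> (\<And>m. m < u \<Longrightarrow> B m \<in> C) \<Longrightarrow> seg u \<subseteq> C"
  unfolding seg_def by (auto intro!: phi_in) (meson not_le)

lemma seg_0: "seg 0 = {0}"
proof -
  have "{q. \<forall>m\<ge>0. coeff q m = (0::'a)} = {0}" by (auto intro: poly_eqI)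
  then show ?thesis by (simp add: seg_def)
qed

lemma B_notin_seg:
  assumes "u \<le> m" "m < p"
  shows "B m \<notin> seg u"
proof
  assume "B m \<in> seg u"
  then obtain q where q: "B m = phi q" "\<forall>m\<ge>u. coeff q m = 0" unfolding seg_def by blast
  then have "phi (monom 1 m - q) = 0" by (simp add: phi_diff B_phi)
  then have "coeff (monom 1 m - q) m = 0" using assms phi_eq_0_iff by blast
  then show False using q assms by simp
qed

text \<open>The last condition makes the structure constant of e_a vanish wherever e_a leads out of
  the segment; targets from t^p on are 0 anyway. The second condition keeps the segment inside the
  derived algebra.\<close>

definition closed_seg :: "nat \<Rightarrow> bool" where
  "closed_seg u \<longleftrightarrow> u \<le> p \<and> (\<forall>m<u. \<alpha>(n := m) \<in> K_idx)
     \<and> (\<forall>a<p. \<forall>m<u. u \<le> m + a - 1 \<longrightarrow> m + a - 1 < p \<longrightarrow> p dvd (m + a * Suc lam))"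

lemma is_submod_seg:
  assumes "closed_seg u"
  shows "is_submod p r (seg u)"
  unfolding is_submod_iff
proof (intro conjI allI impI ballI)
  show "ds.subspace (seg u)" by (rule subspace_seg)
  have "B m \<in> Kalg p r" if "m < u" for m
    unfolding B_def using assms that by (intro DK_mono_in_Kalg) (auto simp: closed_seg_def)
  then show "seg u \<subseteq> Kalg p r" by (rule seg_least[OF subspace_Kalg])
  fix a x assume a: "a < p" and x: "x \<in> seg u"
  have sub: "ds.subspace {x. actK p r a x \<in> seg u}"
    using zero_in_seg ds.subspace_add[OF subspace_seg] ds.subspace_scale[OF subspace_seg]
    unfolding ds.subspace_def by (auto simp: actK_add actK_sc simp del: plus_fun_apply)
  have "B m \<in> {x. actK p r a x \<in> seg u}" if m: "m < u" for m
  proof -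
    have mp: "m < p" using assms m by (simp add: closed_seg_def)
    have "scD (of_nat (m + a * Suc lam)) (B (m + a - 1)) \<in> seg u"
    proof (cases "m + a - 1 < u")
      case True
      then show ?thesis by (intro ds.subspace_scale[OF subspace_seg] B_in_seg)
    next
      case False
      have e: "scD (of_nat (m + a * Suc lam)) (B (m + a - 1)) = 0"
      proof (cases "m + a - 1 < p")
        case True
        then have "p dvd (m + a * Suc lam)" using assms m a False by (auto simp: closed_seg_def)
        then have "(of_nat (m + a * Suc lam) :: 'a) = 0" unfolding of_nat_eq_0_iff .
        then show ?thesis by (simp only: ds.scale_zero_left)
      next
        case False
        then show ?thesis by (simp add: B_ge)
      qed
      show ?thesis unfolding e by (rule zero_in_seg)
    qed
    then show ?thesis using actK_B[OF mp] by simp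
  qed
  then show "actK p r a x \<in> seg u" using seg_least[OF sub, of u] x by blast
qed

lemma word_act_replicate_B:
  "k \<le> m \<Longrightarrow> m < p \<Longrightarrow> \<exists>s. s \<noteq> 0 \<and> word_act p r (replicate k 0) (B m) = scD s (B (m - k))"
proof (induction k)
  case 0
  show ?case by (rule exI[of _ 1]) simp
next
  case (Suc k)
  then obtain s where s: "s \<noteq> 0" "word_act p r (replicate k 0) (B m) = scD s (B (m - k))" by auto
  have "actK p r 0 (B (m - k)) = scD (of_nat (m - k)) (B (m - Suc k))"
    using actK_B[of "m - k" 0] Suc.prems by simp
  then have "word_act p r (replicate (Suc k) 0) (B m) = scD (s * of_nat (m - k)) (B (m - Suc k))"
    using s by (simp add: actK_sc)
  moreover have "s * of_nat (m - k) \<noteq> 0"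
    using s of_nat_neq_0[of "m - k"] Suc.prems by simp
  ultimately show ?case by blast
qed

text \<open>e_0 lowers t^m with factor m, which is invertible for 0 < m < p, so the powers of e_0
  sweep out the segment from its top vector.\<close>

lemma seg_generated:
  assumes u: "0 < u" "u \<le> p" and x: "x \<in> seg u"
  shows "\<exists>\<rho>\<in>fin_comb p. x = ext (\<lambda>w. word_act p r w (B (u - 1))) \<rho>"
proof -
  let ?\<psi> = "\<lambda>w. word_act p r w (B (u - 1))"
  let ?E = "ext ?\<psi> ` fin_comb p"
  have sub: "ds.subspace ?E"
    unfolding ds.subspace_def
  proof (intro conjI ballI allI)
    show "0 \<in> ?E" by (rule image_eqI[of _ _ 0]) (auto simp: fin_comb_0)
    fix x assume "x \<in> ?E"
    then obtain \<rho> where \<rho>: "x = ext ?\<psi> \<rho>" "\<rho> \<in> fin_comb p" by blast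
    show "x + y \<in> ?E" if "y \<in> ?E" for y
    proof -
      from that obtain \<tau> where \<tau>: "y = ext ?\<psi> \<tau>" "\<tau> \<in> fin_comb p" by blast
      show ?thesis unfolding \<rho>(1) \<tau>(1) ext_add[OF \<rho>(2) \<tau>(2), symmetric]
        by (rule imageI) (rule fin_comb_add[OF \<rho>(2) \<tau>(2)])
    qed
    show "scD c x \<in> ?E" for c
      unfolding \<rho>(1) ext_sc[OF \<rho>(2), symmetric] by (rule imageI) (rule fin_comb_scale[OF \<rho>(2)])
  qed
  have "B m \<in> ?E" if "m < u" for m
  proof -
    let ?k = "u - 1 - m"
    have "?k \<le> u - 1" "u - 1 < p" using u by auto
    from word_act_replicate_B[OF this]
    obtain s where s: "s \<noteq> 0" "?\<psi> (replicate ?k 0) = scD s (B (u - 1 - ?k))" by blast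
    have "u - 1 - ?k = m" using that by simp
    then have e: "?\<psi> (replicate ?k 0) = scD s (B m)" using s(2) by simp
    have "valid_word p (replicate ?k 0)" using u by (auto simp: valid_word_def)
    then have "?\<psi> (replicate ?k 0) \<in> ?E"
      by (intro image_eqI[of _ _ "wd (replicate ?k 0)"] wd_fin_comb) simp_all
    then have "scD s (B m) \<in> ?E" unfolding e .
    with s(1) show ?thesis using scD_cancel_in[OF sub] by blast
  qed
  then have "seg u \<subseteq> ?E" by (rule seg_least[OF sub])
  with x show ?thesis by blast
qed

text \<open>For \<open>a \<ge> 2\<close>, e_a raises the top vector out of a closed segment, hence
  kills it. Its weight is (u-1) + c = u + lam.\<close>

lemma actK_highest:
  assumes cl: "closed_seg u" and u: "0 < u" and \<mu>: "(of_nat \<mu> :: 'a) = of_nat (u + lam)"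
    and a: "1 \<le> a" "a < p"
  shows "actK p r a (B (u - 1)) = scD (chi \<mu> a) (B (u - 1))"
proof -
  have up: "u - 1 < p" using cl u by (auto simp: closed_seg_def)
  show ?thesis
  proof (cases "a = 1")
    case True
    have "u - 1 + 1 * Suc lam = u + lam" using u by simp
    then have "(of_nat (u - 1 + 1 * Suc lam) :: 'a) = of_nat \<mu>" using \<mu> by metis
    then show ?thesis using actK_B[OF up, of 1] True unfolding chi_def by simp
  next
    case False
    have "scD (of_nat (u - 1 + a * Suc lam)) (B (u - 1 + a - 1)) = 0"
    proof (cases "u - 1 + a - 1 < p")
      case True
      have "u - 1 < u" "u \<le> u - 1 + a - 1" using u a False by auto
      then have "p dvd (u - 1 + a * Suc lam)" using cl a True unfolding closed_seg_def by blast
      then have "(of_nat (u - 1 + a * Suc lam) :: 'a) = 0" unfolding of_nat_eq_0_iff .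
      then show ?thesis by (simp only: ds.scale_zero_left)
    next
      case False
      then show ?thesis by (simp add: B_ge)
    qed
    then show ?thesis using actK_B[OF up, of a] False by (simp add: chi_def)
  qed
qed

text \<open>The relations and the surjectivity hold exactly in the segment, so \<open>N\<close> can
  be any subspace; both {0} and smaller segments are inserted for it.\<close>

lemma quot_hom_seg:
  assumes cl: "closed_seg u" and u: "0 < u" and \<mu>: "(of_nat \<mu> :: 'a) = of_nat (u + lam)"
    and N: "ds.subspace N"
  shows "quot_hom p r \<mu> (seg u) N (\<lambda>w. word_act p r w (B (u - 1)))"
  unfolding quot_hom_def
proof (intro conjI allI impI ballI)
  have N0: "0 \<in> N" using ds.subspace_0[OF N] .
  have up: "u \<le> p" using cl by (simp add: closed_seg_def)
  show "word_act p r w (B (u - 1)) \<in> seg u" if "valid_word p w" for w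
    using that
  proof (induction w)
    case Nil
    show ?case using u B_in_seg by simp
  next
    case (Cons a w)
    then show ?case using is_submod_actK[OF is_submod_seg[OF cl], of a] by simp
  qed
  show "actK p r a (word_act p r w (B (u - 1))) - word_act p r (a # w) (B (u - 1)) \<in> N" for w a
    using N0 by simp
  show "ext (\<lambda>w. word_act p r w (B (u - 1))) \<rho> \<in> N" if "\<rho> \<in> Rel p \<mu>" for \<rho>
    using ext_Rel_eq_0[OF B_phi actK_highest[OF cl u \<mu>] that] N0 by simp
  show "\<exists>\<rho>\<in>fin_comb p. x - ext (\<lambda>w. word_act p r w (B (u - 1))) \<rho> \<in> N" if "x \<in> seg u" for x
    using seg_generated[OF u up that] N0 by (metis diff_self)
qed

text \<open>e_0 acts as the derivative. An element outside \<open>seg l\<close> is differentiated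
  until its leading exponent is l; its lower terms lie in \<open>seg l\<close>, so
  \<open>B l\<close> is obtained, and \<open>reach\<close> provides the rest.\<close>

lemma simple_subq_seg:
  assumes cu: "closed_seg u" and cl: "closed_seg l" and lu: "l < u"
    and reach: "\<And>C k. is_submod p r C \<Longrightarrow> B l \<in> C \<Longrightarrow> l \<le> k \<Longrightarrow> k < u \<Longrightarrow> B k \<in> C"
  shows "simple_subq p r (seg u) (seg l)"
  unfolding simple_subq_def
proof (intro conjI allI impI)
  show "is_submod p r (seg u)" "is_submod p r (seg l)" using is_submod_seg cu cl by auto
  have up: "u \<le> p" using cu by (simp add: closed_seg_def)
  have "seg l \<subseteq> seg u" using lu by (intro seg_least[OF subspace_seg] B_in_seg) simp
  moreover have "B l \<in> seg u" "B l \<notin> seg l" using lu up B_in_seg[of l u] B_notin_seg[of l l] by auto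
  ultimately show "seg l \<subset> seg u" by blast
  fix C assume C: "is_submod p r C \<and> seg l \<subseteq> C \<and> C \<subseteq> seg u"
  then have sub: "ds.subspace C" using is_submod_subspace by blast
  have lower: "B l \<in> C" if "phi q \<in> C" "coeff q m \<noteq> 0" "\<And>i. m < i \<Longrightarrow> coeff q i = 0" "l \<le> m" "m < p" for q m
    using that
  proof (induction "m - l" arbitrary: m q)
    case 0
    then have m: "m = l" by simp
    have "phi (q - monom (coeff q l) l) \<in> C"
    proof (rule phi_in[OF sub])
      fix i assume "coeff (q - monom (coeff q l) l) i \<noteq> 0"
      then have "i < l" using 0 m by (cases "i < l"; cases "i = l") auto
      then show "B i \<in> C" using C B_in_seg by blast
    qed
    then have "phi q - phi (q - monom (coeff q l) l) \<in> C" using 0 by (intro ds.subspace_diff[OF sub])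
    then have "scD (coeff q l) (B l) \<in> C" by (simp add: phi_diff phi_monom)
    then show ?case using scD_cancel_in[OF sub] 0 m by blast
  next
    case (Suc k)
    have e: "dop (Suc lam) (monom 1 0) q = pderiv q" by (simp add: dop_def pderiv_monom)
    have p0: "0 < p" using p_gt_2 by simp
    have m: "Suc (m - 1) = m" using Suc.hyps(2) by simp
    show ?case
    proof (rule Suc.hyps(1)[of "m - 1" "pderiv q"])
      show "k = m - 1 - l" "l \<le> m - 1" "m - 1 < p" using Suc.hyps(2) Suc.prems by auto
      have "actK p r 0 (phi q) \<in> C" using C Suc.prems(1) is_submod_actK[OF _ p0] by blast
      then show "phi (pderiv q) \<in> C" using phi_actK[OF p0, of q] e by simp
      have "(of_nat m :: 'a) \<noteq> 0" using of_nat_neq_0[of m] Suc.prems m by simp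
      then show "coeff (pderiv q) (m - 1) \<noteq> 0" unfolding coeff_pderiv m using Suc.prems by simp
      show "coeff (pderiv q) i = 0" if "m - 1 < i" for i
        unfolding coeff_pderiv using Suc.prems(3)[of "Suc i"] that by simp
    qed
  qed
  show "C = seg l \<or> C = seg u"
  proof (cases "C = seg l")
    case False
    then obtain x where x: "x \<in> C" "x \<notin> seg l" using C by blast
    then obtain q where q: "x = phi q" "\<forall>m\<ge>u. coeff q m = 0" using C unfolding seg_def by blast
    have ex: "\<exists>m\<ge>l. coeff q m \<noteq> 0"
      using x(2) unfolding q(1) seg_def by blast
    have "q \<noteq> 0" using ex by auto
    moreover have "degree q \<ge> l" using ex le_degree[of q] by (meson order_trans)
    moreover have "degree q < p"
    proof (rule ccontr)
      assume "\<not> degree q < p"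
      then have "coeff q (degree q) = 0" using q(2) up by auto
      then show False using \<open>q \<noteq> 0\<close> by simp
    qed
    ultimately have Bl: "B l \<in> C" using lower[of q "degree q"] x q(1) by (simp add: coeff_eq_0)
    have "B k \<in> C" if "k < u" for k
    proof (cases "l \<le> k")
      case True
      then show ?thesis using reach[OF _ Bl True that] C by blast
    next
      case False
      then show ?thesis using C B_in_seg[of k l] by auto
    qed
    then have "seg u \<subseteq> C" by (rule seg_least[OF sub])
    then show ?thesis using C by blast
  qed simp
qed

lemma subq_iso_L_seg:
  assumes cu: "closed_seg u" and cl: "closed_seg l" and lu: "l < u" and \<mu>: "(of_nat \<mu> :: 'a) = of_nat (u + lam)"
    and reach: "\<And>C k. is_submod p r C \<Longrightarrow> B l \<in> C \<Longrightarrow> l \<le> k \<Longrightarrow> k < u \<Longrightarrow> B k \<in> C"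
  shows "subq_iso_L p r \<mu> (seg u) (seg l)"
  unfolding subq_iso_L_def
proof
  show "simple_subq p r (seg u) (seg l)" using cu cl lu reach by (rule simple_subq_seg)
  have "0 < u" using lu by simp
  then show "\<exists>\<psi>. quot_hom p r \<mu> (seg u) (seg l) \<psi>"
    using quot_hom_seg[OF cu _ \<mu> subspace_seg] by blast
qed

lemma raise_B:
  assumes "is_submod p r C" "B m \<in> C" "m < p" "a < p" "\<not> p dvd (m + a * Suc lam)" "k = m + a - 1"
  shows "B k \<in> C"
proof -
  have "scD (of_nat (m + a * Suc lam)) (B k) \<in> C"
    using is_submod_actK[OF assms(1,4,2)] actK_B[OF assms(3)] assms(6) by simp
  moreover have "(of_nat (m + a * Suc lam) :: 'a) \<noteq> 0" using assms(5) unfolding of_nat_eq_0_iff .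
  ultimately show ?thesis using scD_cancel_in[OF is_submod_subspace[OF assms(1)]] by blast
qed

lemma closed_seg_0: "closed_seg 0"
  by (simp add: closed_seg_def)

lemma closed_seg_p: "(\<And>m. m < p \<Longrightarrow> \<alpha>(n := m) \<in> K_idx) \<Longrightarrow> closed_seg p"
  by (simp add: closed_seg_def)

text \<open>For injectivity, a combination of words is, modulo relations, a combination of the e_0^k
  with k < p, and these map to nonzero multiples of the independent t^(p-1-k). The generator t^(p-1)
  has weight p + lam = lam.\<close>

lemma subq_iso_V_seg:
  assumes cl: "closed_seg p"
  shows "subq_iso_V p r lam (seg p) {0}"
  unfolding subq_iso_V_def
proof (intro conjI exI ballI impI)
  let ?\<psi> = "\<lambda>w. word_act p r w (B (p - 1))"
  have p0: "0 < p" "p > 1" using p_gt_2 by auto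
  have \<mu>: "(of_nat lam :: 'a) = of_nat (p + lam)" using of_nat_eq_0_iff[of p] by simp
  show "is_submod p r (seg p)" by (rule is_submod_seg[OF cl])
  show "is_submod p r {0}" by (rule is_submod_0)
  show "{0} \<subseteq> seg p" using zero_in_seg by simp
  have "ds.subspace {0 :: 'a der}" by (simp add: ds.subspace_def)
  with cl p0(1) \<mu> show "quot_hom p r lam (seg p) {0} ?\<psi>" by (rule quot_hom_seg)
  fix \<rho> :: "'a words" assume \<rho>: "\<rho> \<in> fin_comb p" "ext ?\<psi> \<rho> \<in> {0}"
  obtain \<tau> b where \<tau>: "\<tau> \<in> fs.span (Rel p lam)" and b: "\<rho> = \<tau> + (\<Sum>k<p. sc (b k) (wd (replicate k 0)))"
    using word_normal_form[OF p0(2) \<rho>(1)] by blast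
  have R: "ext ?\<psi> \<sigma> = 0" if "\<sigma> \<in> Rel p lam" for \<sigma>
    using ext_Rel_eq_0[OF B_phi actK_highest[OF cl p0(1) \<mu>] that] by simp
  from \<tau> have t: "\<tau> \<in> fin_comb p \<and> ext ?\<psi> \<tau> = 0"
  proof (induction rule: fs.span_induct_alt)
    case base
    show ?case using fin_comb_0 ext_zero by blast
  next
    case (step c x y)
    then have x: "x \<in> fin_comb p" "ext ?\<psi> x = 0" using Rel_fin_comb R by blast+
    have cx: "sc c x \<in> fin_comb p" using x by (intro fin_comb_scale)
    have y: "y \<in> fin_comb p" "ext ?\<psi> y = 0" using step.IH by blast+
    have "ext ?\<psi> (sc c x + y) = 0"
      unfolding ext_add[OF cx y(1)] ext_sc[OF x(1)] x(2) y(2) by simp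
    then show ?case using fin_comb_add[OF cx y(1)] by blast
  qed
  have w: "sc (b k) (wd (replicate k 0)) \<in> fin_comb p" for k
    using p0 by (intro fin_comb_scale wd_fin_comb) (auto simp: valid_word_def)
  have "\<forall>k\<in>{..<p}. \<exists>s. s \<noteq> 0 \<and> ?\<psi> (replicate k 0) = scD s (B (p - 1 - k))"
    using word_act_replicate_B[of _ "p - 1"] by auto
  then obtain s where s: "\<And>k. k < p \<Longrightarrow> s k \<noteq> 0 \<and> ?\<psi> (replicate k 0) = scD (s k) (B (p - 1 - k))"
    by (metis lessThan_iff)
  have "ext ?\<psi> \<rho> = ext ?\<psi> \<tau> + ext ?\<psi> (\<Sum>k<p. sc (b k) (wd (replicate k 0)))"
    unfolding b using t w by (intro ext_add[of _ p] fin_comb_sum) auto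
  also have "ext ?\<psi> (\<Sum>k<p. sc (b k) (wd (replicate k 0))) = (\<Sum>k<p. ext ?\<psi> (sc (b k) (wd (replicate k 0))))"
    using w by (intro ext_sum[of _ _ p])
  also have "\<dots> = (\<Sum>k<p. phi (monom (b k * s k) (p - 1 - k)))"
  proof (rule sum.cong)
    fix k assume "k \<in> {..<p}"
    moreover have "valid_word p (replicate k 0)" using p0 by (auto simp: valid_word_def)
    ultimately show "ext ?\<psi> (sc (b k) (wd (replicate k 0))) = phi (monom (b k * s k) (p - 1 - k))"
      using s[of k] by (simp add: ext_sc[OF wd_fin_comb] phi_monom)
  qed simp
  also have "\<dots> = phi (\<Sum>k<p. monom (b k * s k) (p - 1 - k))" by (rule phi_sum[symmetric])
  finally have "phi (\<Sum>k<p. monom (b k * s k) (p - 1 - k)) = 0" using \<rho>(2) t by simp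
  then have z: "coeff (\<Sum>k<p. monom (b k * s k) (p - 1 - k)) m = 0" if "m < p" for m
    using that phi_eq_0_iff by blast
  have "b k = 0" if k: "k < p" for k
  proof -
    have "coeff (\<Sum>k<p. monom (b k * s k) (p - 1 - k)) (p - 1 - k)
        = (\<Sum>j<p. if j = k then b k * s k else 0)"
      unfolding coeff_sum using k by (intro sum.cong) auto
    then have "b k * s k = 0" using z[of "p - 1 - k"] k by simp
    then show ?thesis using s[OF k] by simp
  qed
  then have "(\<Sum>k<p. sc (b k) (wd (replicate k 0))) = (0 :: 'a words)"
    by (intro sum.neutral) auto
  then show "\<rho> \<in> fspan (Rel p lam)" unfolding fspan_eq_span b using \<tau> by simp
qed

lemma subq_iso_L_generic:
  assumes cl: "closed_seg p" and lam: "1 \<le> lam" "lam \<le> p - 2"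
  shows "subq_iso_L p r lam (seg p) {0}"
proof -
  have p3: "p \<ge> 3" using p_gt_2 by simp
  have not_dvd: "\<not> p dvd k" if "0 < k" "k < p" for k using that by (auto dest: dvd_imp_le)
  have "subq_iso_L p r lam (seg p) (seg 0)"
  proof (rule subq_iso_L_seg[OF cl closed_seg_0])
    show "0 < p" using p3 by simp
    show "(of_nat lam :: 'a) = of_nat (p + lam)" using of_nat_eq_0_iff[of p] by simp
    fix C k assume C: "is_submod p r C" and B0: "B 0 \<in> C" and k: "k < p"
    \<comment> \<open>e_(k+1) takes 1 to (k+1)(lam+1) t^k; both factors are prime to p here.\<close>
    have low: "B k \<in> C" if "k < p - 1" for k
    proof (rule raise_B[OF C B0, of "Suc k"])
      have "\<not> p dvd Suc k" "\<not> p dvd Suc lam" using not_dvd lam that p3 by auto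
      then show "\<not> p dvd (0 + Suc k * Suc lam)" unfolding add_0 prime_dvd_mult_iff[OF prime_p] by blast
    qed (use that p3 in auto)
    show "B k \<in> C"
    proof (cases "k < p - 1")
      case False
      then have k': "k = p - 1" using k by simp
      \<comment> \<open>Reaching t^(p-1) directly from 1 would take e_p, which W(1) does not have.
        From t it takes e_(p-1), with factor 1 + (p-1)(lam+1), which is -lam modulo p.\<close>
      show ?thesis
      proof (rule raise_B[OF C low[of 1], of "p - 1"])
        obtain i where "p = Suc i" using p3 by (cases p) auto
        then have "1 + (p - 1) * Suc lam + lam = p * Suc lam" by (simp add: algebra_simps)
        then have "p dvd (1 + (p - 1) * Suc lam) \<Longrightarrow> p dvd lam"
          by (metis dvd_add_right_iff dvd_triv_left)
        then show "\<not> p dvd (1 + (p - 1) * Suc lam)" using not_dvd[of lam] lam p3 by auto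
      qed (use k' p3 in auto)
    qed (rule low)
  qed
  then show ?thesis by (simp add: seg_0)
qed

text \<open>In degree c = 1 the action is q \<mapsto> (gq)', and t^(p-1) is not a derivative in
  characteristic p.\<close>

lemma closed_seg_lam_0:
  assumes "lam = 0" "\<And>m. m < p - 1 \<Longrightarrow> \<alpha>(n := m) \<in> K_idx"
  shows "closed_seg (p - 1)"
  unfolding closed_seg_def
proof (intro conjI allI impI)
  fix a m assume "m < p - 1" "p - 1 \<le> m + a - 1" "m + a - 1 < p"
  then have "m + a = p" using p_gt_2 by auto
  then show "p dvd (m + a * Suc lam)" using assms(1) by simp
qed (use assms in auto)

text \<open>From 1, e_(k+1) reaches t^k with factor k+1. The hypothesis stops below t^(p-1) so that
  the exceptional string is included.\<close>

lemma subq_iso_L_lam_0_lower: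
  assumes "lam = 0" "\<And>m. m < p - 1 \<Longrightarrow> \<alpha>(n := m) \<in> K_idx"
  shows "subq_iso_L p r (p - 1) (seg (p - 1)) {0}"
proof -
  have p3: "p \<ge> 3" using p_gt_2 by simp
  have "subq_iso_L p r (p - 1) (seg (p - 1)) (seg 0)"
  proof (rule subq_iso_L_seg[OF closed_seg_lam_0[OF assms] closed_seg_0])
    fix C k assume C: "is_submod p r C" and B0: "B 0 \<in> C" and k: "k < p - 1"
    show "B k \<in> C"
    proof (rule raise_B[OF C B0, of "Suc k"])
      show "\<not> p dvd (0 + Suc k * Suc lam)" using assms(1) k by (auto dest: dvd_imp_le)
    qed (use k p3 in auto)
  qed (use p3 assms in auto)
  then show ?thesis by (simp add: seg_0)
qed

lemma subq_iso_L_lam_0_upper: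
  assumes "lam = 0" "\<And>m. m < p \<Longrightarrow> \<alpha>(n := m) \<in> K_idx"
  shows "subq_iso_L p r 0 (seg p) (seg (p - 1))"
proof (rule subq_iso_L_seg[OF closed_seg_p[OF assms(2)] closed_seg_lam_0[OF assms(1)]])
  show "(of_nat 0 :: 'a) = of_nat (p + lam)" using of_nat_eq_0_iff[of p] assms(1) by simp
  fix C k assume "B (p - 1) \<in> C" "p - 1 \<le> k" "k < p"
  moreover from this have "k = p - 1" by simp
  ultimately show "B k \<in> C" by simp
qed (use p_gt_2 assms in auto)

text \<open>Degree c = p acts like degree 0, so the constants are killed.\<close>

lemma closed_seg_lam_max:
  assumes "lam = p - 1" "\<And>m. m < p \<Longrightarrow> \<alpha>(n := m) \<in> K_idx"
  shows "closed_seg 1"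
proof -
  have "Suc lam = p" using assms(1) p_gt_2 by simp
  then show ?thesis unfolding closed_seg_def using assms(2) p_gt_2 by auto
qed

lemma subq_iso_L_lam_max_lower:
  assumes "lam = p - 1" "\<And>m. m < p \<Longrightarrow> \<alpha>(n := m) \<in> K_idx"
  shows "subq_iso_L p r 0 (seg 1) {0}"
proof -
  have "subq_iso_L p r 0 (seg 1) (seg 0)"
  proof (rule subq_iso_L_seg[OF closed_seg_lam_max[OF assms] closed_seg_0])
    have "1 + lam = p" using assms(1) p_gt_2 by simp
    then show "(of_nat 0 :: 'a) = of_nat (1 + lam)" using of_nat_eq_0_iff[of p] by simp
  qed auto
  then show ?thesis by (simp add: seg_0)
qed

lemma subq_iso_L_lam_max_upper:
  assumes "lam = p - 1" "\<And>m. m < p \<Longrightarrow> \<alpha>(n := m) \<in> K_idx"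
  shows "subq_iso_L p r (p - 1) (seg p) (seg 1)"
proof (rule subq_iso_L_seg[OF closed_seg_p[OF assms(2)] closed_seg_lam_max[OF assms]])
  show "(of_nat (p - 1) :: 'a) = of_nat (p + lam)" using of_nat_eq_0_iff[of p] assms(1) by simp
  have p: "Suc lam = p" using assms(1) p_gt_2 by simp
  fix C k assume C: "is_submod p r C" "B 1 \<in> C" "1 \<le> k" "k < p"
  show "B k \<in> C"
  proof (rule raise_B[OF C(1,2), of k])
    \<comment> \<open>On t the factor of e_k is 1 + kp, which is 1 in the field.\<close>
    have "\<not> p dvd 1" using p_gt_2 by auto
    then show "\<not> p dvd (1 + k * Suc lam)" unfolding p by (metis dvd_add_left_iff dvd_triv_right)
  qed (use C p_gt_2 in auto)
qed (use p_gt_2 in auto)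

end

section \<open>Assembling the decomposition\<close>

text \<open>V(0) and V(p-1), the only induced modules among the summands, both have the factors L(0)
  and L(p-1).\<close>

definition factors :: "nat \<Rightarrow> summand \<Rightarrow> nat multiset" where
  "factors p s = (case s of SV _ \<Rightarrow> {#0, p - 1#} | SL l \<Rightarrow> {#l#})"

context density_string
begin

lemma seg_eq_DKs:
  assumes "u \<le> p"
  shows "seg u = DKs ((\<lambda>m. \<alpha>(n := m)) ` {..<u})"
proof -
  have "seg u = ds.span (B ` {..<u})"
  proof
    show "seg u \<subseteq> ds.span (B ` {..<u})"
      by (rule seg_least[OF ds.subspace_span]) (auto intro: ds.span_base)
    show "ds.span (B ` {..<u}) \<subseteq> seg u"
      by (rule ds.span_minimal[OF _ subspace_seg]) (auto intro: B_in_seg)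
  qed
  also have "\<dots> = DKs ((\<lambda>m. \<alpha>(n := m)) ` {..<u})"
    using assms by (subst DKs_eq_span) (auto simp: valid_string image_image B_def)
  finally show ?thesis .
qed

text \<open>The series is 0 < derivatives < all for \<open>lam = 0\<close> and 0 < constants < all
  for \<open>lam = p - 1\<close>. Both give L(0) and L(p-1), in opposite order.\<close>

lemma full_string:
  assumes K: "\<And>m. m < p \<Longrightarrow> \<alpha>(n := m) \<in> K_idx"
  shows "summand_iso p r (if lam = 0 \<or> lam = p - 1 then SV lam else SL lam) (seg p)"
    and "labelled_series p r (seg p) (factors p (if lam = 0 \<or> lam = p - 1 then SV lam else SL lam))"
proof -
  note cl = closed_seg_p[OF K]
  have K': "\<alpha>(n := m) \<in> K_idx" if "m < p - 1" for m using that K by simp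
  have p: "p - 1 < p" "0 < p" "p - 1 \<noteq> 0" using p_gt_2 by auto
  consider "lam = 0" | "lam = p - 1" | "1 \<le> lam" "lam \<le> p - 2" "lam \<noteq> 0" "lam \<noteq> p - 1"
    using lam_less by linarith
  then have "summand_iso p r (if lam = 0 \<or> lam = p - 1 then SV lam else SL lam) (seg p)
    \<and> labelled_series p r (seg p) (factors p (if lam = 0 \<or> lam = p - 1 then SV lam else SL lam))"
  proof cases
    case 1
    have "labelled_series p r (seg (p - 1)) {#p - 1#}"
      by (rule labelled_series.step[OF labelled_series.zero p(1) subq_iso_L_lam_0_lower[OF 1 K']])
    then have "labelled_series p r (seg p) {#0, p - 1#}"
      by (rule labelled_series.step[OF _ p(2) subq_iso_L_lam_0_upper[OF 1 K]])
    then show ?thesis using 1 subq_iso_V_seg[OF cl] by (simp add: summand_iso_def factors_def)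
  next
    case 2
    have "labelled_series p r (seg 1) {#0#}"
      by (rule labelled_series.step[OF labelled_series.zero p(2) subq_iso_L_lam_max_lower[OF 2 K]])
    then have "labelled_series p r (seg p) {#p - 1, 0#}"
      by (rule labelled_series.step[OF _ p(1) subq_iso_L_lam_max_upper[OF 2 K]])
    then show ?thesis using 2 subq_iso_V_seg[OF cl]
      by (simp add: summand_iso_def factors_def add_mset_commute)
  next
    case 3
    have L: "subq_iso_L p r lam (seg p) {0}" using subq_iso_L_generic[OF cl 3(1,2)] .
    then have "labelled_series p r (seg p) {#lam#}"
      by (rule labelled_series.step[OF labelled_series.zero lam_less])
    then show ?thesis using 3 L by (simp add: summand_iso_def factors_def)
  qed
  then show "summand_iso p r (if lam = 0 \<or> lam = p - 1 then SV lam else SL lam) (seg p)"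
    and "labelled_series p r (seg p) (factors p (if lam = 0 \<or> lam = p - 1 then SV lam else SL lam))" by auto
qed

lemma truncated_string:
  assumes "lam = 0" "\<And>m. m < p - 1 \<Longrightarrow> \<alpha>(n := m) \<in> K_idx"
  shows "summand_iso p r (SL (p - 1)) (seg (p - 1))"
    and "labelled_series p r (seg (p - 1)) (factors p (SL (p - 1)))"
proof -
  have L: "subq_iso_L p r (p - 1) (seg (p - 1)) {0}" using subq_iso_L_lam_0_lower[OF assms] .
  then show "summand_iso p r (SL (p - 1)) (seg (p - 1))" by (simp add: summand_iso_def)
  show "labelled_series p r (seg (p - 1)) (factors p (SL (p - 1)))"
    using L p_gt_2 by (auto simp: factors_def intro!: labelled_series.step[OF labelled_series.zero])
qed

end

section \<open>Counting exponents by degree modulo p\<close>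

lemma mod_add_complement:
  fixes a x p :: nat
  assumes "p > 0"
  shows "((a + x) mod p + (p - a mod p)) mod p = x mod p"
proof -
  have "a + (p - a mod p) = p * Suc (a div p)"
    using mod_less_divisor[OF assms, of a] mult_div_mod_eq[of p a] unfolding mult_Suc_right by linarith
  then have "a + x + (p - a mod p) = x + p * Suc (a div p)" by simp
  then have "(a + x + (p - a mod p)) mod p = x mod p" by (metis mod_mult_self2)
  then show ?thesis by (simp add: mod_add_left_eq)
qed

lemma valid_idx_Suc:
  "valid_idx p (Suc k) \<alpha> \<longleftrightarrow> valid_idx p k (\<alpha>(Suc k := 0)) \<and> \<alpha> (Suc k) < p"
proof
  assume v: "valid_idx p (Suc k) \<alpha>"
  have i: "(1 \<le> i \<and> i \<le> Suc k \<longrightarrow> \<alpha> i < p) \<and> (\<not> (1 \<le> i \<and> i \<le> Suc k) \<longrightarrow> \<alpha> i = 0)" for i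
    using v unfolding valid_idx_def by blast
  have "(1 \<le> i \<and> i \<le> k \<longrightarrow> (\<alpha>(Suc k := 0)) i < p) \<and> (\<not> (1 \<le> i \<and> i \<le> k) \<longrightarrow> (\<alpha>(Suc k := 0)) i = 0)" for i
    using i[of i] by (cases "i = Suc k") auto
  then show "valid_idx p k (\<alpha>(Suc k := 0)) \<and> \<alpha> (Suc k) < p"
    unfolding valid_idx_def using i[of "Suc k"] by auto
next
  assume v: "valid_idx p k (\<alpha>(Suc k := 0)) \<and> \<alpha> (Suc k) < p"
  have i: "(1 \<le> i \<and> i \<le> k \<longrightarrow> (\<alpha>(Suc k := 0)) i < p) \<and> (\<not> (1 \<le> i \<and> i \<le> k) \<longrightarrow> (\<alpha>(Suc k := 0)) i = 0)" for i
    using v unfolding valid_idx_def by blast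
  show "valid_idx p (Suc k) \<alpha>"
    unfolding valid_idx_def
  proof
    fix i
    show "(1 \<le> i \<and> i \<le> Suc k \<longrightarrow> \<alpha> i < p) \<and> (\<not> (1 \<le> i \<and> i \<le> Suc k) \<longrightarrow> \<alpha> i = 0)"
      using i[of i] v by (cases "i = Suc k") (auto simp: le_Suc_eq)
  qed
qed

lemma valid_idx_upd_0: "valid_idx p k \<alpha> \<Longrightarrow> \<alpha>(Suc k := 0) = \<alpha>"
  by (auto simp: valid_idx_def fun_eq_iff)

lemma card_valid_idx: "card (idxs p k) = p ^ k"
proof (induction k)
  case 0
  have "{\<alpha>. valid_idx p 0 \<alpha>} = {\<lambda>_. 0}" by (auto simp: valid_idx_def fun_eq_iff)
  then show ?case by simp
next
  case (Suc k)
  have "bij_betw (\<lambda>\<alpha>. (\<alpha>(Suc k := 0), \<alpha> (Suc k))) {\<alpha>. valid_idx p (Suc k) \<alpha>} ((idxs p k) \<times> {..<p})"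
    by (rule bij_betw_byWitness[where f' = "\<lambda>(\<alpha>, m). \<alpha>(Suc k := m)"])
      (auto simp: valid_idx_Suc valid_idx_upd_0)
  then have "card {\<alpha>. valid_idx p (Suc k) \<alpha>} = card ((idxs p k) \<times> {..<p})"
    by (rule bij_betw_same_card)
  then show ?case by (simp add: Suc card_cartesian_product)
qed

text \<open>The other k coordinates are free and determine the last one modulo p; \<open>t\<close>
  is its representative below p.\<close>

lemma card_valid_idx_sum:
  assumes "s < p"
  shows "card {\<alpha>. valid_idx p (Suc k) \<alpha> \<and> (\<Sum>j\<in>{1..Suc k}. \<alpha> j) mod p = s} = p ^ k"
proof -
  define t where "t \<beta> = (s + (p - (\<Sum>j\<in>{1..k}. \<beta> j) mod p)) mod p" for \<beta> :: "nat \<Rightarrow> nat"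
  have p: "p > 0" using assms by simp
  have sum_upd: "(\<Sum>j\<in>{1..k}. (\<beta>(Suc k := m)) j) = (\<Sum>j\<in>{1..k}. \<beta> j)" for \<beta> :: "nat \<Rightarrow> nat" and m
    by (rule sum.cong) auto
  have sum_Suc: "(\<Sum>j\<in>{1..Suc k}. \<beta> j) = (\<Sum>j\<in>{1..k}. \<beta> j) + \<beta> (Suc k)" for \<beta> :: "nat \<Rightarrow> nat"
    by simp
  have t_mod: "((\<Sum>j\<in>{1..k}. \<beta> j) + t \<beta>) mod p = s" for \<beta>
  proof -
    let ?b = "\<Sum>j\<in>{1..k}. \<beta> j"
    have "(?b + t \<beta>) mod p = (s + (?b + (p - ?b mod p))) mod p"
      unfolding t_def by (simp add: mod_add_right_eq add_ac)
    also have "(?b + (p - ?b mod p)) = p * Suc (?b div p)"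
      using mod_less_divisor[OF p, of ?b] mult_div_mod_eq[of p ?b] unfolding mult_Suc_right by linarith
    finally show ?thesis using assms by (metis mod_less mod_mult_self2)
  qed
  have t_uniq: "m = t \<beta>" if "((\<Sum>j\<in>{1..k}. \<beta> j) + m) mod p = s" "m < p" for \<beta> m
    using mod_add_complement[OF p, of "\<Sum>j\<in>{1..k}. \<beta> j" m] that by (simp add: t_def)
  have "bij_betw (\<lambda>\<alpha>. \<alpha>(Suc k := 0))
      {\<alpha>. valid_idx p (Suc k) \<alpha> \<and> (\<Sum>j\<in>{1..Suc k}. \<alpha> j) mod p = s} (idxs p k)"
  proof (rule bij_betw_byWitness[where f' = "\<lambda>\<beta>. \<beta>(Suc k := t \<beta>)"])
    show "\<forall>\<alpha>\<in>{\<alpha>. valid_idx p (Suc k) \<alpha> \<and> (\<Sum>j\<in>{1..Suc k}. \<alpha> j) mod p = s}.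
        (\<alpha>(Suc k := 0))(Suc k := t (\<alpha>(Suc k := 0))) = \<alpha>"
    proof (rule ballI)
      fix \<alpha> assume a: "\<alpha> \<in> {\<alpha>. valid_idx p (Suc k) \<alpha> \<and> (\<Sum>j\<in>{1..Suc k}. \<alpha> j) mod p = s}"
      have "\<alpha> (Suc k) = t \<alpha>" using a by (intro t_uniq) (auto simp: valid_idx_Suc sum_Suc)
      moreover have "t (\<alpha>(Suc k := 0)) = t \<alpha>" unfolding t_def sum_upd ..
      ultimately show "(\<alpha>(Suc k := 0))(Suc k := t (\<alpha>(Suc k := 0))) = \<alpha>" by (simp add: fun_eq_iff)
    qed
    show "\<forall>\<beta>\<in>idxs p k. (\<beta>(Suc k := t \<beta>))(Suc k := 0) = \<beta>"
      by (auto simp: valid_idx_upd_0)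
    show "(\<lambda>\<alpha>. \<alpha>(Suc k := 0)) ` {\<alpha>. valid_idx p (Suc k) \<alpha> \<and> (\<Sum>j\<in>{1..Suc k}. \<alpha> j) mod p = s} \<subseteq> (idxs p k)"
      by (auto simp: valid_idx_Suc)
    show "(\<lambda>\<beta>. \<beta>(Suc k := t \<beta>)) ` (idxs p k)
        \<subseteq> {\<alpha>. valid_idx p (Suc k) \<alpha> \<and> (\<Sum>j\<in>{1..Suc k}. \<alpha> j) mod p = s}"
    proof (rule image_subsetI, rule CollectI)
      fix \<beta> assume b: "\<beta> \<in> (idxs p k)"
      have "t \<beta> < p" using p by (simp add: t_def)
      then show "valid_idx p (Suc k) (\<beta>(Suc k := t \<beta>)) \<and> (\<Sum>j\<in>{1..Suc k}. (\<beta>(Suc k := t \<beta>)) j) mod p = s"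
        unfolding sum_Suc sum_upd using b t_mod[of \<beta>] by (auto simp: valid_idx_Suc valid_idx_upd_0)
    qed
  qed
  then show ?thesis using card_valid_idx[of p k] by (simp add: bij_betw_same_card)
qed

section \<open>Strings as fibres over the exponents of the first 2r variables\<close>

context contact
begin

lemma of_nat_eq_iff_mod: "(of_nat a :: 'a) = of_nat b \<longleftrightarrow> a mod p = b mod p"
proof -
  have *: "(of_nat a :: 'a) = of_nat b \<longleftrightarrow> a mod p = b mod p" if "a \<le> b" for a b
  proof -
    have "(of_nat a :: 'a) = of_nat b \<longleftrightarrow> (of_nat (b - a) :: 'a) = 0"
      using that by (simp add: of_nat_diff) metis
    also have "\<dots> \<longleftrightarrow> b mod p = a mod p"
      unfolding of_nat_eq_0_iff using mod_eq_dvd_iff_nat[OF that] by simp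
    finally show ?thesis by auto
  qed
  show ?thesis using *[of a b] *[of b a] by (metis nat_le_linear)
qed

text \<open>Solves 2l + 4 = |\<alpha>| modulo the odd prime p: \<open>(p + 1) div 2\<close> inverts
  2, and \<open>p - 2\<close> stands for -2.\<close>

definition weight_of :: "(nat \<Rightarrow> nat) \<Rightarrow> nat" where
  "weight_of \<alpha> = ((\<Sum>j\<in>J. \<alpha> j) * ((p + 1) div 2) + (p - 2)) mod p"

lemma weight_of_less: "weight_of \<alpha> < p"
  using p_gt_2 by (simp add: weight_of_def)

lemma weight_of: "(of_nat (\<Sum>j\<in>J. \<alpha> j) :: 'a) = of_nat (2 * weight_of \<alpha> + 4)"
proof -
  have odd: "odd p" using prime_p p_gt_2 by (simp add: prime_odd_nat)
  let ?s = "\<Sum>j\<in>J. \<alpha> j"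
  have "(2 * weight_of \<alpha> + 4) mod p = (2 * (?s * ((p + 1) div 2) + (p - 2)) + 4) mod p"
    unfolding weight_of_def by (metis mod_add_left_eq mod_mult_right_eq)
  also have "2 * (?s * ((p + 1) div 2) + (p - 2)) + 4 = ?s + p * (?s + 2)"
    using odd p_gt_2 by (auto elim!: oddE simp: algebra_simps)
  finally show ?thesis unfolding of_nat_eq_iff_mod by (simp only: mod_mult_self2)
qed

lemma weight_of_eq_iff:
  assumes "l < p"
  shows "weight_of \<alpha> = l \<longleftrightarrow> (\<Sum>j\<in>J. \<alpha> j) mod p = (2 * l + 4) mod p"
proof
  assume "weight_of \<alpha> = l"
  then show "(\<Sum>j\<in>J. \<alpha> j) mod p = (2 * l + 4) mod p" using weight_of[of \<alpha>] unfolding of_nat_eq_iff_mod by simp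
next
  assume "(\<Sum>j\<in>J. \<alpha> j) mod p = (2 * l + 4) mod p"
  then have "(of_nat (2 * weight_of \<alpha> + 4) :: 'a) = of_nat (2 * l + 4)"
    using weight_of[of \<alpha>] unfolding of_nat_eq_iff_mod by simp
  then have "2 * (of_nat (weight_of \<alpha>) :: 'a) = 2 * of_nat l" by simp
  then have "(of_nat (weight_of \<alpha>) :: 'a) = of_nat l" using two_neq_0 by (metis mult_left_cancel)
  then show "weight_of \<alpha> = l" unfolding of_nat_eq_iff_mod using assms weight_of_less by simp
qed

abbreviation base_idx :: "(nat \<Rightarrow> nat) set" where
  "base_idx \<equiv> {\<alpha>. valid_idx p (2*r) \<alpha>}"

lemma card_weight:
  assumes "l < p"
  shows "card {\<alpha> \<in> base_idx. weight_of \<alpha> = l} = p ^ (2*r - 1)"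
proof -
  have r: "Suc (2*r - 1) = 2*r" using r_pos by simp
  have "{\<alpha> \<in> base_idx. weight_of \<alpha> = l}
     = {\<alpha>. valid_idx p (Suc (2*r - 1)) \<alpha> \<and> (\<Sum>j\<in>{1..Suc (2*r - 1)}. \<alpha> j) mod p = (2 * l + 4) mod p}"
    unfolding r weight_of_eq_iff[OF assms] J_def by auto
  then show ?thesis using card_valid_idx_sum[of "(2 * l + 4) mod p" p "2*r - 1"] p_gt_2 by simp
qed

lemma density_string: "\<alpha> \<in> base_idx \<Longrightarrow> density_string TYPE('a) p r n \<alpha> (weight_of \<alpha>)"
  using weight_of_less weight_of by unfold_locales auto

text \<open>The exponent whose string would end in the top monomial, in the case where that monomial
  is missing from K(2r+1).\<close>

definition exceptional :: "(nat \<Rightarrow> nat) \<Rightarrow> bool" where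
  "exceptional \<alpha> \<longleftrightarrow> (2*r+4) mod p = 0 \<and> \<alpha> = top_idx(n := 0)"

definition fibre :: "(nat \<Rightarrow> nat) \<Rightarrow> (nat \<Rightarrow> nat) set" where
  "fibre \<alpha> = (\<lambda>m. \<alpha>(n := m)) ` {..<(if exceptional \<alpha> then p - 1 else p)}"

definition label :: "(nat \<Rightarrow> nat) \<Rightarrow> summand" where
  "label \<alpha> = (if exceptional \<alpha> then SL (p - 1)
     else if weight_of \<alpha> = 0 \<or> weight_of \<alpha> = p - 1 then SV (weight_of \<alpha>) else SL (weight_of \<alpha>))"

lemma base_idx_n: "\<alpha> \<in> base_idx \<Longrightarrow> \<alpha> n = 0"
  by (simp add: valid_idx_def n_eq)

lemma base_idx_upd: "\<gamma>(n := 0) \<in> base_idx \<and> \<gamma> n < p \<longleftrightarrow> valid_idx p n \<gamma>"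
  using valid_idx_Suc[of p "2*r" \<gamma>] n_eq by simp

lemma string_K_idx:
  assumes "\<alpha> \<in> base_idx" "m < p"
  shows "\<alpha>(n := m) \<in> K_idx \<longleftrightarrow> \<not> (exceptional \<alpha> \<and> m = p - 1)"
proof -
  have v: "valid_idx p n (\<alpha>(n := m))"
    using base_idx_upd[of "\<alpha>(n := m)"] assms base_idx_n[OF assms(1)] by (simp add: fun_upd_idem)
  have "\<alpha>(n := m) = top_idx \<longleftrightarrow> \<alpha> = top_idx(n := 0) \<and> m = p - 1"
  proof
    assume e: "\<alpha>(n := m) = top_idx"
    have "\<alpha> = (\<alpha>(n := m))(n := 0)" using base_idx_n[OF assms(1)] by (simp add: fun_upd_idem)
    moreover have "top_idx n = p - 1" using n_pos by (simp add: top_idx_def)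
    ultimately show "\<alpha> = top_idx(n := 0) \<and> m = p - 1" using e by (metis fun_upd_same)
  next
    assume "\<alpha> = top_idx(n := 0) \<and> m = p - 1"
    then show "\<alpha>(n := m) = top_idx" using n_pos by (auto simp: top_idx_def fun_eq_iff)
  qed
  with v show ?thesis by (auto simp: K_idx_def exceptional_def)
qed

lemma fibre_iff:
  assumes "\<alpha> \<in> base_idx"
  shows "\<gamma> \<in> fibre \<alpha> \<longleftrightarrow> \<gamma> \<in> K_idx \<and> \<alpha> = \<gamma>(n := 0)"
proof
  assume "\<gamma> \<in> fibre \<alpha>"
  then obtain m where m: "\<gamma> = \<alpha>(n := m)" "m < (if exceptional \<alpha> then p - 1 else p)" by (auto simp: fibre_def)
  then have "m < p" "\<not> (exceptional \<alpha> \<and> m = p - 1)" by (auto split: if_splits)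
  then show "\<gamma> \<in> K_idx \<and> \<alpha> = \<gamma>(n := 0)"
    using string_K_idx[OF assms, of m] m base_idx_n[OF assms] by (simp add: fun_upd_idem)
next
  assume g: "\<gamma> \<in> K_idx \<and> \<alpha> = \<gamma>(n := 0)"
  then have e: "\<gamma> = \<alpha>(n := \<gamma> n)" by simp
  have p: "\<gamma> n < p" using g base_idx_upd[of \<gamma>] by (simp add: K_idx_def)
  have "\<not> (exceptional \<alpha> \<and> \<gamma> n = p - 1)" using string_K_idx[OF assms p] g e by simp
  then have "\<gamma> n < (if exceptional \<alpha> then p - 1 else p)" using p by auto
  then show "\<gamma> \<in> fibre \<alpha>" unfolding fibre_def using e by blast
qed

lemma fibre_union: "(\<Union>\<alpha>\<in>base_idx. fibre \<alpha>) = K_idx"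
proof -
  have "\<gamma>(n := 0) \<in> base_idx" if "\<gamma> \<in> K_idx" for \<gamma>
    using that base_idx_upd[of \<gamma>] by (simp add: K_idx_def)
  then show ?thesis using fibre_iff by blast
qed

text \<open>Here |\<alpha>| = 2r(p-1), which is -2r and hence 4 modulo p, so 2l + 4 = |\<alpha>| is
  solved by l = 0.\<close>

lemma exceptional_weight: "exceptional \<alpha> \<Longrightarrow> weight_of \<alpha> = 0"
proof -
  assume e: "exceptional \<alpha>"
  have "\<alpha> j = p - 1" if "j \<in> J" for j
    using e J_bounds[OF that] by (auto simp: exceptional_def top_idx_def)
  then have s: "(\<Sum>j\<in>J. \<alpha> j) = 2*r*(p-1)" by (simp add: J_def)
  have "(of_nat (2*r*(p-1)) :: 'a) = of_nat (2 * 0 + 4)"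
  proof -
    have m1: "(of_nat (p - 1) :: 'a) = - 1"
      using p_gt_2 of_nat_eq_0_iff[of p] by (simp add: of_nat_diff)
    have "(of_nat (2*r+4) :: 'a) = 0"
      unfolding of_nat_eq_0_iff using e by (auto simp: exceptional_def)
    then have "(of_nat (2*r) :: 'a) = - 4" by (simp add: eq_neg_iff_add_eq_0)
    then show ?thesis unfolding of_nat_mult[of "2*r"] m1 by simp
  qed
  then show "weight_of \<alpha> = 0"
    unfolding of_nat_eq_iff_mod using s p_gt_2 by (subst weight_of_eq_iff) auto
qed

lemma fibre_summand:
  assumes "\<alpha> \<in> base_idx"
  shows "summand_iso p r (label \<alpha>) (DKs (fibre \<alpha>))" "labelled_series p r (DKs (fibre \<alpha>)) (factors p (label \<alpha>))"
proof -
  interpret st: density_string p r n ty \<alpha> "weight_of \<alpha>" by (rule density_string[OF assms])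
  have "summand_iso p r (label \<alpha>) (DKs (fibre \<alpha>)) \<and> labelled_series p r (DKs (fibre \<alpha>)) (factors p (label \<alpha>))"
  proof (cases "exceptional \<alpha>")
    case True
    have K: "\<alpha>(n := m) \<in> K_idx" if "m < p - 1" for m using string_K_idx[OF assms, of m] that by auto
    have "DKs (fibre \<alpha>) = st.seg (p - 1)" using True by (simp add: fibre_def st.seg_eq_DKs)
    then show ?thesis using st.truncated_string[OF exceptional_weight[OF True] K] True by (simp add: label_def)
  next
    case False
    have K: "\<alpha>(n := m) \<in> K_idx" if "m < p" for m using string_K_idx[OF assms that] False by auto
    have "DKs (fibre \<alpha>) = st.seg p" using False by (simp add: fibre_def st.seg_eq_DKs)
    then show ?thesis using st.full_string[OF K] False by (simp add: label_def)
  qed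
  then show "summand_iso p r (label \<alpha>) (DKs (fibre \<alpha>))" "labelled_series p r (DKs (fibre \<alpha>)) (factors p (label \<alpha>))"
    by auto
qed

lemma DKs_Un: "DKs (S \<union> S') = msum (DKs S) (DKs S')"
proof
  show "DKs (S \<union> S') \<subseteq> msum (DKs S) (DKs S')"
  proof
    fix x assume "x \<in> DKs (S \<union> S')"
    then obtain f where f: "x = DK p r f" "\<forall>\<gamma>. f \<gamma> \<noteq> 0 \<longrightarrow> \<gamma> \<in> S \<union> S'" unfolding DKs_def by blast
    let ?g = "\<lambda>\<gamma>. if \<gamma> \<in> S then f \<gamma> else 0" and ?h = "\<lambda>\<gamma>. if \<gamma> \<in> S then 0 else f \<gamma>"
    have "f = ?g + ?h" by (auto simp: fun_eq_iff)
    then have x: "x = DK p r ?g + DK p r ?h" unfolding f(1) DK_add[symmetric] by (rule arg_cong)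
    have "DK p r ?g \<in> DKs S" unfolding DKs_def by (rule imageI) auto
    moreover have "DK p r ?h \<in> DKs S'" unfolding DKs_def by (rule imageI) (use f in auto)
    ultimately show "x \<in> msum (DKs S) (DKs S')" unfolding x by (rule msumI)
  qed
  show "msum (DKs S) (DKs S') \<subseteq> DKs (S \<union> S')"
    by (rule msum_least[OF subspace_DKs]) (auto simp: DKs_def)
qed

lemma DKs_disjoint:
  assumes "S \<inter> S' = {}"
  shows "DKs S \<inter> DKs S' = {0}"
proof
  show "{0} \<subseteq> DKs S \<inter> DKs S'" using zero_in_DKs by auto
  show "DKs S \<inter> DKs S' \<subseteq> {0}"
  proof
    fix x assume "x \<in> DKs S \<inter> DKs S'"
    then obtain f g where fg: "x = DK p r f" "x = DK p r g" "\<forall>\<gamma>. f \<gamma> \<noteq> 0 \<longrightarrow> \<gamma> \<in> S" "\<forall>\<gamma>. g \<gamma> \<noteq> 0 \<longrightarrow> \<gamma> \<in> S'"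
      unfolding DKs_def by blast
    have "DK p r (f + sc (-1) g) = 0" unfolding DK_add DK_sc using fg by simp
    then have "f + sc (-1) g = 0" by (rule DK_inj)
    then have "(f + sc (-1) g) \<gamma> = 0" for \<gamma> by (simp only: zero_fun_apply)
    then have "f \<gamma> = g \<gamma>" for \<gamma> by (simp add: sc_apply)
    then have "f = 0" using fg assms by (auto simp: fun_eq_iff)
    then show "x \<in> {0}" using fg by simp
  qed
qed

lemma DKs_empty: "DKs {} = {0}"
  using DKs_disjoint[of "{}" "{}"] by simp

lemma labelled_series_union:
  assumes "distinct as" "set as \<subseteq> base_idx"
  shows "labelled_series p r (DKs (\<Union>\<alpha>\<in>set as. fibre \<alpha>)) (\<Sum>\<alpha>\<leftarrow>as. factors p (label \<alpha>))"
  using assms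
proof (induction as)
  case Nil
  have "labelled_series p r (DKs {}) {#}" unfolding DKs_empty by (rule labelled_series.zero)
  then show ?case by simp
next
  case (Cons \<alpha> as)
  have "fibre \<alpha> \<inter> (\<Union>\<alpha>\<in>set as. fibre \<alpha>) = {}"
    using Cons.prems fibre_iff by fastforce
  then have "DKs (fibre \<alpha>) \<inter> DKs (\<Union>\<alpha>\<in>set as. fibre \<alpha>) = {0}" by (rule DKs_disjoint)
  moreover have "labelled_series p r (DKs (fibre \<alpha>)) (factors p (label \<alpha>))"
    using Cons.prems by (intro fibre_summand) simp
  moreover have "labelled_series p r (DKs (\<Union>\<alpha>\<in>set as. fibre \<alpha>)) (\<Sum>\<alpha>\<leftarrow>as. factors p (label \<alpha>))"
    using Cons by simp
  ultimately show ?case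
    using labelled_series_direct_sum by (simp add: DKs_Un)
qed

lemma sum_nth_set:
  assumes "distinct as"
  shows "(\<Sum>i<length as. g (as ! i)) = (\<Sum>x\<in>set as. g x)"
  using sum.reindex_bij_betw[OF bij_betw_nth[OF assms refl refl], of g] .

text \<open>The fibres partition \<open>K_idx\<close>. By injectivity of \<open>DK\<close>,
  decomposing an element means cutting its coefficient function along the fibres.\<close>

lemma direct_decomp_fibres:
  assumes "distinct as" "set as = base_idx"
  shows "direct_decomp p r (map (\<lambda>\<alpha>. (label \<alpha>, DKs (fibre \<alpha>))) as)"
proof -
  have mem: "as ! i \<in> base_idx" if "i < length as" for i using that assms by (metis nth_mem)
  have 1: "is_submod p r (DKs (fibre (as ! i)))" if "i < length as" for i
    using fibre_summand(2)[OF mem[OF that]] by (rule labelled_series_submod)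
  have 2: "\<exists>v. (\<forall>i<length as. v i \<in> DKs (fibre (as ! i))) \<and> x = (\<Sum>i<length as. v i)" if x: "x \<in> Kalg p r" for x
  proof -
    from x obtain f where f: "x = DK p r f" "\<forall>\<gamma>. f \<gamma> \<noteq> 0 \<longrightarrow> \<gamma> \<in> K_idx" unfolding Kalg_eq DKs_def by blast
    define g where "g \<alpha> = (\<lambda>\<gamma>. if \<gamma> \<in> fibre \<alpha> then f \<gamma> else 0)" for \<alpha>
    have "(\<Sum>\<alpha>\<in>base_idx. g \<alpha>) \<gamma> = f \<gamma>" for \<gamma>
    proof (cases "\<gamma> \<in> K_idx")
      case True
      then have b: "\<gamma>(n := 0) \<in> base_idx" using base_idx_upd[of \<gamma>] by (simp add: K_idx_def)
      have "(\<Sum>\<alpha>\<in>base_idx. g \<alpha> \<gamma>) = (\<Sum>\<alpha>\<in>base_idx. if \<alpha> = \<gamma>(n := 0) then f \<gamma> else 0)"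
        using True fibre_iff by (intro sum.cong) (auto simp: g_def)
      also have "\<dots> = f \<gamma>" using b by (subst sum.delta[OF finite_valid_idx]) auto
      finally show ?thesis by (simp add: sum_fun_apply)
    next
      case False
      then have "f \<gamma> = 0" using f by blast
      then show ?thesis by (auto simp: sum_fun_apply g_def intro!: sum.neutral)
    qed
    then have "f = (\<Sum>\<alpha>\<in>base_idx. g \<alpha>)" by (simp add: fun_eq_iff)
    then have "x = (\<Sum>\<alpha>\<in>base_idx. DK p r (g \<alpha>))" unfolding f(1) DK_sum[symmetric] by (rule arg_cong)
    also have "\<dots> = (\<Sum>i<length as. DK p r (g (as ! i)))"
      using sum_nth_set[OF assms(1), of "\<lambda>\<alpha>. DK p r (g \<alpha>)"] assms(2) by simp
    finally have "x = (\<Sum>i<length as. DK p r (g (as ! i)))" .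
    moreover have "DK p r (g \<alpha>) \<in> DKs (fibre \<alpha>)" for \<alpha>
      unfolding DKs_def by (rule imageI) (auto simp: g_def)
    ultimately show ?thesis by (intro exI[of _ "\<lambda>i. DK p r (g (as ! i))"]) simp
  qed
  have 3: "v i = 0" if v: "\<And>i. i < length as \<Longrightarrow> v i \<in> DKs (fibre (as ! i))"
      and z: "(\<Sum>i<length as. v i) = 0" and i: "i < length as" for v i
  proof -
    have "\<forall>j. \<exists>f. j < length as \<longrightarrow> v j = DK p r f \<and> (\<forall>\<gamma>. f \<gamma> \<noteq> 0 \<longrightarrow> \<gamma> \<in> fibre (as ! j))"
      using v unfolding DKs_def by blast
    then obtain f where f: "\<And>j. j < length as \<Longrightarrow> v j = DK p r (f j)"
        "\<And>j \<gamma>. j < length as \<Longrightarrow> f j \<gamma> \<noteq> 0 \<Longrightarrow> \<gamma> \<in> fibre (as ! j)" by metis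
    have "DK p r (\<Sum>j<length as. f j) = 0" using z f(1) by (simp add: DK_sum)
    then have s: "(\<Sum>j<length as. f j) = 0" by (rule DK_inj)
    have "f i \<gamma> = 0" for \<gamma>
    proof (rule ccontr)
      assume nz: "f i \<gamma> \<noteq> 0"
      then have gi: "as ! i = \<gamma>(n := 0)" using f(2)[OF i] fibre_iff[OF mem[OF i]] by blast
      have "(\<Sum>j<length as. f j \<gamma>) = (\<Sum>j<length as. if j = i then f i \<gamma> else 0)"
      proof (rule sum.cong)
        fix j assume "j \<in> {..<length as}"
        then have j: "j < length as" by simp
        have "f j \<gamma> = 0" if "j \<noteq> i"
        proof (rule ccontr)
          assume "f j \<gamma> \<noteq> 0"
          then have "as ! j = \<gamma>(n := 0)" using f(2)[OF j] fibre_iff[OF mem[OF j]] by blast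
          then show False using gi that nth_eq_iff_index_eq[OF assms(1) j i] by simp
        qed
        then show "f j \<gamma> = (if j = i then f i \<gamma> else 0)" by auto
      qed simp
      then show False using fun_cong[OF s, of \<gamma>] nz i by (simp add: sum_fun_apply)
    qed
    then have "f i = 0" by (simp add: fun_eq_iff)
    then show ?thesis using f(1)[OF i] by simp
  qed
  show ?thesis
    unfolding direct_decomp_def length_map
  proof (intro conjI allI impI ballI)
    show "is_submod p r (snd (map (\<lambda>\<alpha>. (label \<alpha>, DKs (fibre \<alpha>))) as ! i))" if "i < length as" for i
      using 1[OF that] that by simp
    show "\<exists>v. (\<forall>i<length as. v i \<in> snd (map (\<lambda>\<alpha>. (label \<alpha>, DKs (fibre \<alpha>))) as ! i)) \<and> x = (\<Sum>i<length as. v i)"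
      if x: "x \<in> Kalg p r" for x
    proof -
      obtain v where "\<forall>i<length as. v i \<in> DKs (fibre (as ! i))" "x = (\<Sum>i<length as. v i)"
        using 2[OF x] by blast
      then show ?thesis by (intro exI[of _ v]) auto
    qed
    show "v i = 0" if v: "(\<forall>i<length as. v i \<in> snd (map (\<lambda>\<alpha>. (label \<alpha>, DKs (fibre \<alpha>))) as ! i)) \<and> (\<Sum>i<length as. v i) = 0"
        and i: "i < length as" for v i
    proof (rule 3[OF _ _ i])
      show "v j \<in> DKs (fibre (as ! j))" if "j < length as" for j
        using conjunct1[OF v, rule_format, OF that] that by simp
      show "(\<Sum>i<length as. v i) = 0" using conjunct2[OF v] .
    qed
  qed
qed

lemma mset_weights: "image_mset weight_of (mset_set base_idx) = (\<Sum>l<p. replicate_mset (p ^ (2*r - 1)) l)"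
proof (rule multiset_eqI)
  fix l
  have "count (image_mset weight_of (mset_set base_idx)) l = card {\<alpha> \<in> base_idx. weight_of \<alpha> = l}"
    by (simp add: count_image_mset' finite_valid_idx) (rule arg_cong[where f = card], auto)
  also have "\<dots> = (if l < p then p ^ (2*r - 1) else 0)"
  proof (cases "l < p")
    case False
    then have "{\<alpha> \<in> base_idx. weight_of \<alpha> = l} = {}" using weight_of_less by auto
    then show ?thesis using False by (simp only: card.empty if_False)
  qed (use card_weight[of l] in simp)
  also have "\<dots> = count (\<Sum>l<p. replicate_mset (p ^ (2*r - 1)) l) l"
    by (simp add: count_sum)
  finally show "count (image_mset weight_of (mset_set base_idx)) l = count (\<Sum>l<p. replicate_mset (p ^ (2*r - 1)) l) l" .
qed

lemma top_base: "top_idx(n := 0) \<in> base_idx"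
proof -
  have "valid_idx p n top_idx" using p_gt_2 by (auto simp: valid_idx_def top_idx_def)
  then show ?thesis using base_idx_upd[of top_idx] by simp
qed

text \<open>All exponents are counted with the label \<open>tag\<close> that depends on the weight
  alone. If p divides 2r + 4, the exceptional exponent then turns exactly one \<open>SV 0\<close>
  into \<open>SL (p - 1)\<close>.\<close>

lemma mset_labels:
  "image_mset label (mset_set base_idx) =
     (if (2*r+4) mod p = 0 then
        replicate_mset (p^(2*r-1) - 1) (SV 0) + replicate_mset (p^(2*r-1)) (SV (p-1))
        + (\<Sum>i\<in>{1..p-2}. replicate_mset (p^(2*r-1)) (SL i)) + {#SL (p-1)#}
      else
        replicate_mset (p^(2*r-1)) (SV 0) + replicate_mset (p^(2*r-1)) (SV (p-1))
        + (\<Sum>i\<in>{1..p-2}. replicate_mset (p^(2*r-1)) (SL i)))"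
proof -
  let ?P = "p ^ (2*r - 1)"
  define tag where "tag l = (if l = 0 \<or> l = p - 1 then SV l else SL l)" for l
  let ?R = "replicate_mset ?P (SV (p-1)) + (\<Sum>i\<in>{1..p-2}. replicate_mset ?P (SL i))"
  have set: "{..<p} = insert 0 (insert (p - 1) {1..p-2})" using p_gt_2 by auto
  have "image_mset (\<lambda>\<alpha>. tag (weight_of \<alpha>)) (mset_set base_idx) = image_mset tag (\<Sum>l<p. replicate_mset ?P l)"
    unfolding mset_weights[symmetric] image_mset.compositionality comp_def ..
  also have "\<dots> = (\<Sum>l<p. replicate_mset ?P (tag l))"
  proof -
    have "image_mset tag (\<Sum>l\<in>A. replicate_mset k l) = (\<Sum>l\<in>A. replicate_mset k (tag l))"
      if "finite A" for A k using that by (induction A rule: finite_induct) auto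
    then show ?thesis by simp
  qed
  also have "\<dots> = replicate_mset ?P (tag 0) + (replicate_mset ?P (tag (p - 1)) + (\<Sum>l\<in>{1..p-2}. replicate_mset ?P (tag l)))"
  proof -
    have "0 \<notin> insert (p - 1) {1..p-2}" "p - 1 \<notin> {1..p-2}" using p_gt_2 by auto
    then show ?thesis unfolding set by (simp only: sum.insert finite_insert finite_atLeastAtMost not_False_eq_True)
  qed
  also have "(\<Sum>l\<in>{1..p-2}. replicate_mset ?P (tag l)) = (\<Sum>i\<in>{1..p-2}. replicate_mset ?P (SL i))"
    by (rule sum.cong) (auto simp: tag_def)
  finally have all: "image_mset (\<lambda>\<alpha>. tag (weight_of \<alpha>)) (mset_set base_idx) = replicate_mset ?P (SV 0) + ?R"
    by (simp add: tag_def)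
  show ?thesis
  proof (cases "(2*r+4) mod p = 0")
    case False
    then have "label \<alpha> = tag (weight_of \<alpha>)" for \<alpha> by (simp add: label_def exceptional_def tag_def)
    then have "label = (\<lambda>\<alpha>. tag (weight_of \<alpha>))" ..
    then show ?thesis using False all by (simp add: add.assoc)
  next
    case True
    define t where "t = top_idx(n := 0)"
    have ex: "exceptional \<alpha> \<longleftrightarrow> \<alpha> = t" for \<alpha> using True by (simp add: exceptional_def t_def)
    have ins: "mset_set base_idx = add_mset t (mset_set (base_idx - {t}))"
      unfolding t_def by (rule mset_set.remove[OF finite_valid_idx top_base])
    have rest: "image_mset label (mset_set (base_idx - {t})) = image_mset (\<lambda>\<alpha>. tag (weight_of \<alpha>)) (mset_set (base_idx - {t}))"
      by (rule image_mset_cong) (auto simp: label_def ex tag_def finite_valid_idx)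
    have P: "?P = Suc (?P - 1)" using p_gt_2 by simp
    have "tag (weight_of t) = SV 0" using exceptional_weight[of t] ex by (simp add: tag_def)
    then have "add_mset (SV 0) (image_mset label (mset_set (base_idx - {t}))) = replicate_mset ?P (SV 0) + ?R"
      using all unfolding ins rest by simp
    also have "replicate_mset ?P (SV 0) = add_mset (SV 0) (replicate_mset (?P - 1) (SV 0))"
      by (subst P) (simp only: replicate_mset_Suc)
    finally have "image_mset label (mset_set (base_idx - {t})) = replicate_mset (?P - 1) (SV 0) + ?R" by simp
    moreover have "label t = SL (p - 1)" using ex by (simp add: label_def)
    ultimately show ?thesis using True unfolding ins by (simp add: add.assoc)
  qed
qed

end

lemma sum_factors_sum:
  "finite A \<Longrightarrow> (\<Sum>\<^sub># (image_mset f (\<Sum>i\<in>A. M i))) = (\<Sum>i\<in>A. \<Sum>\<^sub># (image_mset f (M i)))"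
  by (induction A rule: finite_induct) auto

lemma sum_factors_SV:
  "(\<Sum>\<^sub># (image_mset (factors p) (replicate_mset k (SV l)))) = replicate_mset k 0 + replicate_mset k (p - 1)"
  by (induction k) (auto simp: factors_def)

lemma sum_factors_SL: "(\<Sum>\<^sub># (image_mset (factors p) (replicate_mset k (SL l)))) = replicate_mset k l"
  by (induction k) (auto simp: factors_def)

theorem theorem6p2:
  fixes p r :: nat
  assumes "CHAR('a::field) = p" and "prime p" and "p > 2"
    and "alg_closed TYPE('a)" and "r \<ge> 1"
  shows "(\<exists>Ns :: (summand \<times> 'a der set) list. direct_decomp p r Ns
           \<and> (\<forall>(s, N)\<in>set Ns. summand_iso p r s N)
           \<and> mset (map fst Ns) =
               (if (2*r+4) mod p = 0 then
                  replicate_mset (p^(2*r-1) - 1) (SV 0) + replicate_mset (p^(2*r-1)) (SV (p-1))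
                  + (\<Sum>i\<in>{1..p-2}. replicate_mset (p^(2*r-1)) (SL i)) + {#SL (p-1)#}
                else
                  replicate_mset (p^(2*r-1)) (SV 0) + replicate_mset (p^(2*r-1)) (SV (p-1))
                  + (\<Sum>i\<in>{1..p-2}. replicate_mset (p^(2*r-1)) (SL i))))
       \<and> comp_factors_are p r
           (if (2*r+4) mod p = 0 then
              replicate_mset (2*p^(2*r-1) - 1) 0 + (\<Sum>i\<in>{1..p-2}. replicate_mset (p^(2*r-1)) i)
              + replicate_mset (2*p^(2*r-1)) (p-1)
            else
              replicate_mset (2*p^(2*r-1)) 0 + (\<Sum>i\<in>{1..p-2}. replicate_mset (p^(2*r-1)) i)
              + replicate_mset (2*p^(2*r-1)) (p-1)) TYPE('a)"
    (is "?decomp \<and> comp_factors_are p r ?factors TYPE('a)")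
proof -
  interpret contact p r "2*r+1" "TYPE('a)"
    using assms by unfold_locales auto
  obtain as where as: "set as = base_idx" "distinct as"
    using finite_distinct_list[OF finite_valid_idx] by blast
  let ?Ns = "map (\<lambda>\<alpha>. (label \<alpha>, DKs (fibre \<alpha>))) as"
  have "mset as = mset_set base_idx" using mset_set_set[OF as(2)] as(1) by simp
  then have labels: "mset (map label as) = image_mset label (mset_set base_idx)" by simp
  have fst: "map fst ?Ns = map label as" by simp
  have ?decomp
  proof (intro exI conjI)
    show "direct_decomp p r ?Ns" using as(2,1) by (rule direct_decomp_fibres)
    show "\<forall>(s, N)\<in>set ?Ns. summand_iso p r s N" using fibre_summand(1) as(1) by auto
  qed (unfold fst labels, rule mset_labels)
  moreover have "comp_factors_are p r ?factors TYPE('a)"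
  proof (rule comp_factors_areI)
    define P where "P = p ^ (2*r - 1)"
    have P: "P > 0" using p_gt_2 by (simp add: P_def)
    have "(\<Sum>\<alpha>\<leftarrow>as. factors p (label \<alpha>)) = (\<Sum>\<^sub># (image_mset (factors p) (mset (map label as))))"
      by (simp flip: sum_mset_sum_list add: image_mset.compositionality comp_def)
    also have "\<dots> = ?factors"
    proof (cases "(2*r+4) mod p = 0")
      case True
      have "(\<Sum>\<^sub># (image_mset (factors p) (mset (map label as))))
          = replicate_mset (P - 1) 0 + replicate_mset (P - 1) (p - 1)
            + (replicate_mset P 0 + replicate_mset P (p - 1)) + (\<Sum>i\<in>{1..p-2}. replicate_mset P i) + {#p - 1#}"
        unfolding labels mset_labels P_def if_P[OF True] image_mset_union sum_mset.union sum_factors_SV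
          sum_factors_sum[OF finite_atLeastAtMost] sum_factors_SL by (simp add: factors_def)
      \<comment> \<open>L(0) is counted (P - 1) + P times. L(p-1) is counted (P - 1) + P + 1 times,
        the last from the exceptional string; this is 2P in \<open>nat\<close> because P is
        positive.\<close>
      also have "\<dots> = ?factors"
        unfolding if_P[OF True] P_def[symmetric] using P by (intro multiset_eqI) auto
      finally show ?thesis .
    next
      case False
      have "(\<Sum>\<^sub># (image_mset (factors p) (mset (map label as))))
          = replicate_mset P 0 + replicate_mset P (p - 1)
            + (replicate_mset P 0 + replicate_mset P (p - 1)) + (\<Sum>i\<in>{1..p-2}. replicate_mset P i)"
        unfolding labels mset_labels P_def if_not_P[OF False] image_mset_union sum_mset.union sum_factors_SV
          sum_factors_sum[OF finite_atLeastAtMost] sum_factors_SL ..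
      also have "\<dots> = ?factors"
        unfolding if_not_P[OF False] P_def[symmetric] by (intro multiset_eqI) auto
      finally show ?thesis .
    qed
    finally have "(\<Sum>\<alpha>\<leftarrow>as. factors p (label \<alpha>)) = ?factors" .
    moreover have "labelled_series p r (DKs (\<Union>\<alpha>\<in>set as. fibre \<alpha>)) (\<Sum>\<alpha>\<leftarrow>as. factors p (label \<alpha>))"
      by (rule labelled_series_union[OF as(2)]) (simp add: as(1))
    ultimately show "labelled_series p r (Kalg p r :: 'a der set) ?factors"
      unfolding as(1) fibre_union Kalg_eq[symmetric] by (simp only:)
  qed
  ultimately show ?thesis ..
qed

end
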